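(* Let $f,m\in R[x]$ be monic with $1\le\deg(f)<\deg(m)=n$, let $e\in\mathbb{Z}^+$, and let $\ell_{\max}=\max(\mathcal{L}(\Gamma_e(f,m)))$. The height algorithm described in the context, on input $f,m,p,e,\ell_{\max}$, correctly computes the height of the trees in the functional graph of the linear finite dynamical system $(R_e[x]/\langle m\rangle,\Gamma_e(f,m))$, in time $$O^{\sim}(n^2\cdot e^2\cdot\mathcal{M}_e(n)).$$
   Context: Let $p$ be a prime, $h\in\mathbb{Z}[t]$ monic of degree $d\ge1$ and irreducible modulo $p$, $q=p^d$, and $R=\mathbb{Z}[t]/\langle h\rangle$. For $e\ge1$ let $R_e=R/\langle p^e\rangle$, $R_1=\mathbb{F}_q$; $\bar z$ denotes reduction mod $p$. A congruence mod $(m,p^e)$ is a congruence mod the ideal generated by $m$ and $p^e$ in $R[x]$. $\Gamma_e(f,m)$ is the map $R_e[x]/\langle m\rangle\to R_e[x]/\langle m\rangle$, $z\mapsto fz$. For a self-map $\Gamma$ of a finite set $X$ and $x\in X$, let $\tau\ge0$, $\ell\ge1$ be the least integers with $\Gamma^{\tau+\ell}(x)=\Gamma^\tau(x)$; $\mathrm{per}(\Gamma,x):=\ell$ and $\mathcal{L}(\Gamma)=\{\mathrm{per}(\Gamma,x):x\in X\}$. The functional graph of $(X,\Gamma)$ has vertex set $X$ and edges $x\to\Gamma(x)$; each weakly connected component is a cycle whose vertices are roots of (possibly trivial) trees directed toward the root. The height of a tree is the maximum number of edges on a path from a leaf to the root (0 for a trivial tree), and the height of the system is the maximum height of its trees.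 Height algorithm. 1. Factor $\bar f=G_1^{k_1}\cdots G_s^{k_s}$ over $\mathbb{F}_q$ into powers of distinct irreducible polynomials. 2. Let $M_2=\bar m/M_1$, where $M_1$ is the greatest monic divisor of $\bar m$ coprime to $\bar f$. Compute $\tau=\max\{\lceil\kappa_{G_i}(M_2)/\kappa_{G_i}(\bar f)\rceil:G_i\mid\bar f\}$, where $\kappa_{G}(z)$ is the exponent of $G$ in $z$. 3. Set $r=e\tau$ and $l=\tau$. 4. While $l\le r$: set $h=l+\lfloor(r-l)/2\rfloor$; if $f^{h+\ell_{\max}}\equiv f^{h}\pmod{(m,p^e)}$ set $r=h-1$, else set $l=h+1$. 5. With the last value of $h$: if $f^{h+\ell_{\max}}\equiv f^{h}\pmod{(m,p^e)}$ return $h$, else return $h+1$. Cost conventions. $\mathcal{M}_e(n)$ is the cost of multiplying two polynomials of degree less than $n$ over $R_e$; $O^{\sim}$ suppresses polylogarithmic factors (in $n$, $e$ and $q$); multiplication and division with remainder cost $O(\mathcal{M}_e(n))$, (probabilistic) factorization over $\mathbb{F}_q$ costs $O(n\,\mathcal{M}_1(n)\log(nq))$, and modular exponentiation with exponent $k$ costs $O(\mathcal{M}_e(n)\log k)$. *)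

theory Defs
  imports
    "HOL-Computational_Algebra.Computational_Algebra"
    "HOL-Library.Monad_Syntax"
    "HOL-Algebra.IntRing"
    "HOL-Algebra.UnivPoly"
    "HOL-Algebra.Ring_Divisibility"
begin

definition preperiod :: "('x \<Rightarrow> 'x) \<Rightarrow> 'x \<Rightarrow> nat" where
  "preperiod \<Gamma> x = (LEAST t. \<exists>l\<ge>1. (\<Gamma> ^^ (t + l)) x = (\<Gamma> ^^ t) x)"

definition per :: "('x \<Rightarrow> 'x) \<Rightarrow> 'x \<Rightarrow> nat" where
  "per \<Gamma> x = (LEAST l. l \<ge> 1 \<and> (\<Gamma> ^^ (preperiod \<Gamma> x + l)) x = (\<Gamma> ^^ preperiod \<Gamma> x) x)"

definition periods :: "'x set \<Rightarrow> ('x \<Rightarrow> 'x) \<Rightarrow> nat set" where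
  "periods X \<Gamma> = per \<Gamma> ` X"

definition fgraph_edges :: "'x set \<Rightarrow> ('x \<Rightarrow> 'x) \<Rightarrow> ('x \<times> 'x) set" where
  "fgraph_edges X \<Gamma> = {(x, \<Gamma> x) | x. x \<in> X}"

definition cycle_vertices :: "'x set \<Rightarrow> ('x \<Rightarrow> 'x) \<Rightarrow> 'x set" where
  "cycle_vertices X \<Gamma> = {x. (x, x) \<in> (fgraph_edges X \<Gamma>)\<^sup>+}"

text \<open>The edges of the trees are the edges of the functional graph that do not start on a cycle.\<close>

definition tree_edges :: "'x set \<Rightarrow> ('x \<Rightarrow> 'x) \<Rightarrow> ('x \<times> 'x) set" where
  "tree_edges X \<Gamma> = {(x, y) \<in> fgraph_edges X \<Gamma>. x \<notin> cycle_vertices X \<Gamma>}"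

definition tree_leaves :: "'x set \<Rightarrow> ('x \<Rightarrow> 'x) \<Rightarrow> 'x \<Rightarrow> 'x set" where
  "tree_leaves X \<Gamma> r = {v \<in> X. (v, r) \<in> (tree_edges X \<Gamma>)\<^sup>* \<and> v \<notin> Range (tree_edges X \<Gamma>)}"

text \<open>The root of a trivial tree is a leaf of that tree, and the tree gets height 0.\<close>

definition tree_height :: "'x set \<Rightarrow> ('x \<Rightarrow> 'x) \<Rightarrow> 'x \<Rightarrow> nat" where
  "tree_height X \<Gamma> r = Max {k. \<exists>v \<in> tree_leaves X \<Gamma> r. (v, r) \<in> tree_edges X \<Gamma> ^^ k}"

definition system_height :: "'x set \<Rightarrow> ('x \<Rightarrow> 'x) \<Rightarrow> nat" where
  "system_height X \<Gamma> = Max (tree_height X \<Gamma> ` cycle_vertices X \<Gamma>)"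

definition int_poly_ring :: "int poly ring" where
  "int_poly_ring = \<lparr>carrier = UNIV, mult = (*), one = 1, zero = 0, add = (+)\<rparr>"

definition base_ring :: "int poly \<Rightarrow> int poly set ring" where
  "base_ring h = int_poly_ring Quot (PIdl\<^bsub>int_poly_ring\<^esub> h)"

definition nat_in :: "('a, 'b) ring_scheme \<Rightarrow> nat \<Rightarrow> 'a" where
  "nat_in S N = [N] \<cdot>\<^bsub>S\<^esub> \<one>\<^bsub>S\<^esub>"

definition ppow_ideal :: "nat \<Rightarrow> int poly \<Rightarrow> nat \<Rightarrow> int poly set set" where
  "ppow_ideal p h e = PIdl\<^bsub>base_ring h\<^esub> (nat_in (base_ring h) (p ^ e))"

type_synonym res = "int poly set set"
type_synonym res_poly = "nat \<Rightarrow> res"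

text \<open>With $R = \<int>[t]/(h)$ given by \<open>base_ring h\<close>, \<open>residue_ring p h e\<close> is $R_e = R/(p^e)$; for \<open>e = 1\<close> it is the field with $p^{\deg h}$ elements.\<close>

definition residue_ring :: "nat \<Rightarrow> int poly \<Rightarrow> nat \<Rightarrow> res ring" where
  "residue_ring p h e = base_ring h Quot ppow_ideal p h e"

abbreviation base_polys :: "int poly \<Rightarrow> (int poly set, nat \<Rightarrow> int poly set) up_ring" where
  "base_polys h \<equiv> UP (base_ring h)"

abbreviation res_polys :: "nat \<Rightarrow> int poly \<Rightarrow> nat \<Rightarrow> (res, res_poly) up_ring" where
  "res_polys p h e \<equiv> UP (residue_ring p h e)"

definition reduce :: "nat \<Rightarrow> int poly \<Rightarrow> nat \<Rightarrow> (nat \<Rightarrow> int poly set) \<Rightarrow> res_poly" where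
  "reduce p h e g = (\<lambda>i. ppow_ideal p h e +>\<^bsub>base_ring h\<^esub> up_ring.coeff (base_polys h) g i)"

definition monic_in :: "('a, 'b) ring_scheme \<Rightarrow> (nat \<Rightarrow> 'a) \<Rightarrow> bool" where
  "monic_in S g \<longleftrightarrow> g \<in> carrier (UP S) \<and> up_ring.coeff (UP S) g (deg S g) = \<one>\<^bsub>S\<^esub>"

definition mod_prime :: "nat \<Rightarrow> int poly \<Rightarrow> nat \<Rightarrow> int set" where
  "mod_prime p h = (\<lambda>i. (Idl\<^bsub>\<Z>\<^esub> {int p}) +>\<^bsub>\<Z>\<^esub> Polynomial.coeff h i)"

definition admissible :: "nat \<Rightarrow> int poly \<Rightarrow> bool" where
  "admissible p h \<longleftrightarrow> normalization_semidom_class.prime p \<and>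
     Polynomial.lead_coeff h = 1 \<and> Polynomial.degree h \<ge> 1 \<and>
     ring_irreducible\<^bsub>UP (ZFact (int p))\<^esub> (mod_prime p h)"

definition quot_ideal :: "nat \<Rightarrow> int poly \<Rightarrow> nat \<Rightarrow> (nat \<Rightarrow> int poly set) \<Rightarrow> res_poly set" where
  "quot_ideal p h e m = PIdl\<^bsub>res_polys p h e\<^esub> (reduce p h e m)"

definition quot_algebra :: "nat \<Rightarrow> int poly \<Rightarrow> nat \<Rightarrow> (nat \<Rightarrow> int poly set) \<Rightarrow> res_poly set ring" where
  "quot_algebra p h e m = res_polys p h e Quot quot_ideal p h e m"

definition lfds_map ::
  "nat \<Rightarrow> int poly \<Rightarrow> nat \<Rightarrow> (nat \<Rightarrow> int poly set) \<Rightarrow> (nat \<Rightarrow> int poly set) \<Rightarrow> res_poly set \<Rightarrow> res_poly set"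
where
  "lfds_map p h e f m z =
     (quot_ideal p h e m +>\<^bsub>res_polys p h e\<^esub> reduce p h e f) \<otimes>\<^bsub>quot_algebra p h e m\<^esub> z"

definition cong_mod ::
  "nat \<Rightarrow> int poly \<Rightarrow> nat \<Rightarrow> (nat \<Rightarrow> int poly set) \<Rightarrow> (nat \<Rightarrow> int poly set) \<Rightarrow> (nat \<Rightarrow> int poly set) \<Rightarrow> bool"
where
  "cong_mod p h e m a b \<longleftrightarrow>
     a \<ominus>\<^bsub>base_polys h\<^esub> b \<in> Idl\<^bsub>base_polys h\<^esub> {m, nat_in (base_polys h) (p ^ e)}"

text \<open>Over a field, distinct monic irreducible polynomials are non-associate.\<close>

definition is_factorization ::
  "('a, 'b) ring_scheme \<Rightarrow> ((nat \<Rightarrow> 'a) \<times> nat) list \<Rightarrow> (nat \<Rightarrow> 'a) \<Rightarrow> bool" where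
  "is_factorization F Gs g \<longleftrightarrow>
     distinct (map fst Gs) \<and>
     (\<forall>(G, k) \<in> set Gs. monic_in F G \<and> ring_irreducible\<^bsub>UP F\<^esub> G \<and> k \<ge> 1) \<and>
     foldr (\<lambda>(G, k) z. (G [^]\<^bsub>UP F\<^esub> k) \<otimes>\<^bsub>UP F\<^esub> z) Gs \<one>\<^bsub>UP F\<^esub> = g"

definition kappa :: "('a, 'b) ring_scheme \<Rightarrow> (nat \<Rightarrow> 'a) \<Rightarrow> (nat \<Rightarrow> 'a) \<Rightarrow> nat" where
  "kappa F G z = (GREATEST k::nat. (G [^]\<^bsub>UP F\<^esub> k) divides\<^bsub>UP F\<^esub> z)"

definition is_greatest_coprime_divisor ::
  "('a, 'b) ring_scheme \<Rightarrow> (nat \<Rightarrow> 'a) \<Rightarrow> (nat \<Rightarrow> 'a) \<Rightarrow> (nat \<Rightarrow> 'a) \<Rightarrow> bool" where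
  "is_greatest_coprime_divisor F f m M \<longleftrightarrow>
     (let cand = {D. monic_in F D \<and> D divides\<^bsub>UP F\<^esub> m \<and> \<one>\<^bsub>UP F\<^esub> gcdof\<^bsub>UP F\<^esub> D f}
      in M \<in> cand \<and> (\<forall>D \<in> cand. D divides\<^bsub>UP F\<^esub> M))"

definition poly_divmod ::
  "('a, 'b) ring_scheme \<Rightarrow> (nat \<Rightarrow> 'a) \<Rightarrow> (nat \<Rightarrow> 'a) \<Rightarrow> (nat \<Rightarrow> 'a) \<times> (nat \<Rightarrow> 'a)" where
  "poly_divmod S a b = (THE (q, r). q \<in> carrier (UP S) \<and> r \<in> carrier (UP S) \<and>
     a = (q \<otimes>\<^bsub>UP S\<^esub> b) \<oplus>\<^bsub>UP S\<^esub> r \<and> (r = \<zero>\<^bsub>UP S\<^esub> \<or> deg S r < deg S b))"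

type_synonym 'a timed = "'a \<times> nat"

definition ret :: "'a \<Rightarrow> 'a timed" where
  "ret x = (x, 0)"

definition charge :: "nat \<Rightarrow> unit timed" where
  "charge t = ((), t)"

definition bind_timed :: "'a timed \<Rightarrow> ('a \<Rightarrow> 'b timed) \<Rightarrow> 'b timed" where
  "bind_timed c g = (fst (g (fst c)), snd c + snd (g (fst c)))"

adhoc_overloading Monad_Syntax.bind \<rightleftharpoons> bind_timed

text \<open>
  The cost of each basic operation may depend on all its operands; the arguments \<open>p\<close>, \<open>h\<close>
  (and \<open>e\<close>) select the coefficient ring.  \<open>factorize\<close> is the output of the factorization
  routine on one run; it is only constrained to be some correct factorization.
\<close>

record cost_model =
  mul_cost :: "nat \<Rightarrow> int poly \<Rightarrow> nat \<Rightarrow> res_poly \<Rightarrow> res_poly \<Rightarrow> nat"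
  div_cost :: "nat \<Rightarrow> int poly \<Rightarrow> nat \<Rightarrow> res_poly \<Rightarrow> res_poly \<Rightarrow> nat"
  powmod_cost :: "nat \<Rightarrow> int poly \<Rightarrow> nat \<Rightarrow> res_poly \<Rightarrow> nat \<Rightarrow> res_poly \<Rightarrow> nat"
  factorize :: "nat \<Rightarrow> int poly \<Rightarrow> res_poly \<Rightarrow> (res_poly \<times> nat) list"
  factorize_cost :: "nat \<Rightarrow> int poly \<Rightarrow> res_poly \<Rightarrow> nat"

definition mult_bound :: "cost_model \<Rightarrow> nat \<Rightarrow> int poly \<Rightarrow> nat \<Rightarrow> nat \<Rightarrow> nat" where
  "mult_bound K p h e n = Max {mul_cost K p h e a b | a b.
     a \<in> carrier (res_polys p h e) \<and> b \<in> carrier (res_polys p h e) \<and>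
     deg (residue_ring p h e) a < n \<and> deg (residue_ring p h e) b < n}"

text \<open>
  The last clause says that multiplying over the residue field is, up to a constant, not more
  expensive than multiplying over $R_e$.  The maximum with 1 only concerns the exponents 0 and 1.
\<close>

definition cost_conventions :: "cost_model \<Rightarrow> bool" where
  "cost_conventions K \<longleftrightarrow> (\<exists>c > 0. \<forall>p h e n. admissible p h \<and> e \<ge> 1 \<and> n \<ge> 1 \<longrightarrow>
     (let S = residue_ring p h e; F = residue_ring p h 1; q = p ^ Polynomial.degree h;
          M = (\<lambda>i. real (mult_bound K p h i n))
      in (\<forall>a b. a \<in> carrier (UP S) \<and> monic_in S b \<and> deg S a \<le> n \<and> deg S b \<le> n \<longrightarrow>
            real (div_cost K p h e a b) \<le> c * M e) \<and>
         (\<forall>g k m. g \<in> carrier (UP S) \<and> monic_in S m \<and> deg S g < deg S m \<and> deg S m = n \<longrightarrow>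
            real (powmod_cost K p h e g k m) \<le> c * M e * max 1 (log 2 (real k))) \<and>
         (\<forall>g. monic_in F g \<and> 1 \<le> deg F g \<and> deg F g \<le> n \<longrightarrow>
            is_factorization F (factorize K p h g) g \<and>
            real (factorize_cost K p h g) \<le> c * real n * M 1 * log 2 (real n * real q)) \<and>
         M 1 \<le> c * M e))"

definition divmod_timed ::
  "cost_model \<Rightarrow> nat \<Rightarrow> int poly \<Rightarrow> res_poly \<Rightarrow> res_poly \<Rightarrow> (res_poly \<times> res_poly) timed" where
  "divmod_timed K p h a b = do {
     charge (div_cost K p h 1 a b);
     ret (poly_divmod (residue_ring p h 1) a b)
   }"

definition powmod_timed ::
  "cost_model \<Rightarrow> nat \<Rightarrow> int poly \<Rightarrow> nat \<Rightarrow> res_poly \<Rightarrow> nat \<Rightarrow> res_poly \<Rightarrow> res_poly timed" where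
  "powmod_timed K p h e g k m = do {
     charge (powmod_cost K p h e g k m);
     ret (snd (poly_divmod (residue_ring p h e) (g [^]\<^bsub>res_polys p h e\<^esub> k) m))
   }"

definition factorize_timed ::
  "cost_model \<Rightarrow> nat \<Rightarrow> int poly \<Rightarrow> res_poly \<Rightarrow> (res_poly \<times> nat) list timed" where
  "factorize_timed K p h g = do {
     charge (factorize_cost K p h g);
     ret (factorize K p h g)
   }"

text \<open>
  The third integer argument of \<open>search_loop\<close> carries the last value of the midpoint; its initial value is irrelevant because the loop body is executed at least once
  when \<open>e \<ge> 1\<close>.
\<close>

function search_loop :: "(int \<Rightarrow> bool timed) \<Rightarrow> int \<Rightarrow> int \<Rightarrow> int \<Rightarrow> int timed" where
  "search_loop P l r mid = (if l \<le> r
     then let mid' = l + (r - l) div 2 in do {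
       b \<leftarrow> P mid';
       if b then search_loop P l (mid' - 1) mid' else search_loop P (mid' + 1) r mid'
     }
     else ret mid)"
  by auto
termination
  by (relation "measure (\<lambda>(P, l, r, mid). nat (r - l + 1))") auto

declare search_loop.simps [simp del]

definition height_search :: "(int \<Rightarrow> bool timed) \<Rightarrow> nat \<Rightarrow> nat \<Rightarrow> int timed" where
  "height_search P e \<tau> = do {
     mid \<leftarrow> search_loop P (int \<tau>) (int (e * \<tau>)) 0;
     b \<leftarrow> P mid;
     ret (if b then mid else mid + 1)
   }"

text \<open>
  The algorithm as a mathematical procedure; \<open>Gs\<close> is the factorization obtained in its first step.
\<close>

definition height_algorithm ::
  "nat \<Rightarrow> int poly \<Rightarrow> nat \<Rightarrow> (nat \<Rightarrow> int poly set) \<Rightarrow> (nat \<Rightarrow> int poly set) \<Rightarrow> nat \<Rightarrow>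
     (res_poly \<times> nat) list \<Rightarrow> int"
where
  "height_algorithm p h e f m lmax Gs =
     (let F = residue_ring p h 1;
          fbar = reduce p h 1 f;
          mbar = reduce p h 1 m;
          M1 = (THE M. is_greatest_coprime_divisor F fbar mbar M);
          M2 = fst (poly_divmod F mbar M1);
          \<tau> = Max ((\<lambda>(G, k). nat \<lceil>real (kappa F G M2) / real (kappa F G fbar)\<rceil>) ` set Gs)
      in fst (height_search
           (\<lambda>i. ret (cong_mod p h e m (f [^]\<^bsub>base_polys h\<^esub> (nat i + lmax)) (f [^]\<^bsub>base_polys h\<^esub> nat i)))
           e \<tau>))"

text \<open>
  The same algorithm carried out with the basic operations.  \<open>strip\<close> divides \<open>z\<close> by \<open>G\<close> as long
  as this is possible, at most \<open>b\<close> times, and returns the cofactor and the number of successful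
  divisions.
\<close>

primrec strip ::
  "cost_model \<Rightarrow> nat \<Rightarrow> int poly \<Rightarrow> nat \<Rightarrow> res_poly \<Rightarrow> res_poly \<Rightarrow> (res_poly \<times> nat) timed" where
  "strip K p h 0 G z = ret (z, 0)"
| "strip K p h (Suc b) G z = do {
     (q, r) \<leftarrow> divmod_timed K p h z G;
     if r = \<zero>\<^bsub>res_polys p h 1\<^esub>
     then do { (w, j) \<leftarrow> strip K p h b G q; ret (w, Suc j) }
     else ret (z, 0)
   }"

primrec coprime_part_timed ::
  "cost_model \<Rightarrow> nat \<Rightarrow> int poly \<Rightarrow> (res_poly \<times> nat) list \<Rightarrow> res_poly \<Rightarrow> res_poly timed" where
  "coprime_part_timed K p h [] z = ret z"
| "coprime_part_timed K p h (Gk # Gs) z = do {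
     (w, j) \<leftarrow> strip K p h (deg (residue_ring p h 1) z) (fst Gk) z;
     coprime_part_timed K p h Gs w
   }"

primrec quotients_timed ::
  "cost_model \<Rightarrow> nat \<Rightarrow> int poly \<Rightarrow> (res_poly \<times> nat) list \<Rightarrow> res_poly \<Rightarrow> nat list timed" where
  "quotients_timed K p h [] z = ret []"
| "quotients_timed K p h (Gk # Gs) z = do {
     (w, j) \<leftarrow> strip K p h (deg (residue_ring p h 1) z) (fst Gk) z;
     ts \<leftarrow> quotients_timed K p h Gs z;
     ret (nat \<lceil>real j / real (snd Gk)\<rceil> # ts)
   }"

text \<open>
  A coefficientwise pass (reducing an input modulo $p^e$ or $p$, comparing two residues modulo $m$,
  together with the integer bookkeeping of one round) is charged like one multiplication over the
  ring in question.
\<close>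

definition cong_timed ::
  "cost_model \<Rightarrow> nat \<Rightarrow> int poly \<Rightarrow> nat \<Rightarrow> nat \<Rightarrow> res_poly \<Rightarrow> res_poly \<Rightarrow> nat \<Rightarrow> int \<Rightarrow> bool timed" where
  "cong_timed K p h e n fe me lmax i = do {
     a \<leftarrow> powmod_timed K p h e fe (nat i + lmax) me;
     b \<leftarrow> powmod_timed K p h e fe (nat i) me;
     charge (mult_bound K p h e n);
     ret (a = b)
   }"

definition height_algorithm_timed ::
  "cost_model \<Rightarrow> nat \<Rightarrow> int poly \<Rightarrow> nat \<Rightarrow> (nat \<Rightarrow> int poly set) \<Rightarrow> (nat \<Rightarrow> int poly set) \<Rightarrow> nat \<Rightarrow>
     int timed"
where
  "height_algorithm_timed K p h e f m lmax =
     (let n = deg (base_ring h) m;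
          fe = reduce p h e f; me = reduce p h e m;
          fbar = reduce p h 1 f; mbar = reduce p h 1 m
      in do {
        charge (2 * mult_bound K p h e n + 2 * mult_bound K p h 1 n);
        Gs \<leftarrow> factorize_timed K p h fbar;
        M1 \<leftarrow> coprime_part_timed K p h Gs mbar;
        (M2, rem) \<leftarrow> divmod_timed K p h mbar M1;
        ts \<leftarrow> quotients_timed K p h Gs M2;
        height_search (cong_timed K p h e n fe me lmax) e (Max (set ts))
      })"

end

theory Submission
  imports Defs
begin

text \<open>
  Write \<open>A\<^sub>e\<close> for the finite ring \<open>R\<^sub>e[x]/(m)\<close> and \<open>a\<close> for the class of \<open>f\<close>, so that the system is
  multiplication by \<open>a\<close> on \<open>A\<^sub>e\<close>.  An equality \<open>a^i = a^j\<close> gives \<open>a^i z = a^j z\<close> for every \<open>z\<close>;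
  therefore no element has a longer preperiod or a longer period than \<open>1\<close>.  Path lengths in the trees
  are preperiods (\<open>tree_path_length\<close>), so the height is the preperiod \<open>T\<^sub>e\<close> of \<open>1\<close>, and \<open>lmax\<close> is
  the period of \<open>1\<close>.  Hence \<open>a^(i + lmax) = a^i\<close> is equivalent to \<open>T\<^sub>e \<le> i\<close>
  (\<open>pow_add_Max_periods_iff\<close>): the congruence tested by the algorithm is monotone in \<open>i\<close>, and a binary
  search finds its threshold \<open>T\<^sub>e\<close> as soon as \<open>\<tau> \<le> T\<^sub>e \<le> e \<tau>\<close>.

  These two bounds come from the residue field.  Modulo \<open>p\<close> let \<open>f\<close> be the product of prime powers
  \<open>G^k\<close> and \<open>m\<close> the product of \<open>w\<close> and the powers \<open>G^(\<kappa> G)\<close> of the same primes, none of which divides \<open>w\<close>.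
  Each \<open>G\<close> divides \<open>f\<close> and hence not \<open>f^l - 1\<close>, so \<open>m\<close> can divide \<open>f^t (f^l - 1)\<close> only if
  \<open>\<kappa> G \<le> t k\<close> for all \<open>G\<close>; if these inequalities hold, then \<open>m\<close> divides it for every \<open>l\<close> with \<open>w\<close>
  dividing \<open>f^l - 1\<close>, and there is such an \<open>l \<ge> 1\<close>.  So \<open>T\<^sub>1 = \<tau>\<close>
  (\<open>divides_power_prod_period_iff\<close>, \<open>residue_height_formula\<close>).  Reduction modulo \<open>p\<close> gives
  \<open>T\<^sub>1 \<le> T\<^sub>e\<close>.  For the upper bound, \<open>f^\<tau> - f^(\<tau> + l)\<close> lies in \<open>(m, p)\<close> for some \<open>l \<ge> 1\<close>, and its
  \<open>e\<close>-th power in \<open>(m, p^e)\<close>.  In \<open>A\<^sub>e\<close> this reads \<open>a^(e \<tau>) (1 - a^l)^e = 0\<close>, which makes \<open>a^(e \<tau>)\<close> a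
  multiple of \<open>a^l\<close> times itself, hence of arbitrarily high powers of \<open>a\<close>; so it lies on a cycle
  (\<open>system_height_mult_nilpotent\<close>).

  For the running time, the exponents are at most \<open>2 q^(e n)\<close>, because \<open>lmax\<close> is at most the number of
  elements of \<open>A\<^sub>e\<close>.  One round of the search therefore costs \<open>O(e n log q)\<close> multiplications, and already
  the trivial bound \<open>e \<tau> + 2 \<le> e n + 2\<close> on the number of tests gives the factor \<open>n\<^sup>2 e\<^sup>2\<close>.  Splitting
  off the prime powers takes \<open>O(n\<^sup>2)\<close> divisions over the residue field.
\<close>

section \<open>Trees and cycles of a finite self-map\<close>

definition recurrent :: "('x \<Rightarrow> 'x) \<Rightarrow> 'x \<Rightarrow> bool" where
  "recurrent \<Gamma> x \<longleftrightarrow> (\<exists>l\<ge>1. (\<Gamma> ^^ l) x = x)"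

lemma funpow_funpow: "(\<Gamma> ^^ j) ((\<Gamma> ^^ i) x) = (\<Gamma> ^^ (i + j)) x"
  by (metis add.commute comp_apply funpow_add)

lemma recurrent_funpow_iff:
  "recurrent \<Gamma> ((\<Gamma> ^^ t) x) \<longleftrightarrow> (\<exists>l\<ge>1. (\<Gamma> ^^ (t + l)) x = (\<Gamma> ^^ t) x)"
  by (simp add: recurrent_def funpow_funpow)

lemma preperiod_Least_recurrent: "preperiod \<Gamma> x = (LEAST t. recurrent \<Gamma> ((\<Gamma> ^^ t) x))"
  by (simp add: preperiod_def recurrent_funpow_iff)

lemma recurrent_funpow: "recurrent \<Gamma> x \<Longrightarrow> recurrent \<Gamma> ((\<Gamma> ^^ k) x)"
  unfolding recurrent_def by (metis funpow_funpow add.commute)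

lemma funpow_period_mult: "(\<Gamma> ^^ l) x = x \<Longrightarrow> (\<Gamma> ^^ (l * k)) x = x"
  by (induction k) (auto simp: funpow_funpow[symmetric])

locale finite_dynamics =
  fixes X :: "'x set" and \<Gamma> :: "'x \<Rightarrow> 'x"
  assumes finite_X: "finite X"
    and maps_X: "x \<in> X \<Longrightarrow> \<Gamma> x \<in> X"
begin

lemma funpow_closed: "x \<in> X \<Longrightarrow> (\<Gamma> ^^ k) x \<in> X"
  by (induction k) (auto intro: maps_X)

lemma eventually_recurrent:
  assumes "x \<in> X"
  shows "\<exists>t. recurrent \<Gamma> ((\<Gamma> ^^ t) x)"
proof -
  have "range (\<lambda>k. (\<Gamma> ^^ k) x) \<subseteq> X" using funpow_closed assms by auto
  hence "\<not> inj (\<lambda>k. (\<Gamma> ^^ k) x)"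
    using finite_X finite_imageD finite_subset infinite_UNIV_nat by blast
  then obtain i j where "i < j" "(\<Gamma> ^^ j) x = (\<Gamma> ^^ i) x"
    unfolding inj_def by (metis linorder_neqE_nat)
  hence "(\<Gamma> ^^ (i + (j - i))) x = (\<Gamma> ^^ i) x" "j - i \<ge> 1" by simp_all
  thus ?thesis unfolding recurrent_funpow_iff by blast
qed

lemma recurrent_iff_preperiod_le:
  assumes "x \<in> X"
  shows "recurrent \<Gamma> ((\<Gamma> ^^ t) x) \<longleftrightarrow> preperiod \<Gamma> x \<le> t"
proof
  assume "recurrent \<Gamma> ((\<Gamma> ^^ t) x)"
  thus "preperiod \<Gamma> x \<le> t" unfolding preperiod_Least_recurrent by (rule Least_le)
next
  assume le: "preperiod \<Gamma> x \<le> t"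
  have "recurrent \<Gamma> ((\<Gamma> ^^ preperiod \<Gamma> x) x)"
    unfolding preperiod_Least_recurrent
    using eventually_recurrent[OF assms] by (rule LeastI_ex)
  from recurrent_funpow[OF this, of "t - preperiod \<Gamma> x"] le
  show "recurrent \<Gamma> ((\<Gamma> ^^ t) x)" by (simp add: funpow_funpow)
qed

lemma per_props:
  assumes "x \<in> X"
  shows "per \<Gamma> x \<ge> 1"
    and "(\<Gamma> ^^ (preperiod \<Gamma> x + per \<Gamma> x)) x = (\<Gamma> ^^ preperiod \<Gamma> x) x"
    and "1 \<le> l \<Longrightarrow> (\<Gamma> ^^ (preperiod \<Gamma> x + l)) x = (\<Gamma> ^^ preperiod \<Gamma> x) x \<Longrightarrow> per \<Gamma> x \<le> l"
proof -
  have "\<exists>l. l \<ge> 1 \<and> (\<Gamma> ^^ (preperiod \<Gamma> x + l)) x = (\<Gamma> ^^ preperiod \<Gamma> x) x"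
    using recurrent_iff_preperiod_le[OF assms, of "preperiod \<Gamma> x"]
    by (simp add: recurrent_funpow_iff)
  from LeastI_ex[OF this]
  show "per \<Gamma> x \<ge> 1" "(\<Gamma> ^^ (preperiod \<Gamma> x + per \<Gamma> x)) x = (\<Gamma> ^^ preperiod \<Gamma> x) x"
    unfolding per_def by blast+
  show "1 \<le> l \<Longrightarrow> (\<Gamma> ^^ (preperiod \<Gamma> x + l)) x = (\<Gamma> ^^ preperiod \<Gamma> x) x \<Longrightarrow> per \<Gamma> x \<le> l"
    unfolding per_def by (rule Least_le) simp
qed

text \<open>Within one period the iterates of a recurrent point are pairwise distinct: a coincidence would
  give a shorter period.\<close>

lemma per_le_card:
  assumes "x \<in> X"
  shows "per \<Gamma> x \<le> card X"
proof -
  define y where "y = (\<Gamma> ^^ preperiod \<Gamma> x) x"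
  let ?l = "per \<Gamma> x"
  have y: "y \<in> X" "(\<Gamma> ^^ ?l) y = y"
    using assms per_props(2)[OF assms] by (simp_all add: y_def funpow_closed funpow_funpow)
  have "(\<Gamma> ^^ i) y \<noteq> (\<Gamma> ^^ j) y" if "i < j" "j < ?l" for i j
  proof
    assume eq: "(\<Gamma> ^^ i) y = (\<Gamma> ^^ j) y"
    have "(\<Gamma> ^^ (?l + (j - i))) y = (\<Gamma> ^^ (?l - i)) ((\<Gamma> ^^ j) y)"
      using that by (simp add: funpow_funpow add.commute)
    also have "\<dots> = y" using that y by (simp add: eq[symmetric] funpow_funpow)
    finally have "(\<Gamma> ^^ (j - i)) y = y" using y(2) by (simp add: funpow_funpow[symmetric])
    hence "?l \<le> j - i" using that by (intro per_props(3)[OF assms]) (auto simp: y_def funpow_funpow)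
    thus False using that by linarith
  qed
  hence "inj_on (\<lambda>k. (\<Gamma> ^^ k) y) {..<?l}"
    unfolding inj_on_def by (metis lessThan_iff linorder_neqE_nat)
  moreover have "(\<lambda>k. (\<Gamma> ^^ k) y) ` {..<?l} \<subseteq> X" using y funpow_closed by auto
  ultimately show ?thesis using card_inj_on_le finite_X by fastforce
qed

lemma fgraph_edges_trancl:
  "(x, y) \<in> (fgraph_edges X \<Gamma>)\<^sup>+ \<longleftrightarrow> x \<in> X \<and> (\<exists>l\<ge>1. y = (\<Gamma> ^^ l) x)"
proof
  assume "(x, y) \<in> (fgraph_edges X \<Gamma>)\<^sup>+"
  thus "x \<in> X \<and> (\<exists>l\<ge>1. y = (\<Gamma> ^^ l) x)"
  proof induction
    case (base y)
    thus ?case by (auto simp: fgraph_edges_def intro!: exI[of _ 1])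
  next
    case (step y z)
    then obtain l where "x \<in> X" "y = (\<Gamma> ^^ l) x" "z = \<Gamma> y" by (auto simp: fgraph_edges_def)
    thus ?case by (auto intro!: exI[of _ "Suc l"])
  qed
next
  assume "x \<in> X \<and> (\<exists>l\<ge>1. y = (\<Gamma> ^^ l) x)"
  then obtain l where "x \<in> X" "l \<ge> 1" "y = (\<Gamma> ^^ l) x" by blast
  from this(2,1,3) show "(x, y) \<in> (fgraph_edges X \<Gamma>)\<^sup>+"
  proof (induction l arbitrary: y rule: nat_induct_at_least)
    case base
    thus ?case by (auto simp: fgraph_edges_def)
  next
    case (Suc l)
    have "((\<Gamma> ^^ l) x, y) \<in> fgraph_edges X \<Gamma>"
      using Suc.prems by (auto simp: fgraph_edges_def funpow_closed)
    with Suc.IH[OF Suc.prems(1) refl] show ?case by (rule trancl_into_trancl)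
  qed
qed

lemma cycle_vertices_iff: "x \<in> cycle_vertices X \<Gamma> \<longleftrightarrow> x \<in> X \<and> recurrent \<Gamma> x"
  by (auto simp: cycle_vertices_def fgraph_edges_trancl recurrent_def eq_commute)

lemma tree_edges_relpow:
  "(v, r) \<in> tree_edges X \<Gamma> ^^ k \<and> v \<in> X \<longleftrightarrow>
     v \<in> X \<and> r = (\<Gamma> ^^ k) v \<and> (\<forall>i<k. \<not> recurrent \<Gamma> ((\<Gamma> ^^ i) v))"
proof (induction k arbitrary: r)
  case 0
  show ?case by auto
next
  case (Suc k)
  have edge: "(w, r) \<in> tree_edges X \<Gamma> \<longleftrightarrow> w \<in> X \<and> r = \<Gamma> w \<and> \<not> recurrent \<Gamma> w" for w
    by (auto simp: tree_edges_def fgraph_edges_def cycle_vertices_iff)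
  have "(v, r) \<in> tree_edges X \<Gamma> ^^ Suc k \<and> v \<in> X \<longleftrightarrow>
      (\<exists>w. ((v, w) \<in> tree_edges X \<Gamma> ^^ k \<and> v \<in> X) \<and> (w, r) \<in> tree_edges X \<Gamma>)" by auto
  also have "\<dots> \<longleftrightarrow> v \<in> X \<and> r = (\<Gamma> ^^ Suc k) v \<and> (\<forall>i<Suc k. \<not> recurrent \<Gamma> ((\<Gamma> ^^ i) v))"
    unfolding Suc.IH edge by (auto simp: less_Suc_eq funpow_closed)
  finally show ?case .
qed

text \<open>A path in a tree meets no cycle before its end, so its end is the first recurrent iterate of its
  start.\<close>

lemma tree_path_length:
  assumes "v \<in> X" "recurrent \<Gamma> r"
  shows "(v, r) \<in> tree_edges X \<Gamma> ^^ k \<longleftrightarrow> k = preperiod \<Gamma> v \<and> r = (\<Gamma> ^^ k) v"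
proof -
  have "(v, r) \<in> tree_edges X \<Gamma> ^^ k \<longleftrightarrow> r = (\<Gamma> ^^ k) v \<and> (\<forall>i<k. \<not> recurrent \<Gamma> ((\<Gamma> ^^ i) v))"
    using tree_edges_relpow[of v r k] assms(1) by blast
  also have "\<dots> \<longleftrightarrow> k = preperiod \<Gamma> v \<and> r = (\<Gamma> ^^ k) v"
    using assms recurrent_iff_preperiod_le[OF assms(1)]
    by (metis linorder_not_le le_refl nat_less_le)
  finally show ?thesis .
qed

text \<open>There is a leaf above every cycle vertex \<open>r\<close>: among the vertices leading to \<open>r\<close>, one of largest
  preperiod has no predecessor in the tree, because such a predecessor would have a larger preperiod.\<close>

lemma tree_height_le:
  assumes r: "r \<in> cycle_vertices X \<Gamma>" and N: "\<And>x. x \<in> X \<Longrightarrow> preperiod \<Gamma> x \<le> N"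
  defines "S \<equiv> {k. \<exists>v \<in> tree_leaves X \<Gamma> r. (v, r) \<in> tree_edges X \<Gamma> ^^ k}"
  shows "finite S" "S \<noteq> {}" "\<forall>k\<in>S. k \<le> N"
proof -
  have rX: "r \<in> X" "recurrent \<Gamma> r" using r by (auto simp: cycle_vertices_iff)
  have le: "\<forall>k\<in>S. k \<le> N"
  proof
    fix k assume "k \<in> S"
    then obtain v where "v \<in> X" "(v, r) \<in> tree_edges X \<Gamma> ^^ k"
      unfolding S_def tree_leaves_def by blast
    thus "k \<le> N" using tree_path_length[OF _ rX(2)] N by simp
  qed
  thus "\<forall>k\<in>S. k \<le> N" "finite S" by (auto intro: finite_subset[of S "{..N}"])
  define V where "V = {v \<in> X. (v, r) \<in> (tree_edges X \<Gamma>)\<^sup>*}"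
  have "finite V" "r \<in> V" using finite_X rX by (auto simp: V_def)
  then obtain v where v: "v \<in> V" "\<And>w. w \<in> V \<Longrightarrow> preperiod \<Gamma> w \<le> preperiod \<Gamma> v"
    using Max_in[of "preperiod \<Gamma> ` V"] Max_ge[of "preperiod \<Gamma> ` V"]
    by (metis (no_types, lifting) empty_iff finite_imageI image_eqI image_iff image_is_empty)
  obtain k where k: "(v, r) \<in> tree_edges X \<Gamma> ^^ k" using v(1) by (auto simp: V_def dest: rtrancl_imp_relpow)
  have vX: "v \<in> X" using v(1) by (simp add: V_def)
  have "v \<notin> Range (tree_edges X \<Gamma>)"
  proof
    assume "v \<in> Range (tree_edges X \<Gamma>)"
    then obtain u where u: "(u, v) \<in> tree_edges X \<Gamma>" by auto
    hence uX: "u \<in> X" by (auto simp: tree_edges_def fgraph_edges_def)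
    have uk: "(u, r) \<in> tree_edges X \<Gamma> ^^ Suc k" using u k by (rule relpow_Suc_I2)
    have "u \<in> V" using uX relpow_imp_rtrancl[OF uk] by (simp add: V_def)
    from v(2)[OF this] uk k show False
      using tree_path_length[OF uX rX(2), of "Suc k"] tree_path_length[OF vX rX(2), of k] by linarith
  qed
  hence "v \<in> tree_leaves X \<Gamma> r" using v(1) by (auto simp: tree_leaves_def V_def)
  thus "S \<noteq> {}" using k unfolding S_def by blast
qed

text \<open>A point of largest preperiod is a leaf, for the same reason as in \<open>tree_height_le\<close>, and the path from
  it to its root is as long as any path in any tree.\<close>

lemma system_height_eq_preperiod:
  assumes x0: "x0 \<in> X" and max: "\<And>x. x \<in> X \<Longrightarrow> preperiod \<Gamma> x \<le> preperiod \<Gamma> x0"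
  shows "system_height X \<Gamma> = preperiod \<Gamma> x0"
proof -
  let ?N = "preperiod \<Gamma> x0"
  let ?C = "cycle_vertices X \<Gamma>"
  let ?S = "\<lambda>r. {k. \<exists>v \<in> tree_leaves X \<Gamma> r. (v, r) \<in> tree_edges X \<Gamma> ^^ k}"
  define r where "r = (\<Gamma> ^^ ?N) x0"
  have rec: "recurrent \<Gamma> r" using recurrent_iff_preperiod_le[OF x0] by (simp add: r_def)
  have r: "r \<in> ?C" using rec x0 by (simp add: cycle_vertices_iff r_def funpow_closed)
  have path: "(x0, r) \<in> tree_edges X \<Gamma> ^^ ?N" using tree_path_length[OF x0 rec] by (simp add: r_def)
  have "x0 \<notin> Range (tree_edges X \<Gamma>)"
  proof
    assume "x0 \<in> Range (tree_edges X \<Gamma>)"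
    then obtain u where u: "(u, x0) \<in> tree_edges X \<Gamma>" by auto
    hence uX: "u \<in> X" by (auto simp: tree_edges_def fgraph_edges_def)
    have "(u, r) \<in> tree_edges X \<Gamma> ^^ Suc ?N" using u path by (rule relpow_Suc_I2)
    with tree_path_length[OF uX rec, of "Suc ?N"] max[OF uX] show False by linarith
  qed
  hence "x0 \<in> tree_leaves X \<Gamma> r"
    using x0 relpow_imp_rtrancl[OF path] by (simp add: tree_leaves_def)
  hence "?N \<in> ?S r" using path by blast
  hence "tree_height X \<Gamma> r = ?N"
    unfolding tree_height_def using tree_height_le[OF r max] by (intro Max_eqI) auto
  moreover have "tree_height X \<Gamma> r' \<le> ?N" if "r' \<in> ?C" for r'
    unfolding tree_height_def using tree_height_le[OF that max] by (subst Max_le_iff) auto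
  moreover have "finite ?C" using finite_X by (rule finite_subset[rotated]) (auto simp: cycle_vertices_iff)
  ultimately show ?thesis
    unfolding system_height_def using r by (intro Max_eqI) force+
qed

end

section \<open>Multiplication by a fixed element of a finite commutative ring\<close>

context cring
begin

lemma funpow_mult:
  assumes "a \<in> carrier R" "z \<in> carrier R"
  shows "((\<lambda>z. a \<otimes> z) ^^ k) z = a [^] k \<otimes> z"
  using assms by (induction k) (simp_all add: m_ac)

context
  fixes a
  assumes fin: "finite (carrier R)" and a: "a \<in> carrier R"
begin

abbreviation (input) "mult_a \<equiv> \<lambda>z. a \<otimes> z"

interpretation finite_dynamics "carrier R" "\<lambda>z. a \<otimes> z"
  using fin a by unfold_locales auto

lemma recurrent_mult_iff:
  assumes "z \<in> carrier R"
  shows "recurrent mult_a ((mult_a ^^ t) z) \<longleftrightarrow> (\<exists>l\<ge>1. a [^] (t + l) \<otimes> z = a [^] t \<otimes> z)"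
  unfolding recurrent_funpow_iff using assms a by (simp add: funpow_mult)

text \<open>An equality between powers of \<open>a\<close> survives multiplication by \<open>z\<close>.\<close>

lemma preperiod_mult_le: 
  assumes z: "z \<in> carrier R"
  shows "preperiod mult_a z \<le> preperiod mult_a \<one>"
proof -
  have "\<exists>l\<ge>1. a [^] (preperiod mult_a \<one> + l) \<otimes> \<one> = a [^] (preperiod mult_a \<one>) \<otimes> \<one>"
    using recurrent_iff_preperiod_le[of \<one>] recurrent_mult_iff[of \<one>] by blast
  hence "\<exists>l\<ge>1. a [^] (preperiod mult_a \<one> + l) \<otimes> z = a [^] (preperiod mult_a \<one>) \<otimes> z"
    using a by auto
  thus ?thesis using recurrent_iff_preperiod_le[OF z] recurrent_mult_iff[OF z] by blast
qed

lemma system_height_mult: "system_height (carrier R) mult_a = preperiod mult_a \<one>"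
  using preperiod_mult_le by (intro system_height_eq_preperiod) auto

lemma system_height_mult_le_iff:
  "system_height (carrier R) mult_a \<le> t \<longleftrightarrow> (\<exists>l\<ge>1. a [^] (t + l) = a [^] t)"
  using recurrent_iff_preperiod_le[of \<one>] recurrent_mult_iff[of \<one>] a
  by (simp add: system_height_mult)

lemma per_one_mult:
  assumes "preperiod mult_a \<one> \<le> t"
  shows "a [^] (t + per mult_a \<one>) = a [^] t"
proof -
  let ?T = "preperiod mult_a \<one>" and ?l = "per mult_a \<one>"
  have "a [^] (?T + ?l) = a [^] ?T"
    using per_props(2)[of \<one>] a by (simp add: funpow_mult)
  hence "a [^] (t - ?T) \<otimes> a [^] (?T + ?l) = a [^] (t - ?T) \<otimes> a [^] ?T" by simp
  thus ?thesis using assms a by (simp add: nat_pow_mult)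
qed

text \<open>The first recurrent iterate \<open>y\<close> of \<open>z\<close> satisfies \<open>y = a^(k T) y\<close> for some \<open>k \<ge> 1\<close>, where \<open>T\<close> is the
  preperiod of \<open>1\<close>.  From the exponent \<open>T\<close> on, adding the period of \<open>1\<close> does not change a power of \<open>a\<close>, and so
  the period of \<open>1\<close> returns \<open>y\<close> to itself.\<close>

lemma per_mult_le:
  assumes z: "z \<in> carrier R"
  shows "per mult_a z \<le> per mult_a \<one>"
proof -
  let ?T = "preperiod mult_a \<one>" and ?l = "per mult_a \<one>" and ?s = "preperiod mult_a z"
  define y where "y = a [^] ?s \<otimes> z"
  have y: "y \<in> carrier R" using a z by (simp add: y_def)
  obtain k where k: "k \<ge> 1" "(mult_a ^^ k) y = y"
    using recurrent_iff_preperiod_le[OF z, of ?s] a z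
    by (auto simp: funpow_mult y_def recurrent_def)
  have "(mult_a ^^ (k * ?T)) y = y" using k(2) by (rule funpow_period_mult)
  hence ky: "a [^] (k * ?T) \<otimes> y = y" using a y by (simp add: funpow_mult)
  have "?T \<le> k * ?T" using k(1) by simp
  from per_one_mult[OF this] have kT: "a [^] (k * ?T + ?l) = a [^] (k * ?T)" .
  have "a [^] ?l \<otimes> y = a [^] ?l \<otimes> (a [^] (k * ?T) \<otimes> y)" by (simp only: ky)
  also have "\<dots> = a [^] (k * ?T + ?l) \<otimes> y"
    using a y by (simp add: nat_pow_mult[symmetric] m_ac)
  also have "\<dots> = y" by (simp only: kT ky)
  finally have "a [^] ?l \<otimes> y = y" .
  hence "(mult_a ^^ (?s + ?l)) z = (mult_a ^^ ?s) z"
    using a z by (simp add: funpow_mult y_def nat_pow_mult[symmetric] m_ac)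
  with per_props(1)[of \<one>] show ?thesis by (intro per_props(3)[OF z]) auto
qed

lemma Max_periods_mult: "Max (periods (carrier R) mult_a) = per mult_a \<one>"
  unfolding periods_def using fin per_mult_le by (intro Max_eqI) auto

lemma Max_periods_mult_le_card: "Max (periods (carrier R) mult_a) \<le> card (carrier R)"
  using per_le_card[of \<one>] by (simp add: Max_periods_mult)

text \<open>The congruence that drives the binary search is true exactly from the height on, although it is tested
  for the single shift \<open>lmax\<close> only.\<close>

lemma pow_add_Max_periods_iff:
  "a [^] (t + Max (periods (carrier R) mult_a)) = a [^] t \<longleftrightarrow>
     system_height (carrier R) mult_a \<le> t"
  using per_one_mult per_props(1)[of \<one>] system_height_mult_le_iff
  by (auto simp: system_height_mult Max_periods_mult)

lemma one_minus_pow_expand: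
  assumes "x \<in> carrier R"
  shows "\<exists>g\<in>carrier R. (\<one> \<ominus> x) [^] (k::nat) = \<one> \<ominus> x \<otimes> g"
proof (induction k)
  case 0
  show ?case using assms by (intro bexI[of _ \<zero>]) (simp_all add: minus_eq)
next
  case (Suc k)
  then obtain g where g: "g \<in> carrier R" "(\<one> \<ominus> x) [^] k = \<one> \<ominus> x \<otimes> g" by blast
  have "(\<one> \<ominus> x \<otimes> g) \<otimes> (\<one> \<ominus> x) = \<one> \<ominus> x \<otimes> (g \<oplus> \<one> \<ominus> x \<otimes> g)"
    using assms g(1) by algebra
  thus ?case using assms g by (intro bexI[of _ "g \<oplus> \<one> \<ominus> x \<otimes> g"]) simp_all
qed

text \<open>Put \<open>x = a^l\<close> and \<open>w = a^(e t)\<close>.  The hypothesis says \<open>w (1 - x)\<^sup>e = 0\<close>, and \<open>(1 - x)\<^sup>e = 1 - x g\<close> for some \<open>g\<close>,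
  so \<open>w = w x g\<close>.  Iterating, \<open>w = w x\<^sup>N g\<^sup>N\<close> for every \<open>N\<close>; for large \<open>N\<close> the factor \<open>x\<^sup>N\<close> is a recurrent
  power of \<open>a\<close>, and therefore \<open>w\<close> is recurrent.\<close>

lemma system_height_mult_nilpotent:
  assumes l: "l \<ge> 1" and nil: "(a [^] t \<ominus> a [^] (t + l)) [^] (e::nat) = \<zero>"
  shows "system_height (carrier R) mult_a \<le> e * t"
proof -
  define x w where "x = a [^] l" and "w = a [^] (e * t)"
  have xw: "x \<in> carrier R" "w \<in> carrier R" using a by (simp_all add: x_def w_def)
  obtain g where g: "g \<in> carrier R" "(\<one> \<ominus> x) [^] e = \<one> \<ominus> x \<otimes> g"
    using one_minus_pow_expand[OF xw(1)] by blast
  have "a [^] t \<ominus> a [^] (t + l) = a [^] t \<otimes> (\<one> \<ominus> x)"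
    using a xw by (simp add: nat_pow_mult[symmetric] r_minus minus_eq r_distr x_def)
  hence "(a [^] t \<otimes> (\<one> \<ominus> x)) [^] e = \<zero>" using nil by simp
  hence "w \<otimes> (\<one> \<ominus> x \<otimes> g) = \<zero>"
    using a xw g by (simp add: nat_pow_distrib nat_pow_pow w_def mult.commute)
  moreover have "w \<otimes> (\<one> \<ominus> x \<otimes> g) = w \<ominus> w \<otimes> (x \<otimes> g)"
    using xw g(1) by algebra
  ultimately have step: "w \<otimes> (x \<otimes> g) = w" using xw g(1) by (metis r_right_minus_eq m_closed)
  have iter: "w \<otimes> (x [^] N \<otimes> g [^] N) = w" for N :: nat
  proof (induction N)
    case 0
    show ?case using xw by simp
  next
    case (Suc N)
    have "w \<otimes> (x [^] Suc N \<otimes> g [^] Suc N) = (w \<otimes> (x [^] N \<otimes> g [^] N)) \<otimes> (x \<otimes> g)"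
      using xw g(1) by (simp add: m_ac)
    with Suc step show ?case by simp
  qed
  let ?T = "system_height (carrier R) mult_a"
  have "?T \<le> l * ?T" using l by simp
  then obtain L where L: "L \<ge> 1" "a [^] (l * ?T + L) = a [^] (l * ?T)"
    using system_height_mult_le_iff by blast
  have xT: "x [^] ?T = a [^] (l * ?T)" using a by (simp add: x_def nat_pow_pow)
  define y where "y = w \<otimes> g [^] ?T"
  have yw: "y \<in> carrier R" "w = a [^] (l * ?T) \<otimes> y"
    using iter[of ?T] xw g(1) a by (simp_all add: y_def xT m_lcomm)
  have "a [^] (e * t + L) = a [^] L \<otimes> w" using a by (simp add: w_def nat_pow_mult add.commute)
  also have "\<dots> = a [^] (l * ?T + L) \<otimes> y"
    using yw a by (simp add: nat_pow_mult[symmetric] m_ac)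
  also have "\<dots> = a [^] (e * t)" using yw L(2) by (simp add: w_def)
  finally show ?thesis using L(1) system_height_mult_le_iff by blast
qed

end

end

section \<open>Ideals with two generators\<close>

context cring
begin

lemma genideal_pair:
  assumes "a \<in> carrier R" "b \<in> carrier R"
  shows "Idl {a, b} = {x \<otimes> a \<oplus> y \<otimes> b | x y. x \<in> carrier R \<and> y \<in> carrier R}"
proof -
  have "Idl {a, b} = Idl (PIdl a \<union> PIdl b)"
  proof (rule antisym)
    show "Idl {a, b} \<subseteq> Idl (PIdl a \<union> PIdl b)"
    proof (rule genideal_minimal)
      have sub: "PIdl a \<union> PIdl b \<subseteq> carrier R"
        using assms ideal.Icarr[OF cgenideal_ideal] by blast
      thus "ideal (Idl (PIdl a \<union> PIdl b)) R" by (rule genideal_ideal)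
      show "{a, b} \<subseteq> Idl (PIdl a \<union> PIdl b)"
        using genideal_self[OF sub] cgenideal_self assms by blast
    qed
    show "Idl (PIdl a \<union> PIdl b) \<subseteq> Idl {a, b}"
    proof (rule genideal_minimal)
      have sub: "{a, b} \<subseteq> carrier R" using assms by simp
      thus id: "ideal (Idl {a, b}) R" by (rule genideal_ideal)
      show "PIdl a \<union> PIdl b \<subseteq> Idl {a, b}"
        using genideal_self[OF sub] cgenideal_minimal[OF id] by simp
    qed
  qed
  also have "\<dots> = PIdl a <+> PIdl b" using assms by (intro union_genideal cgenideal_ideal)
  also have "\<dots> = {x \<otimes> a \<oplus> y \<otimes> b | x y. x \<in> carrier R \<and> y \<in> carrier R}"
    unfolding set_add_def' cgenideal_def by blast
  finally show ?thesis .
qed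

text \<open>Modulo \<open>m\<close> the element \<open>x\<close> is a multiple of \<open>\<pi>\<close>.  This is the step that turns a congruence modulo
  \<open>(m, p)\<close> into one modulo \<open>(m, p\<^sup>e)\<close>.\<close>

lemma pow_mem_genideal_pair:
  assumes c: "m \<in> carrier R" "\<pi> \<in> carrier R" and x: "x \<in> Idl {m, \<pi>}"
  shows "x [^] (k::nat) \<in> Idl {m, \<pi> [^] k}"
proof (induction k)
  case 0
  have "\<one> = \<zero> \<otimes> m \<oplus> \<one> \<otimes> \<one>" using c by simp
  hence "\<exists>y z. \<one> = y \<otimes> m \<oplus> z \<otimes> \<one> \<and> y \<in> carrier R \<and> z \<in> carrier R"
    by (metis zero_closed one_closed)
  thus ?case using c by (simp only: genideal_pair nat_pow_0 one_closed mem_Collect_eq)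
next
  case (Suc k)
  obtain u v where uv: "u \<in> carrier R" "v \<in> carrier R" "x = u \<otimes> m \<oplus> v \<otimes> \<pi>"
    using x genideal_pair[OF c] by blast
  obtain u' v' where uv': "u' \<in> carrier R" "v' \<in> carrier R" "x [^] k = u' \<otimes> m \<oplus> v' \<otimes> \<pi> [^] k"
    using Suc genideal_pair[of m "\<pi> [^] k"] c by auto
  define q where "q = \<pi> [^] k"
  have q: "q \<in> carrier R" using c by (simp add: q_def)
  have "x [^] Suc k = (u' \<otimes> m \<oplus> v' \<otimes> q) \<otimes> (u \<otimes> m \<oplus> v \<otimes> \<pi>)"
    using uv uv' c by (simp add: q_def)
  also have "\<dots> = (u' \<otimes> (u \<otimes> m \<oplus> v \<otimes> \<pi>) \<oplus> v' \<otimes> q \<otimes> u) \<otimes> m \<oplus> (v' \<otimes> v) \<otimes> (q \<otimes> \<pi>)"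
    using uv(1,2) uv'(1,2) c q by algebra
  finally have eq: "x [^] Suc k =
    (u' \<otimes> (u \<otimes> m \<oplus> v \<otimes> \<pi>) \<oplus> v' \<otimes> q \<otimes> u) \<otimes> m \<oplus> (v' \<otimes> v) \<otimes> \<pi> [^] Suc k"
    by (simp add: q_def)
  have "\<exists>y z. x [^] Suc k = y \<otimes> m \<oplus> z \<otimes> \<pi> [^] Suc k \<and> y \<in> carrier R \<and> z \<in> carrier R"
    using eq uv(1,2) uv'(1,2) c q by blast
  thus ?case using c by (simp only: genideal_pair nat_pow_closed mem_Collect_eq)
qed

end

text \<open>The kernel of \<open>R \<rightarrow> S \<rightarrow> S/(h m)\<close>: dividing out \<open>\<pi>\<close> first and \<open>m\<close> afterwards is the same as dividing
  out both at once.  It is used for \<open>\<int>[t] \<rightarrow> R \<rightarrow> R\<^sub>e\<close>, for \<open>\<int>[t] \<rightarrow> F\<^sub>p[t] \<rightarrow> F\<^sub>q\<close> and for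
  \<open>R[x] \<rightarrow> R\<^sub>e[x] \<rightarrow> R\<^sub>e[x]/(m)\<close>.\<close>

lemma (in ring_hom_cring) hom_mem_cgenideal_iff:
  assumes surj: "h ` carrier R = carrier S"
    and ker: "\<And>x. x \<in> carrier R \<Longrightarrow> h x = \<zero>\<^bsub>S\<^esub> \<longleftrightarrow> x \<in> PIdl\<^bsub>R\<^esub> \<pi>"
    and c: "\<pi> \<in> carrier R" "m \<in> carrier R" "x \<in> carrier R"
  shows "h x \<in> PIdl\<^bsub>S\<^esub> (h m) \<longleftrightarrow> x \<in> Idl\<^bsub>R\<^esub> {m, \<pi>}"
proof
  assume "h x \<in> PIdl\<^bsub>S\<^esub> (h m)"
  then obtain w where w: "w \<in> carrier S" "h x = w \<otimes>\<^bsub>S\<^esub> h m" unfolding cgenideal_def by blast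
  have "w \<in> h ` carrier R" using w(1) surj by simp
  then obtain u where u: "u \<in> carrier R" "h x = h u \<otimes>\<^bsub>S\<^esub> h m" using w(2) by auto
  hence "h (x \<ominus> u \<otimes> m) = \<zero>\<^bsub>S\<^esub>" using c by (simp add: R.minus_eq S.r_neg)
  hence "x \<ominus> u \<otimes> m \<in> PIdl\<^bsub>R\<^esub> \<pi>" using ker[of "x \<ominus> u \<otimes> m"] u c by blast
  then obtain v where v: "v \<in> carrier R" "x \<ominus> u \<otimes> m = v \<otimes> \<pi>" unfolding cgenideal_def by blast
  have "x = u \<otimes> m \<oplus> (x \<ominus> u \<otimes> m)" using u c by algebra
  thus "x \<in> Idl\<^bsub>R\<^esub> {m, \<pi>}" using u v c by (auto simp: R.genideal_pair)
next
  assume "x \<in> Idl\<^bsub>R\<^esub> {m, \<pi>}"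
  then obtain u v where uv: "u \<in> carrier R" "v \<in> carrier R" "x = u \<otimes> m \<oplus> v \<otimes> \<pi>"
    unfolding R.genideal_pair[OF c(2,1)] by blast
  have "v \<otimes> \<pi> \<in> PIdl\<^bsub>R\<^esub> \<pi>" using uv(2) unfolding cgenideal_def by blast
  hence "h (v \<otimes> \<pi>) = \<zero>\<^bsub>S\<^esub>" using ker[of "v \<otimes> \<pi>"] uv c by blast
  hence "h v \<otimes>\<^bsub>S\<^esub> h \<pi> = \<zero>\<^bsub>S\<^esub>" using uv c by simp
  hence "h x = h u \<otimes>\<^bsub>S\<^esub> h m" using uv c by simp
  thus "h x \<in> PIdl\<^bsub>S\<^esub> (h m)" using uv unfolding cgenideal_def by blast
qed

section \<open>Products of prime powers in a domain\<close>

text \<open>The fold that occurs in \<open>is_factorization\<close>.\<close>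

definition power_prod :: "('a, 'b) ring_scheme \<Rightarrow> ('a \<times> nat) list \<Rightarrow> 'a" where
  "power_prod R Gs = foldr (\<lambda>(G, k) z. (G [^]\<^bsub>R\<^esub> k) \<otimes>\<^bsub>R\<^esub> z) Gs \<one>\<^bsub>R\<^esub>"

abbreviation (input) set_exponents :: "('a \<Rightarrow> nat) \<Rightarrow> ('a \<times> nat) list \<Rightarrow> ('a \<times> nat) list" where
  "set_exponents \<kappa> Gs \<equiv> map (\<lambda>(G, k). (G, \<kappa> G)) Gs"

lemma power_prod_Nil [simp]: "power_prod R [] = \<one>\<^bsub>R\<^esub>"
  and power_prod_Cons [simp]:
    "power_prod R (Gk # Gs) = (fst Gk [^]\<^bsub>R\<^esub> snd Gk) \<otimes>\<^bsub>R\<^esub> power_prod R Gs"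
  by (simp_all add: power_prod_def case_prod_beta)

lemma (in cring) power_prod_closed:
  "fst ` set Gs \<subseteq> carrier R \<Longrightarrow> power_prod R Gs \<in> carrier R"
  by (induction Gs) auto

lemma (in cring) power_prod_pow:
  assumes "fst ` set Gs \<subseteq> carrier R"
  shows "power_prod R Gs [^] (t::nat) = power_prod R (map (\<lambda>(G, k). (G, t * k)) Gs)"
  using assms
  by (induction Gs) (auto simp: nat_pow_distrib nat_pow_pow mult.commute power_prod_closed)

lemma (in cring) divides_mult_mono:
  assumes "a divides b" "c divides d" "a \<in> carrier R" "c \<in> carrier R"
  shows "(a \<otimes> c) divides (b \<otimes> d)"
proof -
  obtain x y where "x \<in> carrier R" "b = a \<otimes> x" "y \<in> carrier R" "d = c \<otimes> y"
    using assms unfolding factor_def by blast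
  hence "b \<otimes> d = (a \<otimes> c) \<otimes> (x \<otimes> y)" "x \<otimes> y \<in> carrier R" using assms by (simp_all add: m_ac)
  thus ?thesis unfolding factor_def by blast
qed

lemma (in cring) pow_divides_pow: 
  assumes "G \<in> carrier R" "(i::nat) \<le> j"
  shows "G [^] i divides G [^] j"
proof -
  have "G [^] j = G [^] i \<otimes> G [^] (j - i)" using assms by (simp add: nat_pow_mult)
  thus ?thesis using assms unfolding factor_def by auto
qed

lemma (in cring) power_prod_divides:
  assumes "fst ` set Gs \<subseteq> carrier R" "\<And>G k. (G, k) \<in> set Gs \<Longrightarrow> \<alpha> G \<le> \<beta> G k"
  shows "power_prod R (map (\<lambda>(G, k). (G, \<alpha> G)) Gs) divides
         power_prod R (map (\<lambda>(G, k). (G, \<beta> G k :: nat)) Gs)"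
  using assms
proof (induction Gs)
  case Nil
  show ?case by (simp add: one_divides)
next
  case (Cons Gk Gs)
  obtain G k where Gk: "Gk = (G, k)" by (cases Gk)
  have "fst ` set (map (\<lambda>(G, k). (G, \<alpha> G)) Gs) = fst ` set Gs" by force
  hence c: "G \<in> carrier R" "power_prod R (map (\<lambda>(G, k). (G, \<alpha> G)) Gs) \<in> carrier R"
    using Cons.prems(1) Gk power_prod_closed by simp_all
  have "G [^] \<alpha> G divides G [^] \<beta> G k" using Cons.prems Gk by (intro pow_divides_pow) auto
  with Cons.IH Cons.prems c show ?case by (auto simp: Gk intro: divides_mult_mono)
qed

context domain
begin

text \<open>In \<open>d c = G u\<close> the prime \<open>G\<close> must divide the cofactor \<open>c\<close>, and can be cancelled there.\<close>

lemma prime_divides_cancel: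
  assumes G: "prime R G" "G \<in> carrier R" "G \<noteq> \<zero>" and d: "d \<in> carrier R" "\<not> G divides d"
    and u: "u \<in> carrier R" and dvd: "d divides (G \<otimes> u)"
  shows "d divides u"
proof -
  obtain c where c: "c \<in> carrier R" "G \<otimes> u = d \<otimes> c" using dvd unfolding factor_def by blast
  hence "G divides (d \<otimes> c)" using u unfolding factor_def by metis
  hence "G divides c" using G d c(1) unfolding prime_def by blast
  then obtain c' where c': "c' \<in> carrier R" "c = G \<otimes> c'" unfolding factor_def by blast
  have "G \<otimes> u = G \<otimes> (d \<otimes> c')" using c c' d G by (simp add: m_lcomm)
  hence "u = d \<otimes> c'" using G u d c' m_lcancel by simp
  thus ?thesis using c' unfolding factor_def by blast
qed

lemma prime_pow_divides_cancel:
  assumes G: "prime R G" "G \<in> carrier R" "G \<noteq> \<zero>" and d: "d \<in> carrier R" "\<not> G divides d"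
    and u: "u \<in> carrier R"
  shows "d divides (G [^] (k::nat) \<otimes> u) \<Longrightarrow> d divides u"
proof (induction k)
  case 0
  thus ?case using u by simp
next
  case (Suc k)
  have "d divides (G \<otimes> (G [^] k \<otimes> u))" using Suc.prems G u by (simp add: m_ac)
  from prime_divides_cancel[OF G d _ this] Suc.IH G u show ?case by simp
qed

lemma power_prod_divides_cancel:
  assumes Gs: "\<And>G. G \<in> fst ` set Gs \<Longrightarrow> prime R G \<and> G \<in> carrier R \<and> G \<noteq> \<zero> \<and> \<not> G divides d"
    and d: "d \<in> carrier R" and u: "u \<in> carrier R"
  shows "d divides (power_prod R Gs \<otimes> u) \<Longrightarrow> d divides u"
  using Gs
proof (induction Gs)
  case Nil
  thus ?case using u by simp
next
  case (Cons Gk Gs)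
  have c: "fst Gk \<in> carrier R" "power_prod R Gs \<in> carrier R"
    using Cons.prems(2) by (auto intro!: power_prod_closed)
  have "d divides (fst Gk [^] snd Gk \<otimes> (power_prod R Gs \<otimes> u))"
    using Cons.prems(1) c u by (simp add: m_assoc)
  hence "d divides (power_prod R Gs \<otimes> u)"
    using prime_pow_divides_cancel[of "fst Gk" d "power_prod R Gs \<otimes> u" "snd Gk"] Cons.prems(2) c u d
    by simp
  thus ?case using Cons by simp
qed

lemma prime_divides_pow:
  assumes "prime R G" "G \<in> carrier R" "a \<in> carrier R"
  shows "G divides a [^] (k::nat) \<Longrightarrow> G divides a"
proof (induction k)
  case 0
  thus ?case using assms divides_one unfolding prime_def by simp
next
  case (Suc k)
  thus ?case using assms unfolding prime_def by (metis nat_pow_Suc nat_pow_closed)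
qed

lemma prime_divides_power_prod:
  assumes G: "prime R G" "G \<in> carrier R" and w: "w \<in> carrier R" "\<not> G divides w"
    and Gs: "fst ` set Gs \<subseteq> carrier R"
  shows "G divides (power_prod R Gs \<otimes> w) \<Longrightarrow> \<exists>G'\<in>fst ` set Gs. G divides G'"
  using Gs
proof (induction Gs)
  case Nil
  thus ?case using w by simp
next
  case (Cons Gk Gs)
  have c: "fst Gk \<in> carrier R" "power_prod R Gs \<in> carrier R"
    using Cons.prems(2) by (auto intro!: power_prod_closed)
  have "G divides (fst Gk [^] snd Gk \<otimes> (power_prod R Gs \<otimes> w))"
    using Cons.prems(1) c w by (simp add: m_assoc)
  hence "G divides (fst Gk [^] snd Gk) \<or> G divides (power_prod R Gs \<otimes> w)"
    using G c w unfolding prime_def by simp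
  thus ?case using Cons prime_divides_pow[OF G c(1)] by auto
qed

lemma prime_pow_divides_iff:
  assumes G: "prime R G" "G \<in> carrier R" "G \<noteq> \<zero>" and w: "w \<in> carrier R" "\<not> G divides w"
  shows "G [^] (k::nat) divides (G [^] (j::nat) \<otimes> w) \<longleftrightarrow> k \<le> j"
proof
  assume "k \<le> j"
  hence "G [^] j \<otimes> w = G [^] k \<otimes> (G [^] (j - k) \<otimes> w)"
    using G w by (simp add: m_assoc[symmetric] nat_pow_mult)
  thus "G [^] k divides (G [^] j \<otimes> w)" using G w unfolding factor_def by auto
next
  assume dvd: "G [^] k divides (G [^] j \<otimes> w)"
  show "k \<le> j"
  proof (rule ccontr)
    assume "\<not> k \<le> j"
    hence k: "k = j + Suc (k - j - 1)" by simp
    let ?i = "k - j - 1"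
    have "G [^] k = G [^] j \<otimes> (G [^] Suc ?i)"
      using G by (subst k) (simp only: nat_pow_mult[symmetric])
    hence "(G [^] j \<otimes> (G [^] Suc ?i)) divides (G [^] j \<otimes> w)" using dvd by simp
    moreover have "G [^] j \<noteq> \<zero>" for j :: nat using G by (induction j) (auto simp: integral_iff)
    ultimately have "G [^] Suc ?i divides w" using G w mult_divides[of "G [^] Suc ?i" w "G [^] j"] by simp
    then obtain c where "c \<in> carrier R" "w = G [^] Suc ?i \<otimes> c" unfolding factor_def by blast
    hence "w = G \<otimes> (G [^] ?i \<otimes> c)" "G [^] ?i \<otimes> c \<in> carrier R" using G by (simp_all add: m_ac)
    thus False using w unfolding factor_def by blast
  qed
qed

text \<open>Collects the factors equal to one prime; the remaining primes are not divisible by it.\<close>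

lemma power_prod_split:
  assumes "(G, j) \<in> set Js" "distinct (map fst Js)"
    and "\<And>G. G \<in> fst ` set Js \<Longrightarrow> prime R G \<and> G \<in> carrier R"
    and "\<And>G G'. G \<in> fst ` set Js \<Longrightarrow> G' \<in> fst ` set Js \<Longrightarrow> G divides G' \<Longrightarrow> G = G'"
    and w: "w \<in> carrier R" "\<not> G divides w"
  shows "\<exists>w'\<in>carrier R. power_prod R Js \<otimes> w = G [^] j \<otimes> w' \<and> \<not> G divides w'"
  using assms(1-4)
proof (induction Js)
  case Nil
  thus ?case by simp
next
  case (Cons Gk Js)
  have c: "fst Gk \<in> carrier R" "power_prod R Js \<in> carrier R" "fst ` set Js \<subseteq> carrier R"
    using Cons.prems(3) by (auto intro!: power_prod_closed)
  have "G \<in> fst ` set (Gk # Js)" using Cons.prems(1) by force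
  hence G: "prime R G" "G \<in> carrier R" using Cons.prems(3) by blast+
  show ?case
  proof (cases "Gk = (G, j)")
    case True
    have "\<not> G divides (power_prod R Js \<otimes> w)"
    proof
      assume "G divides (power_prod R Js \<otimes> w)"
      then obtain G' where G': "G' \<in> fst ` set Js" "G divides G'"
        using prime_divides_power_prod[OF G w c(3)] by blast
      hence "G = G'" using Cons.prems(4)[of G G'] True by simp
      thus False using G'(1) Cons.prems(2) True by simp
    qed
    thus ?thesis using True c w G by (intro bexI[of _ "power_prod R Js \<otimes> w"]) (simp_all add: m_assoc)
  next
    case False
    hence mem: "(G, j) \<in> set Js" using Cons.prems(1) by auto
    have "\<exists>w'\<in>carrier R. power_prod R Js \<otimes> w = G [^] j \<otimes> w' \<and> \<not> G divides w'"
    proof (rule Cons.IH[OF mem])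
      show "H = H'" if "H \<in> fst ` set Js" "H' \<in> fst ` set Js" "H divides H'" for H H'
        using Cons.prems(4)[of H H'] that by simp
    qed (use Cons.prems(2,3) in auto)
    then obtain w' where w': "w' \<in> carrier R" "power_prod R Js \<otimes> w = G [^] j \<otimes> w'" "\<not> G divides w'"
      by blast
    have "G \<in> fst ` set Js" using mem by force
    hence "fst Gk \<noteq> G" using Cons.prems(2) by auto
    hence "\<not> G divides fst Gk" using Cons.prems(4)[of G "fst Gk"] mem by force
    hence "\<not> G divides (fst Gk [^] snd Gk \<otimes> w')"
      using w' G c prime_divides_pow[OF G c(1)] unfolding prime_def by blast
    moreover have "power_prod R (Gk # Js) \<otimes> w = G [^] j \<otimes> (fst Gk [^] snd Gk \<otimes> w')"
    proof -
      have "power_prod R (Gk # Js) \<otimes> w = fst Gk [^] snd Gk \<otimes> (power_prod R Js \<otimes> w)"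
        using c w by (simp add: m_assoc)
      also have "\<dots> = G [^] j \<otimes> (fst Gk [^] snd Gk \<otimes> w')"
        using w' G c by (simp add: m_lcomm)
      finally show ?thesis .
    qed
    ultimately show ?thesis using w' c by blast
  qed
qed

text \<open>A common divisor of \<open>d\<close> and the product that is divisible by none of the primes divides \<open>1\<close>, by
  \<open>power_prod_divides_cancel\<close>.\<close>

lemma one_gcdof_power_prod_iff:
  assumes Gs: "\<And>G k. (G, k) \<in> set Gs \<Longrightarrow> prime R G \<and> G \<in> carrier R \<and> G \<noteq> \<zero> \<and> k \<ge> 1"
    and d: "d \<in> carrier R"
  shows "\<one> gcdof d (power_prod R Gs) \<longleftrightarrow> (\<forall>G\<in>fst ` set Gs. \<not> G divides d)"
proof
  assume gcd: "\<one> gcdof d (power_prod R Gs)"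
  show "\<forall>G\<in>fst ` set Gs. \<not> G divides d"
  proof (safe)
    fix G k assume Gk: "(G, k) \<in> set Gs" and dvd: "fst (G, k) divides d"
    have "power_prod R [(G, 1)] divides power_prod R Gs"
    proof -
      obtain As Bs where split: "Gs = As @ (G, k) # Bs" using split_list[OF Gk] by blast
      have "fst ` set Gs \<subseteq> carrier R" using Gs by auto
      hence cl: "fst ` set As \<subseteq> carrier R" "fst ` set Bs \<subseteq> carrier R" "G \<in> carrier R" "k \<ge> 1"
        using Gs[OF Gk] by (simp_all add: split image_Un)
      have "power_prod R (As @ Cs) = power_prod R As \<otimes> power_prod R Cs"
        if "fst ` set Cs \<subseteq> carrier R" for Cs
        using cl(1) that by (induction As) (auto simp: m_assoc power_prod_closed)
      hence "power_prod R Gs = power_prod R As \<otimes> (G [^] k \<otimes> power_prod R Bs)"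
        using cl by (simp add: split)
      moreover have "G [^] k = G \<otimes> G [^] (k - 1)"
        using cl by (metis One_nat_def Suc_pred less_eq_Suc_le nat_pow_Suc2)
      ultimately have "power_prod R Gs = G \<otimes> (power_prod R As \<otimes> (G [^] (k - 1) \<otimes> power_prod R Bs))"
        using cl power_prod_closed by (simp add: m_ac)
      thus ?thesis using cl power_prod_closed unfolding factor_def by auto
    qed
    hence "G divides power_prod R Gs" using Gs[OF Gk] by simp
    hence "G divides \<one>" using gcd dvd Gs[OF Gk] unfolding isgcd_def by simp
    thus False using Gs[OF Gk] divides_one unfolding prime_def by blast
  qed
next
  assume ndvd: "\<forall>G\<in>fst ` set Gs. \<not> G divides d"
  have cl: "fst ` set Gs \<subseteq> carrier R" using Gs by auto
  show "\<one> gcdof d (power_prod R Gs)"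
    unfolding isgcd_def
  proof (intro conjI ballI impI)
    show "\<one> divides d" "\<one> divides power_prod R Gs"
      using d cl power_prod_closed by (auto intro!: one_divides)
    fix y assume y: "y \<in> carrier R" "y divides d \<and> y divides power_prod R Gs"
    have "\<not> G divides y" if "G \<in> fst ` set Gs" for G
    proof
      assume "G divides y"
      hence "G divides d" using y that cl d by (meson divides_trans subsetD)
      thus False using ndvd that by blast
    qed
    moreover have "y divides (power_prod R Gs \<otimes> \<one>)" using y cl power_prod_closed by simp
    ultimately show "y divides \<one>"
      using Gs y(1) by (intro power_prod_divides_cancel[of Gs y \<one>]) auto
  qed
qed

text \<open>This determines the preperiod of \<open>f\<close> modulo \<open>M w\<close>, where \<open>M\<close> collects the primes of \<open>f\<close>.  From left to
  right, a prime of \<open>f\<close> does not divide \<open>f\<^sup>l - 1\<close>, so its power in \<open>M\<close> has to divide \<open>f\<^sup>t\<close>.  From right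
  to left, \<open>M\<close> divides \<open>f\<^sup>t\<close>, and \<open>w\<close> divides \<open>f\<^sup>l - 1\<close> for the \<open>l = l0\<close> of the hypothesis, since the
  factor \<open>f\<^sup>a\<close> has no prime in common with \<open>w\<close>.  The hypothesis holds in any situation where the powers of \<open>f\<close> take
  only finitely many values modulo \<open>M w\<close>.\<close>

lemma divides_power_prod_period_iff:
  fixes Gs :: "('a \<times> nat) list" and \<kappa> :: "'a \<Rightarrow> nat"
  assumes dist: "distinct (map fst Gs)"
    and Gs: "\<And>G k. (G, k) \<in> set Gs \<Longrightarrow> prime R G \<and> G \<in> carrier R \<and> G \<noteq> \<zero> \<and> k \<ge> 1"
    and indep: "\<And>G G'. G \<in> fst ` set Gs \<Longrightarrow> G' \<in> fst ` set Gs \<Longrightarrow> G divides G' \<Longrightarrow> G = G'"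
    and w: "w \<in> carrier R" "\<And>G. G \<in> fst ` set Gs \<Longrightarrow> \<not> G divides w"
  defines "f \<equiv> power_prod R Gs"
    and "M \<equiv> power_prod R (set_exponents \<kappa> Gs)"
  assumes per: "l0 \<ge> 1" "(M \<otimes> w) divides (f [^] (a::nat) \<otimes> (f [^] (l0::nat) \<ominus> \<one>))"
  shows "(\<exists>l\<ge>(1::nat). (M \<otimes> w) divides (f [^] (t::nat) \<otimes> (f [^] l \<ominus> \<one>))) \<longleftrightarrow>
         (\<forall>(G, k)\<in>set Gs. \<kappa> G \<le> t * k)"
proof
  have cl: "fst ` set Gs \<subseteq> carrier R" using Gs by auto
  have clM: "fst ` set (set_exponents \<kappa> Gs) \<subseteq> carrier R" using Gs by auto
  have c: "f \<in> carrier R" "M \<in> carrier R" using cl clM by (simp_all add: f_def M_def power_prod_closed)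
  {
    assume "\<exists>l\<ge>(1::nat). (M \<otimes> w) divides (f [^] (t::nat) \<otimes> (f [^] l \<ominus> \<one>))"
    then obtain l :: nat where l: "l \<ge> 1" "(M \<otimes> w) divides (f [^] t \<otimes> (f [^] l \<ominus> \<one>))" by blast
    show "\<forall>(G, k)\<in>set Gs. \<kappa> G \<le> t * k"
    proof safe
      fix G k assume Gk: "(G, k) \<in> set Gs"
      have G: "prime R G" "G \<in> carrier R" "G \<noteq> \<zero>" "k \<ge> 1" using Gs[OF Gk] by auto
      have G1: "\<not> G divides \<one>" using G divides_one unfolding prime_def by blast
      have "\<exists>w'\<in>carrier R. f \<otimes> \<one> = G [^] k \<otimes> w' \<and> \<not> G divides w'"
        unfolding f_def
      proof (intro power_prod_split[OF Gk dist _ _ one_closed G1])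
        show "prime R H \<and> H \<in> carrier R" if "H \<in> fst ` set Gs" for H using that Gs by auto
      qed (rule indep)
      then obtain c' where c': "c' \<in> carrier R" "f = G [^] k \<otimes> c'" "\<not> G divides c'" using c by auto
      have "\<exists>w'\<in>carrier R. M \<otimes> w = G [^] \<kappa> G \<otimes> w' \<and> \<not> G divides w'"
        unfolding M_def
      proof (intro power_prod_split)
        have "map fst (set_exponents \<kappa> Gs) = map fst Gs" by auto
        thus "distinct (map fst (set_exponents \<kappa> Gs))" using dist by metis
        have *: "fst ` set (set_exponents \<kappa> Gs) = fst ` set Gs" by force
        show "prime R H \<and> H \<in> carrier R" if "H \<in> fst ` set (set_exponents \<kappa> Gs)" for H
          using that Gs unfolding * by auto
        show "H = H'" if "H \<in> fst ` set (set_exponents \<kappa> Gs)"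
          "H' \<in> fst ` set (set_exponents \<kappa> Gs)" "H divides H'" for H H'
          using that indep unfolding * by blast
        show "(G, \<kappa> G) \<in> set (set_exponents \<kappa> Gs)" using Gk by force
        show "\<not> G divides w" using w(2) Gk by force
      qed (use w in auto)
      then obtain w' where w': "w' \<in> carrier R" "M \<otimes> w = G [^] \<kappa> G \<otimes> w'" by blast
      hence "G [^] \<kappa> G divides (M \<otimes> w)" unfolding factor_def by auto
      hence *: "G [^] \<kappa> G divides (f [^] t \<otimes> (f [^] l \<ominus> \<one>))"
        using l(2) by (rule divides_trans) (use G in simp)
      have "f [^] t = G [^] (t * k) \<otimes> c' [^] t"
        using c' G by (simp add: nat_pow_distrib nat_pow_pow mult.commute)
      hence "f [^] t \<otimes> (f [^] l \<ominus> \<one>) = G [^] (t * k) \<otimes> (c' [^] t \<otimes> (f [^] l \<ominus> \<one>))"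
        using c' G c by (simp add: m_assoc)
      moreover have "\<not> G divides (c' [^] t \<otimes> (f [^] l \<ominus> \<one>))"
      proof
        assume "G divides (c' [^] t \<otimes> (f [^] l \<ominus> \<one>))"
        hence "G divides (c' [^] t) \<or> G divides (f [^] l \<ominus> \<one>)"
          using G c' c unfolding prime_def by simp
        hence "G divides (f [^] l \<ominus> \<one>)" using prime_divides_pow[OF G(1,2) c'(1)] c'(3) by blast
        then obtain y where y: "y \<in> carrier R" "f [^] l \<ominus> \<one> = G \<otimes> y" unfolding factor_def by blast
        have Gk1: "G [^] k = G \<otimes> G [^] (k - 1)" "f [^] l = f \<otimes> f [^] (l - 1)"
          using G c l(1) by (metis One_nat_def Suc_pred less_eq_Suc_le nat_pow_Suc2)+
        have fl: "f [^] l = G \<otimes> (G [^] (k - 1) \<otimes> c' \<otimes> f [^] (l - 1))"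
          using G c c' unfolding Gk1(2) by (subst (1) c'(2)) (simp add: Gk1(1) m_assoc)
        define u where "u = G [^] (k - 1) \<otimes> c' \<otimes> f [^] (l - 1)"
        have u: "u \<in> carrier R" "f [^] l = G \<otimes> u" using fl G c c' by (simp_all add: u_def)
        have "\<one> = z \<ominus> (z \<ominus> \<one>)" if "z \<in> carrier R" for z using that by algebra
        hence "\<one> = f [^] l \<ominus> (f [^] l \<ominus> \<one>)" using c by blast
        also have "\<dots> = G \<otimes> u \<ominus> G \<otimes> y" using u y by simp
        also have "\<dots> = G \<otimes> (u \<ominus> y)" using u y G by algebra
        finally have "\<one> = G \<otimes> (u \<ominus> y)" .
        moreover have "u \<ominus> y \<in> carrier R" using u y by simp
        ultimately show False using G1 unfolding factor_def by blast
      qed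
      ultimately show "\<kappa> G \<le> t * k"
        using * prime_pow_divides_iff[OF G(1-3)] c' c by simp
    qed
  }
  {
    assume le: "\<forall>(G, k)\<in>set Gs. \<kappa> G \<le> t * k"
    have 1: "M divides f [^] t"
      unfolding M_def f_def power_prod_pow[OF cl]
      using cl le by (intro power_prod_divides) auto
    have "w divides (M \<otimes> w)" using c w unfolding factor_def by (metis m_comm)
    hence "w divides (f [^] a \<otimes> (f [^] l0 \<ominus> \<one>))" using per(2) w by (blast intro: divides_trans)
    hence "w divides (power_prod R (map (\<lambda>(G, k). (G, a * k)) Gs) \<otimes> (f [^] l0 \<ominus> \<one>))"
      unfolding f_def power_prod_pow[OF cl] .
    hence "w divides (f [^] l0 \<ominus> \<one>)"
    proof (rule power_prod_divides_cancel[rotated 3])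
      have *: "fst ` set (map (\<lambda>(G, k). (G, a * k)) Gs) = fst ` set Gs" by force
      show "prime R G \<and> G \<in> carrier R \<and> G \<noteq> \<zero> \<and> \<not> G divides w"
        if "G \<in> fst ` set (map (\<lambda>(G, k). (G, a * k)) Gs)" for G
        using that Gs w(2)[of G] unfolding * by auto
    qed (use w c in simp_all)
    with 1 have "(M \<otimes> w) divides (f [^] t \<otimes> (f [^] l0 \<ominus> \<one>))"
      using c w by (intro divides_mult_mono)
    thus "\<exists>l\<ge>(1::nat). (M \<otimes> w) divides (f [^] (t::nat) \<otimes> (f [^] l \<ominus> \<one>))" using per(1) by blast
  }
qed

end

section \<open>Division by monic polynomials\<close>

context cring
begin

lemma division_diff:
  assumes "q \<in> carrier R" "q' \<in> carrier R" "g \<in> carrier R" "r \<in> carrier R" "r' \<in> carrier R"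
    and eq: "q \<otimes> g \<oplus> r = q' \<otimes> g \<oplus> r'"
  shows "(q \<ominus> q') \<otimes> g = r' \<ominus> r"
proof -
  have "(q \<ominus> q') \<otimes> g = (q \<otimes> g \<oplus> r) \<ominus> r \<ominus> q' \<otimes> g" using assms(1-5) by algebra
  also have "\<dots> = r' \<ominus> r" unfolding eq using assms(1-5) by algebra
  finally show ?thesis .
qed

lemma division_add:
  assumes "x \<in> carrier R" "q \<in> carrier R" "g \<in> carrier R" "r \<in> carrier R" "f \<in> carrier R"
    and "f \<ominus> (q \<otimes> g \<oplus> r) = x \<otimes> g"
  shows "f = (x \<oplus> q) \<otimes> g \<oplus> r"
proof -
  have "f = f \<ominus> (q \<otimes> g \<oplus> r) \<oplus> (q \<otimes> g \<oplus> r)" using assms(1-5) by algebra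
  also have "\<dots> = x \<otimes> g \<oplus> (q \<otimes> g \<oplus> r)" by (simp only: assms(6))
  also have "\<dots> = (x \<oplus> q) \<otimes> g \<oplus> r" using assms(1-5) by algebra
  finally show ?thesis .
qed

lemma add_minus_cancel_right: "x \<in> carrier R \<Longrightarrow> y \<in> carrier R \<Longrightarrow> (x \<oplus> y) \<ominus> y = x"
  by algebra

lemma division_minus_same_remainder:
  "q \<in> carrier R \<Longrightarrow> q' \<in> carrier R \<Longrightarrow> g \<in> carrier R \<Longrightarrow> r \<in> carrier R \<Longrightarrow>
    (q \<otimes> g \<oplus> r) \<ominus> (q' \<otimes> g \<oplus> r) = (q \<ominus> q') \<otimes> g"
  by algebra

end

context UP_cring
begin

lemma monic_in_iff: "monic_in R g \<longleftrightarrow> g \<in> carrier P \<and> lcoeff g = \<one>"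
  by (simp add: monic_in_def P_def)

lemma coeff_mult_deg_sum:
  assumes R: "p \<in> carrier P" "q \<in> carrier P"
  shows "coeff P (p \<otimes>\<^bsub>P\<^esub> q) (deg R p + deg R q) = lcoeff p \<otimes> lcoeff q"
proof -
  let ?d = "deg R p"
  let ?s = "\<lambda>i. coeff P p i \<otimes> coeff P q (?d + deg R q - i)"
  have "?s i = (if ?d = i then ?s i else \<zero>)" for i
    using R deg_aboveD[of p i] deg_aboveD[of q "?d + deg R q - i"] by (cases i ?d rule: linorder_cases) simp_all
  hence "(\<Oplus>i\<in>{..?d + deg R q}. ?s i) = (\<Oplus>i\<in>{..?d + deg R q}. if ?d = i then ?s i else \<zero>)"
    using R by (intro R.finsum_cong') auto
  also have "\<dots> = ?s ?d" using R by (intro R.finsum_singleton) auto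
  finally show ?thesis using R by simp
qed

text \<open>A monic factor keeps the degree additive even if there are zero divisors, as in \<open>R\<^sub>e\<close>.\<close>

lemma deg_mult_monic:
  assumes g: "monic_in R g" and p: "p \<in> carrier P" "p \<noteq> \<zero>\<^bsub>P\<^esub>"
  shows "deg R (p \<otimes>\<^bsub>P\<^esub> g) = deg R p + deg R g" "lcoeff (p \<otimes>\<^bsub>P\<^esub> g) = lcoeff p" "p \<otimes>\<^bsub>P\<^esub> g \<noteq> \<zero>\<^bsub>P\<^esub>"
proof -
  have c: "coeff P (p \<otimes>\<^bsub>P\<^esub> g) (deg R p + deg R g) = lcoeff p"
    using coeff_mult_deg_sum[of p g] p g by (simp add: monic_in_iff)
  have nz: "lcoeff p \<noteq> \<zero>" using p lcoeff_nonzero2 by blast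
  show d: "deg R (p \<otimes>\<^bsub>P\<^esub> g) = deg R p + deg R g"
  proof (rule le_antisym)
    show "deg R (p \<otimes>\<^bsub>P\<^esub> g) \<le> deg R p + deg R g"
      using p g by (intro deg_mult_ring) (auto simp: monic_in_iff)
    show "deg R p + deg R g \<le> deg R (p \<otimes>\<^bsub>P\<^esub> g)"
      using p g c nz by (intro deg_belowI) (auto simp: monic_in_iff simp del: coeff_mult)
  qed
  show "lcoeff (p \<otimes>\<^bsub>P\<^esub> g) = lcoeff p" using c d by simp
  show "p \<otimes>\<^bsub>P\<^esub> g \<noteq> \<zero>\<^bsub>P\<^esub>" using c nz by (metis coeff_zero)
qed

lemma monic_nonzero: "monic_in R g \<Longrightarrow> \<one> \<noteq> \<zero> \<Longrightarrow> g \<noteq> \<zero>\<^bsub>P\<^esub>"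
  by (auto simp: monic_in_iff)

lemma monic_mult_iff:
  assumes "monic_in R g" "p \<in> carrier P" "\<one> \<noteq> \<zero>"
  shows "monic_in R (p \<otimes>\<^bsub>P\<^esub> g) \<longleftrightarrow> monic_in R p"
proof (cases "p = \<zero>\<^bsub>P\<^esub>")
  case False
  thus ?thesis using assms deg_mult_monic(2)[OF assms(1,2) False] by (simp add: monic_in_iff)
next
  case True
  thus ?thesis using assms by (simp add: monic_in_iff)
qed

lemma monic_one: "monic_in R \<one>\<^bsub>P\<^esub>"
  by (simp add: monic_in_iff)

lemma monic_degree_zero:
  assumes "monic_in R g" "deg R g = 0"
  shows "g = \<one>\<^bsub>P\<^esub>"
  using assms deg_zero_impl_monom[of g] by (simp add: monic_in_iff)

lemma monic_division:
  assumes "monic_in R g" "f \<in> carrier P" "\<one> \<noteq> \<zero>"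
  shows "\<exists>q r. q \<in> carrier P \<and> r \<in> carrier P \<and> f = (q \<otimes>\<^bsub>P\<^esub> g) \<oplus>\<^bsub>P\<^esub> r \<and>
    (r = \<zero>\<^bsub>P\<^esub> \<or> deg R r < deg R g)"
proof -
  have g: "g \<in> carrier P" "lcoeff g = \<one>" using assms(1) by (simp_all add: monic_in_iff)
  obtain q r k where qr: "q \<in> carrier P" "r \<in> carrier P"
    "lcoeff g [^] (k::nat) \<odot>\<^bsub>P\<^esub> f = g \<otimes>\<^bsub>P\<^esub> q \<oplus>\<^bsub>P\<^esub> r" "r = \<zero>\<^bsub>P\<^esub> \<or> deg R r < deg R g"
    using long_div_theorem[OF g(1) assms(2) monic_nonzero[OF assms(1,3)]] by blast
  have "f = q \<otimes>\<^bsub>P\<^esub> g \<oplus>\<^bsub>P\<^esub> r" using qr(3) assms(2) by (simp add: g(2) P.m_comm[OF g(1) qr(1)])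
  with qr show ?thesis by blast
qed

lemma monic_division_unique:
  assumes g: "monic_in R g"
    and q: "q \<in> carrier P" "r \<in> carrier P" "r = \<zero>\<^bsub>P\<^esub> \<or> deg R r < deg R g"
    and q': "q' \<in> carrier P" "r' \<in> carrier P" "r' = \<zero>\<^bsub>P\<^esub> \<or> deg R r' < deg R g"
    and eq: "(q \<otimes>\<^bsub>P\<^esub> g) \<oplus>\<^bsub>P\<^esub> r = (q' \<otimes>\<^bsub>P\<^esub> g) \<oplus>\<^bsub>P\<^esub> r'"
  shows "q = q' \<and> r = r'"
proof -
  have gP: "g \<in> carrier P" using g by (simp add: monic_in_iff)
  have diff: "(q \<ominus>\<^bsub>P\<^esub> q') \<otimes>\<^bsub>P\<^esub> g = r' \<ominus>\<^bsub>P\<^esub> r"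
    using P.division_diff[OF q(1) q'(1) gP q(2) q'(2) eq] .
  have "q \<ominus>\<^bsub>P\<^esub> q' = \<zero>\<^bsub>P\<^esub>"
  proof (rule ccontr)
    assume nz: "q \<ominus>\<^bsub>P\<^esub> q' \<noteq> \<zero>\<^bsub>P\<^esub>"
    have "deg R g \<le> deg R (r' \<ominus>\<^bsub>P\<^esub> r)" "r' \<ominus>\<^bsub>P\<^esub> r \<noteq> \<zero>\<^bsub>P\<^esub>"
      using deg_mult_monic[OF g _ nz] q(1) q'(1) unfolding diff by simp_all
    moreover have "deg R (r' \<ominus>\<^bsub>P\<^esub> r) \<le> max (deg R r') (deg R r)"
      using deg_add[of r' "\<ominus>\<^bsub>P\<^esub> r"] q q' by (simp add: P.minus_eq)
    ultimately have "deg R g \<le> max (deg R r') (deg R r)" by simp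
    with \<open>r' \<ominus>\<^bsub>P\<^esub> r \<noteq> \<zero>\<^bsub>P\<^esub>\<close> q q' show False by (auto simp: max_def split: if_splits)
  qed
  hence "q = q'" using q q' by simp
  moreover from this have "r = r'" using eq q q' gP by simp
  ultimately show ?thesis by blast
qed

lemma poly_divmod_eqI:
  assumes "monic_in R g" "q \<in> carrier P" "r \<in> carrier P" "r = \<zero>\<^bsub>P\<^esub> \<or> deg R r < deg R g"
    and "f = (q \<otimes>\<^bsub>P\<^esub> g) \<oplus>\<^bsub>P\<^esub> r"
  shows "poly_divmod R f g = (q, r)"
  unfolding poly_divmod_def P_def[symmetric]
proof (rule the_equality)
  fix x :: "(nat \<Rightarrow> 'a) \<times> (nat \<Rightarrow> 'a)"
  obtain q' r' where x: "x = (q', r')" by (cases x)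
  assume "case x of (q, r) \<Rightarrow> q \<in> carrier P \<and> r \<in> carrier P \<and> f = (q \<otimes>\<^bsub>P\<^esub> g) \<oplus>\<^bsub>P\<^esub> r \<and>
    (r = \<zero>\<^bsub>P\<^esub> \<or> deg R r < deg R g)"
  hence "q' \<in> carrier P" "r' \<in> carrier P" "f = (q' \<otimes>\<^bsub>P\<^esub> g) \<oplus>\<^bsub>P\<^esub> r'"
    "r' = \<zero>\<^bsub>P\<^esub> \<or> deg R r' < deg R g" unfolding x by simp_all
  with monic_division_unique[OF assms(1), of q' r' q r] assms show "x = (q, r)" unfolding x by simp
qed (use assms in simp)

lemma poly_divmod_monic:
  assumes "monic_in R g" "f \<in> carrier P" "\<one> \<noteq> \<zero>"
  defines "q \<equiv> fst (poly_divmod R f g)" and "r \<equiv> snd (poly_divmod R f g)"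
  shows "q \<in> carrier P" "r \<in> carrier P" "f = (q \<otimes>\<^bsub>P\<^esub> g) \<oplus>\<^bsub>P\<^esub> r" "r = \<zero>\<^bsub>P\<^esub> \<or> deg R r < deg R g"
proof -
  obtain q' r' where *: "q' \<in> carrier P" "r' \<in> carrier P" "f = (q' \<otimes>\<^bsub>P\<^esub> g) \<oplus>\<^bsub>P\<^esub> r'"
    "r' = \<zero>\<^bsub>P\<^esub> \<or> deg R r' < deg R g" using monic_division[OF assms(1-3)] by blast
  have "q = q'" "r = r'" using poly_divmod_eqI[OF assms(1) *(1,2,4,3)] by (simp_all add: q_def r_def)
  with * show "q \<in> carrier P" "r \<in> carrier P" "f = (q \<otimes>\<^bsub>P\<^esub> g) \<oplus>\<^bsub>P\<^esub> r" "r = \<zero>\<^bsub>P\<^esub> \<or> deg R r < deg R g"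
    by simp_all
qed

lemma poly_divmod_exact:
  assumes "monic_in R g" "q \<in> carrier P"
  shows "poly_divmod R (q \<otimes>\<^bsub>P\<^esub> g) g = (q, \<zero>\<^bsub>P\<^esub>)"
  using assms by (intro poly_divmod_eqI) (simp_all add: monic_in_iff)

lemma poly_divmod_snd_zero_iff:
  assumes "monic_in R g" "f \<in> carrier P" "\<one> \<noteq> \<zero>"
  shows "snd (poly_divmod R f g) = \<zero>\<^bsub>P\<^esub> \<longleftrightarrow> g divides\<^bsub>P\<^esub> f"
proof
  assume 0: "snd (poly_divmod R f g) = \<zero>\<^bsub>P\<^esub>"
  have "f = g \<otimes>\<^bsub>P\<^esub> fst (poly_divmod R f g)"
    using poly_divmod_monic[OF assms] assms 0 by (simp add: P.m_comm monic_in_iff)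
  thus "g divides\<^bsub>P\<^esub> f" using poly_divmod_monic(1)[OF assms] unfolding factor_def by blast
next
  assume "g divides\<^bsub>P\<^esub> f"
  then obtain q where "q \<in> carrier P" "f = g \<otimes>\<^bsub>P\<^esub> q" unfolding factor_def by blast
  thus "snd (poly_divmod R f g) = \<zero>\<^bsub>P\<^esub>"
    using poly_divmod_exact[OF assms(1), of q] assms(1) by (simp add: P.m_comm monic_in_iff)
qed

text \<open>Equality of remainders is how the algorithm decides a congruence modulo \<open>m\<close>.\<close>

lemma poly_divmod_snd_eq_iff:
  assumes m: "monic_in R m" and f: "f \<in> carrier P" "g \<in> carrier P" and "\<one> \<noteq> \<zero>"
  shows "snd (poly_divmod R f m) = snd (poly_divmod R g m) \<longleftrightarrow> f \<ominus>\<^bsub>P\<^esub> g \<in> PIdl\<^bsub>P\<^esub> m"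
proof -
  have mP: "m \<in> carrier P" using m by (simp add: monic_in_iff)
  note F = poly_divmod_monic[OF m f(1) \<open>\<one> \<noteq> \<zero>\<close>] and G = poly_divmod_monic[OF m f(2) \<open>\<one> \<noteq> \<zero>\<close>]
  define q r q' r' where "q = fst (poly_divmod R f m)" and "r = snd (poly_divmod R f m)"
    and "q' = fst (poly_divmod R g m)" and "r' = snd (poly_divmod R g m)"
  note F = F[folded q_def r_def] and G = G[folded q'_def r'_def]
  show ?thesis unfolding r_def[symmetric] r'_def[symmetric]
  proof
    assume "r = r'"
    hence "f \<ominus>\<^bsub>P\<^esub> g = (q \<otimes>\<^bsub>P\<^esub> m \<oplus>\<^bsub>P\<^esub> r) \<ominus>\<^bsub>P\<^esub> (q' \<otimes>\<^bsub>P\<^esub> m \<oplus>\<^bsub>P\<^esub> r)" using F(3) G(3) by simp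
    also have "\<dots> = (q \<ominus>\<^bsub>P\<^esub> q') \<otimes>\<^bsub>P\<^esub> m" using P.division_minus_same_remainder[OF F(1) G(1) mP F(2)] .
    finally show "f \<ominus>\<^bsub>P\<^esub> g \<in> PIdl\<^bsub>P\<^esub> m" using F(1) G(1) unfolding cgenideal_def by auto
  next
    assume "f \<ominus>\<^bsub>P\<^esub> g \<in> PIdl\<^bsub>P\<^esub> m"
    then obtain x where x: "x \<in> carrier P" "f \<ominus>\<^bsub>P\<^esub> g = x \<otimes>\<^bsub>P\<^esub> m" unfolding cgenideal_def by blast
    have "f = (x \<oplus>\<^bsub>P\<^esub> q') \<otimes>\<^bsub>P\<^esub> m \<oplus>\<^bsub>P\<^esub> r'"
      using x f mP G by (intro P.division_add) simp_all
    thus "r = r'"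
      using monic_division_unique[OF m F(1,2,4), of "x \<oplus>\<^bsub>P\<^esub> q'" r'] F(3) G x(1) by simp
  qed
qed

lemma monic_divides_antisym:
  assumes "monic_in R g" "monic_in R g'" "g divides\<^bsub>P\<^esub> g'" "deg R g' \<le> deg R g" "\<one> \<noteq> \<zero>"
  shows "g = g'"
proof -
  obtain c where c: "c \<in> carrier P" "g' = c \<otimes>\<^bsub>P\<^esub> g"
    using assms P.m_comm unfolding factor_def monic_in_iff by blast
  have gP: "g \<in> carrier P" using assms by (simp add: monic_in_iff)
  have nz: "c \<noteq> \<zero>\<^bsub>P\<^esub>" using c gP monic_nonzero[OF assms(2,5)] by auto
  have "monic_in R c" using monic_mult_iff[OF assms(1) c(1) assms(5)] assms(2) c(2) by simp
  moreover have "deg R c = 0" using deg_mult_monic(1)[OF assms(1) c(1) nz] assms(4) c(2) by simp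
  ultimately have "c = \<one>\<^bsub>P\<^esub>" by (rule monic_degree_zero)
  thus ?thesis using c gP by simp
qed

text \<open>Every class contains a remainder, and a remainder is determined by its first \<open>deg m\<close> coefficients.\<close>

lemma card_quotient_monic:
  assumes m: "monic_in R m" and nz: "\<one> \<noteq> \<zero>" and fin: "finite (carrier R)" and deg: "1 \<le> deg R m"
  shows "finite (carrier (P Quot PIdl\<^bsub>P\<^esub> m))"
    and "card (carrier (P Quot PIdl\<^bsub>P\<^esub> m)) \<le> card (carrier R) ^ deg R m"
proof -
  let ?n = "deg R m"
  let ?A = "{..<?n} \<rightarrow>\<^sub>E carrier R"
  let ?F = "\<lambda>g. PIdl\<^bsub>P\<^esub> m +>\<^bsub>P\<^esub> (\<lambda>i. if i < ?n then g i else \<zero>)"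
  have mP: "m \<in> carrier P" using m by (simp add: monic_in_iff)
  have ideal: "ideal (PIdl\<^bsub>P\<^esub> m) P" using mP by (rule P.cgenideal_ideal)
  have sub: "carrier (P Quot PIdl\<^bsub>P\<^esub> m) \<subseteq> ?F ` ?A"
  proof
    fix X assume "X \<in> carrier (P Quot PIdl\<^bsub>P\<^esub> m)"
    then obtain f where f: "f \<in> carrier P" "X = PIdl\<^bsub>P\<^esub> m +>\<^bsub>P\<^esub> f"
      by (auto simp: FactRing_simps)
    define q r where "q = fst (poly_divmod R f m)" and "r = snd (poly_divmod R f m)"
    note F = poly_divmod_monic[OF m f(1) nz, folded q_def r_def]
    have "f \<ominus>\<^bsub>P\<^esub> r = q \<otimes>\<^bsub>P\<^esub> m"
    proof -
      have "f \<ominus>\<^bsub>P\<^esub> r = (q \<otimes>\<^bsub>P\<^esub> m \<oplus>\<^bsub>P\<^esub> r) \<ominus>\<^bsub>P\<^esub> r" using F(3) by simp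
      also have "\<dots> = q \<otimes>\<^bsub>P\<^esub> m" using F(1,2) mP by (simp add: P.add_minus_cancel_right)
      finally show ?thesis .
    qed
    hence "f \<ominus>\<^bsub>P\<^esub> r \<in> PIdl\<^bsub>P\<^esub> m" using F(1) unfolding cgenideal_def by blast
    hence X: "X = PIdl\<^bsub>P\<^esub> m +>\<^bsub>P\<^esub> r"
      using P.quotient_eq_iff_same_a_r_cos[OF ideal f(1) F(2)] f(2) by simp
    have coeff_r: "coeff P r i = r i" for i using F(2) by (simp add: UP_def P_def)
    have r0: "r i = \<zero>" if "\<not> i < ?n" for i
    proof (cases "r = \<zero>\<^bsub>P\<^esub>")
      case True
      thus ?thesis using coeff_r[of i] by simp
    next
      case False
      thus ?thesis using F(2,4) that deg_aboveD[of r i] coeff_r[of i] by simp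
    qed
    have rc: "r i \<in> carrier R" for i using coeff_closed[OF F(2), of i] coeff_r[of i] by simp
    have "(\<lambda>i. if i < ?n then restrict r {..<?n} i else \<zero>) = r" using r0 by auto
    moreover have "restrict r {..<?n} \<in> ?A" using rc by auto
    ultimately show "X \<in> ?F ` ?A"
      unfolding X by (intro image_eqI[of _ _ "restrict r {..<?n}"]) (simp_all only:)
  qed
  have finA: "finite ?A" using fin by (intro finite_PiE) auto
  show "finite (carrier (P Quot PIdl\<^bsub>P\<^esub> m))" using sub finA by (meson finite_imageI finite_subset)
  have "card (carrier (P Quot PIdl\<^bsub>P\<^esub> m)) \<le> card (?F ` ?A)" using sub finA by (intro card_mono) auto
  also have "\<dots> \<le> card ?A" using finA by (rule card_image_le)
  also have "\<dots> = card (carrier R) ^ ?n" by (simp add: card_PiE)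
  finally show "card (carrier (P Quot PIdl\<^bsub>P\<^esub> m)) \<le> card (carrier R) ^ ?n" .
qed

end

section \<open>Polynomials over a field\<close>

locale UP_field = UP_cring + R?: field R

sublocale UP_field < UP_domain by intro_locales

context UP_field
begin

text \<open>The pseudo-division of \<open>long_div_theorem\<close> multiplies the dividend by a power \<open>c\<close> of the leading
  coefficient of the divisor; over a field this is undone by the inverse \<open>d\<close> of \<open>c\<close>.\<close>

lemma UP_euclidean: "euclidean_domain P (deg R)"
proof (rule domain.euclidean_domainI[OF UP_domain])
  fix a b assume ab: "a \<in> carrier P - {\<zero>\<^bsub>P\<^esub>}" "b \<in> carrier P - {\<zero>\<^bsub>P\<^esub>}"
  obtain q r k where qr: "q \<in> carrier P" "r \<in> carrier P"
    "lcoeff b [^] (k::nat) \<odot>\<^bsub>P\<^esub> a = b \<otimes>\<^bsub>P\<^esub> q \<oplus>\<^bsub>P\<^esub> r" "r = \<zero>\<^bsub>P\<^esub> \<or> deg R r < deg R b"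
    using long_div_theorem[of b a] ab by auto
  define c where "c = lcoeff b [^] k"
  have "lcoeff b \<in> Units R" using ab lcoeff_nonzero2[of b] by (simp add: field_Units)
  hence cU: "c \<in> Units R" unfolding c_def by (induction k) auto
  define d where "d = inv c"
  have d: "d \<in> carrier R" "c \<in> carrier R" "d \<otimes> c = \<one>" using cU R.Units_closed[of c] by (simp_all add: d_def)
  have "a = d \<odot>\<^bsub>P\<^esub> (c \<odot>\<^bsub>P\<^esub> a)" using ab d by (simp add: UP_smult_assoc1[symmetric])
  also have "c \<odot>\<^bsub>P\<^esub> a = b \<otimes>\<^bsub>P\<^esub> q \<oplus>\<^bsub>P\<^esub> r" using qr(3) by (simp add: c_def)
  also have "d \<odot>\<^bsub>P\<^esub> (b \<otimes>\<^bsub>P\<^esub> q \<oplus>\<^bsub>P\<^esub> r) = d \<odot>\<^bsub>P\<^esub> (b \<otimes>\<^bsub>P\<^esub> q) \<oplus>\<^bsub>P\<^esub> d \<odot>\<^bsub>P\<^esub> r"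
    using qr ab d by (intro UP_smult_r_distr) auto
  also have "b \<otimes>\<^bsub>P\<^esub> q = q \<otimes>\<^bsub>P\<^esub> b" using qr(1) ab by (intro P.m_comm) auto
  also have "d \<odot>\<^bsub>P\<^esub> (q \<otimes>\<^bsub>P\<^esub> b) = (d \<odot>\<^bsub>P\<^esub> q) \<otimes>\<^bsub>P\<^esub> b"
    using qr(1) ab d by (intro UP_smult_assoc2[symmetric]) auto
  also have "(d \<odot>\<^bsub>P\<^esub> q) \<otimes>\<^bsub>P\<^esub> b = b \<otimes>\<^bsub>P\<^esub> (d \<odot>\<^bsub>P\<^esub> q)" using qr(1) ab d by (intro P.m_comm) auto
  finally have "a = b \<otimes>\<^bsub>P\<^esub> (d \<odot>\<^bsub>P\<^esub> q) \<oplus>\<^bsub>P\<^esub> (d \<odot>\<^bsub>P\<^esub> r)" .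
  moreover have "d \<odot>\<^bsub>P\<^esub> r = \<zero>\<^bsub>P\<^esub> \<or> deg R (d \<odot>\<^bsub>P\<^esub> r) < deg R b"
  proof (cases "r = \<zero>\<^bsub>P\<^esub>")
    case True
    have "d \<odot>\<^bsub>P\<^esub> \<zero>\<^bsub>P\<^esub> = \<zero>\<^bsub>P\<^esub>" using d(1) by (intro up_eqI) simp_all
    thus ?thesis using True by simp
  next
    case False
    have "deg R (d \<odot>\<^bsub>P\<^esub> r) \<le> deg R r" using d(1) qr(2) by (rule deg_smult_decr)
    thus ?thesis using False qr(4) by linarith
  qed
  ultimately show "\<exists>q r. q \<in> carrier P \<and> r \<in> carrier P \<and> a = b \<otimes>\<^bsub>P\<^esub> q \<oplus>\<^bsub>P\<^esub> r \<and>
    (r = \<zero>\<^bsub>P\<^esub> \<or> deg R r < deg R b)"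
    using UP_smult_closed[OF d(1) qr(1)] UP_smult_closed[OF d(1) qr(2)]
    by (intro exI[of _ "d \<odot>\<^bsub>P\<^esub> q"] exI[of _ "d \<odot>\<^bsub>P\<^esub> r"] conjI)
qed

lemma UP_principal: "principal_domain P"
proof -
  interpret euclidean_domain P "deg R" by (rule UP_euclidean)
  show ?thesis by (rule principal_domain_axioms)
qed

lemma irreducible_imp_prime:
  assumes "G \<in> carrier P" "ring_irreducible\<^bsub>P\<^esub> G"
  shows "prime P G" "G \<noteq> \<zero>\<^bsub>P\<^esub>"
proof -
  interpret principal_domain P by (rule UP_principal)
  have "ring_prime\<^bsub>P\<^esub> G" using primeness_condition assms by blast
  thus "prime P G" "G \<noteq> \<zero>\<^bsub>P\<^esub>" by (simp_all add: ring_prime_def)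
qed

lemma unit_degree_zero:
  assumes "c \<in> Units P"
  shows "deg R c = 0"
proof -
  obtain d where d: "d \<in> carrier P" "c \<in> carrier P" "c \<otimes>\<^bsub>P\<^esub> d = \<one>\<^bsub>P\<^esub>"
    using assms unfolding Units_def by blast
  have "c \<noteq> \<zero>\<^bsub>P\<^esub>" "d \<noteq> \<zero>\<^bsub>P\<^esub>" using d UP_one_not_zero by auto
  hence "deg R c + deg R d = deg R \<one>\<^bsub>P\<^esub>" using deg_mult[of c d] d by simp
  thus ?thesis by simp
qed

lemma irreducible_degree_pos:
  assumes "monic_in R G" "ring_irreducible\<^bsub>P\<^esub> G"
  shows "deg R G \<ge> 1"
proof (rule ccontr)
  assume "\<not> 1 \<le> deg R G"
  hence "G = \<one>\<^bsub>P\<^esub>" using monic_degree_zero assms(1) by simp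
  thus False using domain.ring_irreducibleE(4)[OF UP_domain, of G] assms(2) by simp
qed

text \<open>The cofactor is a unit, hence of degree 0, and it is monic.\<close>

lemma monic_irreducible_divides_eq:
  assumes "monic_in R G" "ring_irreducible\<^bsub>P\<^esub> G" "monic_in R G'" "ring_irreducible\<^bsub>P\<^esub> G'"
    and dvd: "G divides\<^bsub>P\<^esub> G'"
  shows "G = G'"
proof -
  have c: "G \<in> carrier P" "G' \<in> carrier P" using assms by (simp_all add: monic_in_iff)
  obtain u where u: "u \<in> carrier P" "G' = G \<otimes>\<^bsub>P\<^esub> u" using dvd unfolding factor_def by blast
  have "G \<in> Units P \<or> u \<in> Units P"
    using domain.ring_irreducibleE(5)[OF UP_domain c(2) assms(4) c(1) u(1,2)] .
  hence "u \<in> Units P" using domain.ring_irreducibleE(4)[OF UP_domain c(1) assms(2)] by blast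
  hence "deg R u = 0" by (rule unit_degree_zero)
  hence "deg R G' \<le> deg R G" using deg_mult_ring[OF c(1) u(1)] u(2) by simp
  thus ?thesis using monic_divides_antisym[OF assms(1,3) dvd] R.one_not_zero by blast
qed

end

context UP_field
begin

lemma factorization_facts:
  assumes "is_factorization R Gs f"
  shows "distinct (map fst Gs)"
    and "\<And>G k. (G, k) \<in> set Gs \<Longrightarrow>
      prime P G \<and> G \<in> carrier P \<and> G \<noteq> \<zero>\<^bsub>P\<^esub> \<and> k \<ge> 1"
    and "\<And>G. G \<in> fst ` set Gs \<Longrightarrow> monic_in R G \<and> deg R G \<ge> 1"
    and "\<And>G G'. G \<in> fst ` set Gs \<Longrightarrow> G' \<in> fst ` set Gs \<Longrightarrow> G divides\<^bsub>P\<^esub> G' \<Longrightarrow> G = G'"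
    and "power_prod P Gs = f"
proof -
  have irr: "monic_in R G \<and> ring_irreducible\<^bsub>P\<^esub> G \<and> k \<ge> 1" if "(G, k) \<in> set Gs" for G k
    using assms that unfolding is_factorization_def P_def[symmetric] by auto
  show "distinct (map fst Gs)" "power_prod P Gs = f"
    using assms unfolding is_factorization_def power_prod_def P_def[symmetric] by auto
  show "prime P G \<and> G \<in> carrier P \<and> G \<noteq> \<zero>\<^bsub>P\<^esub> \<and> k \<ge> 1" if "(G, k) \<in> set Gs" for G k
    using irr[OF that] irreducible_imp_prime[of G] by (auto simp: monic_in_iff)
  show "monic_in R G \<and> deg R G \<ge> 1" if "G \<in> fst ` set Gs" for G
    using that irr irreducible_degree_pos by auto
  show "G = G'" if "G \<in> fst ` set Gs" "G' \<in> fst ` set Gs" "G divides\<^bsub>P\<^esub> G'" for G G'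
    using that irr by (auto intro: monic_irreducible_divides_eq)
qed

lemma monic_pow:
  assumes "monic_in R G"
  shows "monic_in R (G [^]\<^bsub>P\<^esub> (k::nat))"
proof (induction k)
  case 0
  show ?case using monic_one by simp
next
  case (Suc k)
  have "G [^]\<^bsub>P\<^esub> k \<in> carrier P" using Suc by (simp add: monic_in_iff)
  thus ?case using monic_mult_iff[OF assms, of "G [^]\<^bsub>P\<^esub> k"] Suc by simp
qed

lemma deg_monic_mult:
  assumes "monic_in R a" "monic_in R b"
  shows "monic_in R (a \<otimes>\<^bsub>P\<^esub> b)" "deg R (a \<otimes>\<^bsub>P\<^esub> b) = deg R a + deg R b"
  using assms monic_mult_iff[of b a] deg_mult_monic(1)[of b a] monic_nonzero[of a]
  by (simp_all add: monic_in_iff)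

lemma deg_monic_pow:
  assumes "monic_in R G"
  shows "deg R (G [^]\<^bsub>P\<^esub> (k::nat)) = k * deg R G"
  by (induction k) (use assms monic_pow[OF assms] in \<open>simp_all add: deg_monic_mult(2)\<close>)

lemma monic_power_prod:
  assumes "\<And>G. G \<in> fst ` set Gs \<Longrightarrow> monic_in R G"
  shows "monic_in R (power_prod P Gs)"
  using assms by (induction Gs) (simp_all add: monic_one deg_monic_mult monic_pow)

lemma deg_power_prod:
  assumes "\<And>G. G \<in> fst ` set Gs \<Longrightarrow> monic_in R G"
  shows "deg R (power_prod P Gs) = (\<Sum>(G, k)\<leftarrow>Gs. k * deg R G)"
  using assms
  by (induction Gs) (auto simp: deg_monic_mult deg_monic_pow monic_pow monic_power_prod)

lemma deg_factor_le:
  assumes "\<And>G. G \<in> fst ` set Gs \<Longrightarrow> monic_in R G" "(G, k) \<in> set Gs"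
  shows "k * deg R G \<le> deg R (power_prod P Gs)"
proof -
  have "(\<lambda>(G, k). k * deg R G) (G, k) \<le> (\<Sum>(G, k)\<leftarrow>Gs. k * deg R G)"
    using assms(2) by (intro member_le_sum_list) (force, simp)
  thus ?thesis using deg_power_prod[of Gs] assms(1) by simp
qed

text \<open>Every factor contributes at least 1 to the degree.\<close>

lemma length_factorization_le:
  assumes "is_factorization R Gs f"
  shows "length Gs \<le> deg R f"
proof -
  note facts = factorization_facts[OF assms]
  have "length Gs = (\<Sum>x\<leftarrow>Gs. 1)" by (simp add: sum_list_triv)
  also have "\<dots> \<le> (\<Sum>(G, k)\<leftarrow>Gs. k * deg R G)"
    using facts(2,3) by (intro sum_list_mono) (force simp: Suc_le_eq)
  also have "\<dots> = deg R f" using deg_power_prod[of Gs] facts(3,5) by simp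
  finally show ?thesis .
qed

lemma kappa_eq:
  assumes G: "prime P G" "G \<in> carrier P" "G \<noteq> \<zero>\<^bsub>P\<^esub>"
    and w: "w \<in> carrier P" "\<not> G divides\<^bsub>P\<^esub> w"
  shows "kappa R G (G [^]\<^bsub>P\<^esub> (j::nat) \<otimes>\<^bsub>P\<^esub> w) = j"
  unfolding kappa_def P_def[symmetric] domain.prime_pow_divides_iff[OF UP_domain G w]
  by (intro Greatest_equality) auto

lemma prime_not_divides_one:
  assumes "prime P G" "G \<in> carrier P"
  shows "\<not> G divides\<^bsub>P\<^esub> \<one>\<^bsub>P\<^esub>"
  using assms P.divides_one unfolding prime_def by blast

lemma kappa_power_prod:
  assumes fac: "is_factorization R Gs f" and Js: "map fst Js = map fst Gs" "(G, j) \<in> set Js"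
    and w: "w \<in> carrier P" "\<not> G divides\<^bsub>P\<^esub> w"
  shows "kappa R G (power_prod P Js \<otimes>\<^bsub>P\<^esub> w) = j"
proof -
  note facts = factorization_facts[OF fac]
  have set_eq: "fst ` set Js = fst ` set Gs" using Js(1) by (metis list.set_map)
  have Gmem: "G \<in> fst ` set Gs" using Js(2) set_eq by force
  have prime: "prime P H \<and> H \<in> carrier P \<and> H \<noteq> \<zero>\<^bsub>P\<^esub>" if "H \<in> fst ` set Gs" for H
    using that facts(2) by auto
  have "\<exists>w'\<in>carrier P. power_prod P Js \<otimes>\<^bsub>P\<^esub> w = G [^]\<^bsub>P\<^esub> j \<otimes>\<^bsub>P\<^esub> w' \<and> \<not> G divides\<^bsub>P\<^esub> w'"
  proof (rule domain.power_prod_split[OF UP_domain Js(2) _ _ _ w])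
    show "distinct (map fst Js)" using Js(1) facts(1) by simp
    show "prime P H \<and> H \<in> carrier P" if "H \<in> fst ` set Js" for H
      using that prime unfolding set_eq by blast
    show "H = H'" if "H \<in> fst ` set Js" "H' \<in> fst ` set Js" "H divides\<^bsub>P\<^esub> H'" for H H'
      using that facts(4) unfolding set_eq by blast
  qed
  then obtain w' where "w' \<in> carrier P" "power_prod P Js \<otimes>\<^bsub>P\<^esub> w = G [^]\<^bsub>P\<^esub> j \<otimes>\<^bsub>P\<^esub> w'"
    "\<not> G divides\<^bsub>P\<^esub> w'" by blast
  thus ?thesis using kappa_eq[of G w' j] prime[OF Gmem] by simp
qed

lemma kappa_factor:
  assumes fac: "is_factorization R Gs f" and Gk: "(G, k) \<in> set Gs"
  shows "kappa R G f = k"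
proof -
  have G: "prime P G" "G \<in> carrier P" using factorization_facts(2)[OF fac Gk] by simp_all
  have "f \<in> carrier P"
    using monic_power_prod[of Gs] factorization_facts(3,5)[OF fac] by (simp add: monic_in_iff)
  thus ?thesis
    using kappa_power_prod[OF fac refl Gk UP_one_closed prime_not_divides_one[OF G]]
      factorization_facts(5)[OF fac] by simp
qed

text \<open>A divisor of \<open>m\<close> prime to \<open>f\<close> is divisible by no \<open>G\<close>, so all prime powers cancel and it divides \<open>w\<close>.
  Two monic polynomials that divide each other are equal, so the greatest such divisor is unique.\<close>

lemma greatest_coprime_divisor:
  assumes fac: "is_factorization R Gs f" and w: "monic_in R w"
    and ndvd: "\<And>G. G \<in> fst ` set Gs \<Longrightarrow> \<not> G divides\<^bsub>P\<^esub> w"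
    and m: "m = power_prod P (set_exponents \<kappa> Gs) \<otimes>\<^bsub>P\<^esub> w"
  shows "(THE M. is_greatest_coprime_divisor R f m M) = w"
proof (rule the_equality)
  note facts = factorization_facts[OF fac]
  let ?Js = "set_exponents \<kappa> Gs"
  define cand where
    "cand = {D. monic_in R D \<and> D divides\<^bsub>P\<^esub> m \<and> \<one>\<^bsub>P\<^esub> gcdof\<^bsub>P\<^esub> D f}"
  have set_eq: "fst ` set ?Js = fst ` set Gs" by force
  have cl: "w \<in> carrier P" "power_prod P ?Js \<in> carrier P"
    using w monic_power_prod[of ?Js] facts(3) unfolding set_eq by (simp_all add: monic_in_iff)
  have cop: "\<one>\<^bsub>P\<^esub> gcdof\<^bsub>P\<^esub> D f \<longleftrightarrow> (\<forall>G\<in>fst ` set Gs. \<not> G divides\<^bsub>P\<^esub> D)" if "D \<in> carrier P" for D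
    unfolding facts(5)[symmetric]
    using facts(2) that by (rule domain.one_gcdof_power_prod_iff[OF UP_domain])
  have "w divides\<^bsub>P\<^esub> m"
    unfolding m factor_def using cl by (intro bexI[of _ "power_prod P ?Js"] P.m_comm)
  hence wc: "w \<in> cand" using w ndvd cop[OF cl(1)] by (simp add: cand_def)
  have max: "D divides\<^bsub>P\<^esub> w" if "D \<in> cand" for D
  proof -
    have D: "D \<in> carrier P" "D divides\<^bsub>P\<^esub> m" "\<one>\<^bsub>P\<^esub> gcdof\<^bsub>P\<^esub> D f"
      using that by (auto simp: cand_def monic_in_iff)
    show ?thesis
    proof (rule domain.power_prod_divides_cancel[OF UP_domain _ D(1) cl(1) D(2)[unfolded m]])
      fix G assume "G \<in> fst ` set ?Js"
      hence "G \<in> fst ` set Gs" unfolding set_eq .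
      thus "prime P G \<and> G \<in> carrier P \<and> G \<noteq> \<zero>\<^bsub>P\<^esub> \<and> \<not> G divides\<^bsub>P\<^esub> D"
        using facts(2) cop[OF D(1)] D(3) by auto
    qed
  qed
  have iff: "is_greatest_coprime_divisor R f m M \<longleftrightarrow> M \<in> cand \<and> (\<forall>D\<in>cand. D divides\<^bsub>P\<^esub> M)" for M
    by (simp add: is_greatest_coprime_divisor_def cand_def Let_def P_def)
  show "is_greatest_coprime_divisor R f m w" unfolding iff using wc max by blast
  fix M assume "is_greatest_coprime_divisor R f m M"
  hence M: "M \<in> cand" "w divides\<^bsub>P\<^esub> M" unfolding iff using wc by blast+
  have Mm: "monic_in R M" using M(1) by (simp add: cand_def)
  obtain c where c: "c \<in> carrier P" "w = M \<otimes>\<^bsub>P\<^esub> c" using max[OF M(1)] unfolding factor_def by blast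
  have nz: "c \<noteq> \<zero>\<^bsub>P\<^esub>" using c Mm monic_nonzero[OF w] by (auto simp: monic_in_iff)
  have "deg R M \<le> deg R w"
    using c nz Mm deg_mult_monic(1)[OF Mm c(1) nz] by (simp add: monic_in_iff P.m_comm)
  thus "M = w" using monic_divides_antisym[OF w Mm M(2)] by simp
qed

end

section \<open>Reducing the coefficients of polynomials\<close>

lemma (in ideal) rcos_eq_zero_iff:
  assumes "x \<in> carrier R"
  shows "I +> x = \<zero>\<^bsub>R Quot I\<^esub> \<longleftrightarrow> x \<in> I"
  using assms rcos_const_imp_mem a_rcos_zero[OF ideal_axioms] by (auto simp: FactRing_def)

lemma FactRing_surj: "(+>\<^bsub>R\<^esub>) I ` carrier R = carrier (R Quot I)"
  by (auto simp: FactRing_simps)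

lemma (in cring) nat_in_closed: "nat_in R N \<in> carrier R"
  by (simp add: nat_in_def)

lemma (in cring) nat_in_0: "nat_in R 0 = \<zero>" and nat_in_Suc: "nat_in R (Suc N) = nat_in R N \<oplus> \<one>"
  by (simp_all add: nat_in_def)

lemma (in cring) nat_in_add: "nat_in R (M + N) = nat_in R M \<oplus> nat_in R N"
  by (induction N) (simp_all add: nat_in_0 nat_in_Suc nat_in_closed a_assoc)

lemma (in cring) nat_in_mult: "nat_in R (M * N) = nat_in R M \<otimes> nat_in R N"
  by (induction N) (simp_all add: nat_in_0 nat_in_Suc nat_in_closed nat_in_add r_distr a_comm)

lemma (in cring) nat_in_power: "nat_in R (N ^ k) = nat_in R N [^] k"
  by (induction k) (simp_all add: nat_in_Suc[of 0, simplified] nat_in_0 nat_in_mult nat_in_closed m_comm)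

lemma (in ring_hom_cring) hom_nat_in: "h (nat_in R N) = nat_in S N"
  by (induction N) (simp_all add: R.nat_in_0 S.nat_in_0 R.nat_in_Suc S.nat_in_Suc R.nat_in_closed)

lemma ring_hom_cring_comp:
  assumes "ring_hom_cring R S f" "ring_hom_cring S T g"
  shows "ring_hom_cring R T (\<lambda>x. g (f x))"
proof -
  interpret f: ring_hom_cring R S f by fact
  interpret g: ring_hom_cring S T g by fact
  show ?thesis by (rule ring_hom_cringI) (auto intro!: f.R.cring_axioms g.S.cring_axioms ring_hom_memI)
qed

text \<open>Both rings are the quotient of \<open>R\<close> by the common kernel.\<close>

lemma field_if_same_kernel:
  assumes f: "ring_hom_cring R F f" "f ` carrier R = carrier F"
    and g: "ring_hom_cring R L g" "g ` carrier R = carrier L"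
    and ker: "\<And>x. x \<in> carrier R \<Longrightarrow> f x = \<zero>\<^bsub>F\<^esub> \<longleftrightarrow> g x = \<zero>\<^bsub>L\<^esub>"
    and L: "field L"
  shows "field F"
proof -
  interpret f: ring_hom_cring R F f by fact
  interpret g: ring_hom_cring R L g by fact
  interpret L: field L by fact
  show ?thesis
  proof (rule f.S.cring_fieldI2)
    show "\<zero>\<^bsub>F\<^esub> \<noteq> \<one>\<^bsub>F\<^esub>"
      using ker[of "\<one>\<^bsub>R\<^esub>"] L.one_not_zero by force
    fix a assume a: "a \<in> carrier F" "a \<noteq> \<zero>\<^bsub>F\<^esub>"
    then obtain x where x: "x \<in> carrier R" "a = f x" using f(2) by auto
    have "g x \<in> Units L" using ker[OF x(1)] a x L.field_Units by auto
    then obtain b where b: "b \<in> carrier L" "g x \<otimes>\<^bsub>L\<^esub> b = \<one>\<^bsub>L\<^esub>" unfolding Units_def by blast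
    have "b \<in> g ` carrier R" using b(1) g(2) by simp
    then obtain y where y: "y \<in> carrier R" "b = g y" by auto
    have "g (x \<otimes>\<^bsub>R\<^esub> y \<ominus>\<^bsub>R\<^esub> \<one>\<^bsub>R\<^esub>) = \<zero>\<^bsub>L\<^esub>"
      using x y b by (simp add: f.R.minus_eq g.S.r_neg)
    hence "f (x \<otimes>\<^bsub>R\<^esub> y \<ominus>\<^bsub>R\<^esub> \<one>\<^bsub>R\<^esub>) = \<zero>\<^bsub>F\<^esub>"
      using ker[of "x \<otimes>\<^bsub>R\<^esub> y \<ominus>\<^bsub>R\<^esub> \<one>\<^bsub>R\<^esub>"] x y by blast
    hence "f x \<otimes>\<^bsub>F\<^esub> f y \<ominus>\<^bsub>F\<^esub> \<one>\<^bsub>F\<^esub> = \<zero>\<^bsub>F\<^esub>" using x y by (simp add: f.R.minus_eq f.S.minus_eq)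
    hence "a \<otimes>\<^bsub>F\<^esub> f y = \<one>\<^bsub>F\<^esub>" using x y by simp
    thus "\<exists>b\<in>carrier F. a \<otimes>\<^bsub>F\<^esub> b = \<one>\<^bsub>F\<^esub>" using y by blast
  qed
qed

definition map_coeffs :: "('a, 'b) ring_scheme \<Rightarrow> ('a \<Rightarrow> 'c) \<Rightarrow> (nat \<Rightarrow> 'a) \<Rightarrow> (nat \<Rightarrow> 'c)" where
  "map_coeffs R c g = (\<lambda>i. c (up_ring.coeff (UP R) g i))"

context ring_hom_cring
begin

interpretation PR: UP_cring R "UP R" by unfold_locales
interpretation PS: UP_cring S "UP S" by unfold_locales

lemma map_coeffs_closed:
  assumes "g \<in> carrier (UP R)"
  shows "map_coeffs R h g \<in> carrier (UP S)"
    and "up_ring.coeff (UP S) (map_coeffs R h g) i = h (up_ring.coeff (UP R) g i)"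
proof -
  have "map_coeffs R h g \<in> up S"
  proof (rule mem_upI)
    show "map_coeffs R h g n \<in> carrier S" for n using assms by (simp add: map_coeffs_def)
    have "bound \<zero>\<^bsub>S\<^esub> (deg R g) (map_coeffs R h g)"
      using assms by (auto simp: map_coeffs_def PR.deg_aboveD)
    thus "\<exists>n. bound \<zero>\<^bsub>S\<^esub> n (map_coeffs R h g)" by blast
  qed
  thus "map_coeffs R h g \<in> carrier (UP S)"
    "up_ring.coeff (UP S) (map_coeffs R h g) i = h (up_ring.coeff (UP R) g i)"
    by (simp_all add: UP_def map_coeffs_def)
qed

lemma map_coeffs_hom: "ring_hom_cring (UP R) (UP S) (map_coeffs R h)"
proof (rule ring_hom_cringI[OF PR.UP_cring PS.UP_cring], rule ring_hom_memI)
  fix x y assume c: "x \<in> carrier (UP R)" "y \<in> carrier (UP R)"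
  show "map_coeffs R h (x \<otimes>\<^bsub>UP R\<^esub> y) = map_coeffs R h x \<otimes>\<^bsub>UP S\<^esub> map_coeffs R h y"
    using c by (intro PS.up_eqI) (simp_all add: map_coeffs_closed Pi_def comp_def)
  show "map_coeffs R h (x \<oplus>\<^bsub>UP R\<^esub> y) = map_coeffs R h x \<oplus>\<^bsub>UP S\<^esub> map_coeffs R h y"
    using c by (intro PS.up_eqI) (simp_all add: map_coeffs_closed)
next
  show "map_coeffs R h \<one>\<^bsub>UP R\<^esub> = \<one>\<^bsub>UP S\<^esub>"
    by (intro PS.up_eqI) (simp_all add: map_coeffs_closed)
qed (simp add: map_coeffs_closed)

lemma map_coeffs_surj:
  assumes surj: "h ` carrier R = carrier S"
  shows "map_coeffs R h ` carrier (UP R) = carrier (UP S)"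
proof (intro equalityI subsetI)
  fix g assume g: "g \<in> carrier (UP S)"
  let ?c = "up_ring.coeff (UP S) g"
  define r where "r y = (SOME x. x \<in> carrier R \<and> h x = y)" for y
  have r: "r y \<in> carrier R \<and> h (r y) = y" if "y \<in> carrier S" for y
  proof -
    have "y \<in> h ` carrier R" using that surj by simp
    hence "\<exists>x. x \<in> carrier R \<and> h x = y" by blast
    thus ?thesis unfolding r_def by (rule someI_ex)
  qed
  define f where "f i = (if i \<le> deg S g then r (?c i) else \<zero>)" for i
  have rc: "r (?c i) \<in> carrier R \<and> h (r (?c i)) = ?c i" for i using g by (intro r) simp
  have "f \<in> up R" using rc by (intro mem_upI) (auto simp: f_def intro!: exI[of _ "deg S g"])
  hence f: "f \<in> carrier (UP R)" "up_ring.coeff (UP R) f = f" by (simp_all add: UP_def)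
  have "map_coeffs R h f = g"
    using f g rc by (intro PS.up_eqI) (auto simp: map_coeffs_closed f_def PS.deg_aboveD)
  thus "g \<in> map_coeffs R h ` carrier (UP R)" using f by blast
qed (auto simp: map_coeffs_closed)

text \<open>If \<open>\<pi>\<close> divides each coefficient, the cofactors can be chosen to vanish beyond the degree of \<open>g\<close> and
  form a polynomial.\<close>

lemma map_coeffs_kernel:
  assumes ker: "\<And>x. x \<in> carrier R \<Longrightarrow> h x = \<zero>\<^bsub>S\<^esub> \<longleftrightarrow> x \<in> PIdl\<^bsub>R\<^esub> \<pi>"
    and \<pi>: "\<pi> \<in> carrier R" and g: "g \<in> carrier (UP R)"
  shows "map_coeffs R h g = \<zero>\<^bsub>UP S\<^esub> \<longleftrightarrow> g \<in> PIdl\<^bsub>UP R\<^esub> (up_ring.monom (UP R) \<pi> 0)"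
proof
  assume 0: "map_coeffs R h g = \<zero>\<^bsub>UP S\<^esub>"
  have "\<exists>y\<in>carrier R. up_ring.coeff (UP R) g i = y \<otimes> \<pi>" for i
  proof -
    have "h (up_ring.coeff (UP R) g i) = \<zero>\<^bsub>S\<^esub>"
      using map_coeffs_closed(2)[OF g, of i] 0 by simp
    hence "up_ring.coeff (UP R) g i \<in> PIdl \<pi>" using ker g by simp
    thus ?thesis unfolding cgenideal_def by blast
  qed
  then obtain y where y: "y i \<in> carrier R" "up_ring.coeff (UP R) g i = y i \<otimes> \<pi>" for i by metis
  define f where "f i = (if i \<le> deg R g then y i else \<zero>)" for i
  have "f \<in> up R" using y by (intro mem_upI) (auto simp: f_def intro!: exI[of _ "deg R g"])
  hence f: "f \<in> carrier (UP R)" "up_ring.coeff (UP R) f = f" by (simp_all add: UP_def)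
  have "g = \<pi> \<odot>\<^bsub>UP R\<^esub> f"
  proof (rule PR.up_eqI)
    fix i
    show "up_ring.coeff (UP R) g i = up_ring.coeff (UP R) (\<pi> \<odot>\<^bsub>UP R\<^esub> f) i"
    proof (cases "i \<le> deg R g")
      case True
      thus ?thesis using y[of i] f \<pi> by (simp add: f_def R.m_comm)
    next
      case False
      thus ?thesis using f \<pi> g PR.deg_aboveD[of g i] by (simp add: f_def)
    qed
  qed (use f g \<pi> in simp_all)
  also have "\<dots> = up_ring.monom (UP R) \<pi> 0 \<otimes>\<^bsub>UP R\<^esub> f" using f \<pi> by (simp add: PR.monom_mult_is_smult)
  also have "\<dots> = f \<otimes>\<^bsub>UP R\<^esub> up_ring.monom (UP R) \<pi> 0" using f \<pi> by (simp add: PR.P.m_comm)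
  finally show "g \<in> PIdl\<^bsub>UP R\<^esub> (up_ring.monom (UP R) \<pi> 0)" using f(1) unfolding cgenideal_def by blast
next
  assume "g \<in> PIdl\<^bsub>UP R\<^esub> (up_ring.monom (UP R) \<pi> 0)"
  then obtain f where f: "f \<in> carrier (UP R)" "g = f \<otimes>\<^bsub>UP R\<^esub> up_ring.monom (UP R) \<pi> 0"
    unfolding cgenideal_def by blast
  have "g = up_ring.monom (UP R) \<pi> 0 \<otimes>\<^bsub>UP R\<^esub> f" using f \<pi> by (simp add: PR.P.m_comm)
  hence g': "g = \<pi> \<odot>\<^bsub>UP R\<^esub> f" using f \<pi> by (simp add: PR.monom_mult_is_smult)
  have "\<one> \<otimes> \<pi> \<in> PIdl \<pi>" unfolding cgenideal_def by blast
  hence h\<pi>: "h \<pi> = \<zero>\<^bsub>S\<^esub>" using ker \<pi> by simp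
  show "map_coeffs R h g = \<zero>\<^bsub>UP S\<^esub>"
  proof (rule PS.up_eqI)
    fix i
    show "up_ring.coeff (UP S) (map_coeffs R h g) i = up_ring.coeff (UP S) \<zero>\<^bsub>UP S\<^esub> i"
      unfolding map_coeffs_closed(2)[OF g] unfolding g' using f(1) \<pi> h\<pi> by simp
  qed (use g in \<open>simp_all add: map_coeffs_closed\<close>)
qed

lemma map_coeffs_monic:
  assumes g: "monic_in R g" and nz: "\<one>\<^bsub>S\<^esub> \<noteq> \<zero>\<^bsub>S\<^esub>"
  shows "monic_in S (map_coeffs R h g)" "deg S (map_coeffs R h g) = deg R g"
proof -
  have gP: "g \<in> carrier (UP R)" "up_ring.coeff (UP R) g (deg R g) = \<one>"
    using g by (simp_all add: PR.monic_in_iff)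
  have c: "up_ring.coeff (UP S) (map_coeffs R h g) (deg R g) = \<one>\<^bsub>S\<^esub>"
    using gP by (simp add: map_coeffs_closed)
  show d: "deg S (map_coeffs R h g) = deg R g"
  proof (rule le_antisym)
    show "deg S (map_coeffs R h g) \<le> deg R g"
      using gP by (intro PS.deg_aboveI) (auto simp: map_coeffs_closed PR.deg_aboveD)
    show "deg R g \<le> deg S (map_coeffs R h g)"
      using gP c nz by (intro PS.deg_belowI) (auto simp: map_coeffs_closed(1))
  qed
  show "monic_in S (map_coeffs R h g)"
    unfolding PS.monic_in_iff d using c gP by (simp add: map_coeffs_closed)
qed

end

section \<open>The residue rings of the coefficient ring\<close>

lemma int_poly_ring_simps [simp]:
  "carrier int_poly_ring = UNIV" "mult int_poly_ring = (*)" "one int_poly_ring = 1"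
  "zero int_poly_ring = 0" "add int_poly_ring = (+)"
  by (simp_all add: int_poly_ring_def)

lemma int_poly_ring_cring: "cring int_poly_ring"
  by (unfold int_poly_ring_def) (auto intro!: cringI abelian_groupI comm_monoidI
    left_minus distrib_right exI[of _ "- x" for x] simp: algebra_simps)

interpretation int_poly: cring int_poly_ring by (rule int_poly_ring_cring)

lemma int_poly_ring_minus [simp]: "a \<ominus>\<^bsub>int_poly_ring\<^esub> b = a - b"
  using int_poly.minus_equality[of "- b" b] by (simp add: int_poly.minus_eq)

abbreviation (input) Zt :: "int poly ring" where
  "Zt \<equiv> int_poly_ring"

abbreviation (input) Rx :: "int poly \<Rightarrow> (int poly set, nat \<Rightarrow> int poly set) up_ring" where
  "Rx h \<equiv> base_polys h"

lemma nat_in_int_poly_ring: "nat_in Zt N = [:int N:]"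
  by (induction N) (simp_all add: int_poly.nat_in_0 int_poly.nat_in_Suc one_pCons)

text \<open>Bezout's identity \<open>u k + v p = 1\<close> provides the inverse of the class of \<open>k\<close>.\<close>

lemma ZFact_prime_field:
  assumes p: "normalization_semidom_class.prime (p :: nat)"
  shows "field (ZFact (int p))"
proof -
  let ?I = "Idl\<^bsub>\<Z>\<^esub> {int p}"
  interpret I: ideal ?I \<Z> by (rule int.genideal_ideal) simp
  interpret c: ring_hom_cring \<Z> "ZFact (int p)" "(+>\<^bsub>\<Z>\<^esub>) ?I"
    unfolding ZFact_def by (rule I.rcos_ring_hom_cring) (rule int_is_cring)
  have ker: "?I +>\<^bsub>\<Z>\<^esub> k = \<zero>\<^bsub>ZFact (int p)\<^esub> \<longleftrightarrow> int p dvd k" for k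
    unfolding ZFact_def by (subst I.rcos_eq_zero_iff) (auto simp: int_Idl dvd_def)
  show ?thesis
  proof (rule c.S.cring_fieldI2)
    have "\<not> int p dvd 1" using p by (metis int_dvd_int_iff of_nat_1 not_prime_unit)
    thus "\<zero>\<^bsub>ZFact (int p)\<^esub> \<noteq> \<one>\<^bsub>ZFact (int p)\<^esub>" using ker[of 1] c.hom_one by auto
    fix a assume a: "a \<in> carrier (ZFact (int p))" "a \<noteq> \<zero>\<^bsub>ZFact (int p)\<^esub>"
    then obtain k where k: "a = ?I +>\<^bsub>\<Z>\<^esub> k"
      using FactRing_surj[where R=\<Z> and I="?I"] by (auto simp: ZFact_def)
    have "\<not> int p dvd k" using ker a k by blast
    moreover have "Factorial_Ring.prime (int p)" using p by simp
    ultimately have "coprime k (int p)" by (metis coprime_commute prime_imp_coprime)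
    then obtain u v where uv: "u * k + v * int p = 1" using bezout_int[of k "int p"] by auto
    have "a \<otimes>\<^bsub>ZFact (int p)\<^esub> (?I +>\<^bsub>\<Z>\<^esub> u) = ?I +>\<^bsub>\<Z>\<^esub> (k * u)" using c.hom_mult[of k u] k by simp
    also have "k * u = 1 + (- v) * int p" using uv by (simp add: algebra_simps)
    also have "?I +>\<^bsub>\<Z>\<^esub> (1 + (- v) * int p) =
      (?I +>\<^bsub>\<Z>\<^esub> 1) \<oplus>\<^bsub>ZFact (int p)\<^esub> (?I +>\<^bsub>\<Z>\<^esub> ((- v) * int p))"
      using c.hom_add[of 1 "(- v) * int p"] by simp
    also have "\<dots> = \<one>\<^bsub>ZFact (int p)\<^esub>" using ker[of "(- v) * int p"] c.hom_one by simp
    finally have "a \<otimes>\<^bsub>ZFact (int p)\<^esub> (?I +>\<^bsub>\<Z>\<^esub> u) = \<one>\<^bsub>ZFact (int p)\<^esub>" .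
    moreover have "?I +>\<^bsub>\<Z>\<^esub> u \<in> carrier (ZFact (int p))" using c.hom_closed[of u] by simp
    ultimately show "\<exists>b\<in>carrier (ZFact (int p)). a \<otimes>\<^bsub>ZFact (int p)\<^esub> b = \<one>\<^bsub>ZFact (int p)\<^esub>" by blast
  qed
qed

lemma coeff_int_poly_hom:
  "ring_hom_cring Zt (UP \<Z>) Polynomial.coeff"
  "range Polynomial.coeff = carrier (UP \<Z>)"
proof -
  interpret Z: UP_cring \<Z> "UP \<Z>" by unfold_locales
  have up: "Polynomial.coeff g \<in> up \<Z>" for g :: "int poly"
    by (intro mem_upI) (auto intro!: exI[of _ "degree g"] simp: bound_def coeff_eq_0)
  have up': "Polynomial.coeff g \<in> carrier (UP \<Z>)" for g :: "int poly" using up by (simp add: UP_def)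
  have coeff: "up_ring.coeff (UP \<Z>) (Polynomial.coeff g) = Polynomial.coeff g" for g :: "int poly"
    using up by (simp add: UP_def)
  show "ring_hom_cring Zt (UP \<Z>) Polynomial.coeff"
  proof (rule ring_hom_cringI[OF int_poly_ring_cring Z.UP_cring], rule ring_hom_memI)
    fix x y :: "int poly"
    have "up_ring.coeff (UP \<Z>) (Polynomial.coeff x \<otimes>\<^bsub>UP \<Z>\<^esub> Polynomial.coeff y) n = Polynomial.coeff (x * y) n" for n
      using up' coeff by (simp add: Polynomial.coeff_mult)
    thus "Polynomial.coeff (x \<otimes>\<^bsub>Zt\<^esub> y) = Polynomial.coeff x \<otimes>\<^bsub>UP \<Z>\<^esub> Polynomial.coeff y"
      using up' coeff by (intro Z.up_eqI) simp_all
    show "Polynomial.coeff (x \<oplus>\<^bsub>Zt\<^esub> y) = Polynomial.coeff x \<oplus>\<^bsub>UP \<Z>\<^esub> Polynomial.coeff y"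
      using up' coeff by (intro Z.up_eqI) simp_all
  next
    show "Polynomial.coeff \<one>\<^bsub>Zt\<^esub> = \<one>\<^bsub>UP \<Z>\<^esub>"
      using up'[of 1] coeff[of 1] by (intro Z.up_eqI) simp_all
  qed (use up' in simp)
  show "range Polynomial.coeff = carrier (UP \<Z>)"
  proof (intro equalityI subsetI)
    fix f assume "f \<in> carrier (UP \<Z>)"
    hence "f \<in> up \<Z>" by (simp add: UP_def)
    then obtain n where "bound (0::int) n f" by (auto simp: up_def)
    hence "Polynomial.coeff (Abs_poly f) = f" by (intro coeff_Abs_poly[of n]) auto
    thus "f \<in> range Polynomial.coeff" by (metis rangeI)
  qed (use up' in auto)
qed

text \<open>Integer polynomials are the polynomials over the ring \<open>\<Z>\<close> of integers, via their coefficient functions; so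
  \<open>mod_prime\<close> is an instance of \<open>map_coeffs\<close>.\<close>

lemma mod_prime_hom:
  "ring_hom_cring Zt (UP (ZFact (int p))) (mod_prime p)"
  "range (mod_prime p) = carrier (UP (ZFact (int p)))"
  "mod_prime p g = \<zero>\<^bsub>UP (ZFact (int p))\<^esub> \<longleftrightarrow> g \<in> PIdl\<^bsub>Zt\<^esub> [:int p:]"
proof -
  let ?I = "Idl\<^bsub>\<Z>\<^esub> {int p}"
  let ?c = "(+>\<^bsub>\<Z>\<^esub>) ?I"
  interpret I: ideal ?I \<Z> by (rule int.genideal_ideal) simp
  interpret c: ring_hom_cring \<Z> "ZFact (int p)" ?c
    unfolding ZFact_def by (rule I.rcos_ring_hom_cring) (rule int_is_cring)
  interpret ZP: UP_cring "ZFact (int p)" "UP (ZFact (int p))" by unfold_locales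
  interpret co: ring_hom_cring Zt "UP \<Z>" Polynomial.coeff by (rule coeff_int_poly_hom)
  have "up_ring.coeff (UP \<Z>) (Polynomial.coeff g) = Polynomial.coeff g" for g :: "int poly"
    using co.hom_closed[of g] by (simp add: UP_def)
  hence eq: "mod_prime p = (\<lambda>g. map_coeffs \<Z> ?c (Polynomial.coeff g))"
    by (intro ext) (simp add: mod_prime_def map_coeffs_def)
  show "ring_hom_cring Zt (UP (ZFact (int p))) (mod_prime p)"
    unfolding eq by (rule ring_hom_cring_comp[OF coeff_int_poly_hom(1) c.map_coeffs_hom])
  have surj: "range ?c = carrier (ZFact (int p))"
    using FactRing_surj[where R=\<Z> and I="?I"] by (simp add: ZFact_def)
  show "range (mod_prime p) = carrier (UP (ZFact (int p)))"
    using c.map_coeffs_surj[OF surj] coeff_int_poly_hom(2) unfolding eq by (metis image_image)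
  have coeff0: "up_ring.coeff (UP (ZFact (int p))) (mod_prime p g) i = ?c (Polynomial.coeff g i)" for i
    using c.map_coeffs_closed(2)[of "Polynomial.coeff g" i] co.hom_closed[of g]
    by (simp add: eq UP_def)
  have cl: "mod_prime p g \<in> carrier (UP (ZFact (int p)))"
    using c.map_coeffs_closed(1)[of "Polynomial.coeff g"] co.hom_closed[of g] by (simp add: eq)
  have ker: "?c k = \<zero>\<^bsub>ZFact (int p)\<^esub> \<longleftrightarrow> int p dvd k" for k
    unfolding ZFact_def by (subst I.rcos_eq_zero_iff) (auto simp: int_Idl dvd_def)
  have "mod_prime p g = \<zero>\<^bsub>UP (ZFact (int p))\<^esub> \<longleftrightarrow> (\<forall>i. int p dvd Polynomial.coeff g i)"
  proof
    assume zero: "mod_prime p g = \<zero>\<^bsub>UP (ZFact (int p))\<^esub>"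
    show "\<forall>i. int p dvd Polynomial.coeff g i"
      unfolding ker[symmetric] coeff0[symmetric] zero by simp
  next
    assume "\<forall>i. int p dvd Polynomial.coeff g i"
    thus "mod_prime p g = \<zero>\<^bsub>UP (ZFact (int p))\<^esub>"
      using coeff0 ker cl by (intro ZP.up_eqI) simp_all
  qed
  also have "\<dots> \<longleftrightarrow> [:int p:] dvd g" by (simp add: const_poly_dvd_iff)
  also have "\<dots> \<longleftrightarrow> g \<in> PIdl\<^bsub>Zt\<^esub> [:int p:]"
    by (auto simp: cgenideal_def dvd_def mult.commute)
  finally show "mod_prime p g = \<zero>\<^bsub>UP (ZFact (int p))\<^esub> \<longleftrightarrow> g \<in> PIdl\<^bsub>Zt\<^esub> [:int p:]" .
qed

lemma base_hom:
  "ring_hom_cring Zt (base_ring h) ((+>\<^bsub>Zt\<^esub>) (PIdl\<^bsub>Zt\<^esub> h))"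
  unfolding base_ring_def
  by (rule ideal.rcos_ring_hom_cring) (rule int_poly.cgenideal_ideal, simp, rule int_poly_ring_cring)

lemma base_cring: "cring (base_ring h)"
  using base_hom by (rule ring_hom_cring.axioms(2))

lemma ppow_ideal: "ideal (ppow_ideal p h e) (base_ring h)"
proof -
  interpret B: cring "base_ring h" by (rule base_cring)
  show ?thesis unfolding ppow_ideal_def by (intro B.cgenideal_ideal B.nat_in_closed)
qed

lemma residue_hom:
  "ring_hom_cring (base_ring h) (residue_ring p h e) ((+>\<^bsub>base_ring h\<^esub>) (ppow_ideal p h e))"
  unfolding residue_ring_def by (rule ideal.rcos_ring_hom_cring[OF ppow_ideal base_cring])

lemma residue_cring: "cring (residue_ring p h e)"
  using residue_hom by (rule ring_hom_cring.axioms(2))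

lemma residue_surj:
  "(+>\<^bsub>base_ring h\<^esub>) (ppow_ideal p h e) ` carrier (base_ring h) = carrier (residue_ring p h e)"
  unfolding residue_ring_def by (rule FactRing_surj)

lemma residue_kernel:
  assumes "x \<in> carrier (base_ring h)"
  shows "ppow_ideal p h e +>\<^bsub>base_ring h\<^esub> x = \<zero>\<^bsub>residue_ring p h e\<^esub> \<longleftrightarrow>
    x \<in> PIdl\<^bsub>base_ring h\<^esub> (nat_in (base_ring h) (p ^ e))"
  unfolding residue_ring_def ideal.rcos_eq_zero_iff[OF ppow_ideal assms] by (simp add: ppow_ideal_def)

text \<open>The composite \<open>\<int>[t] \<rightarrow> R \<rightarrow> R\<^sub>e\<close>, which makes the elements of \<open>R\<^sub>e\<close> accessible as classes of integer
  polynomials.\<close>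

definition int_poly_residue :: "nat \<Rightarrow> int poly \<Rightarrow> nat \<Rightarrow> int poly \<Rightarrow> res" where
  "int_poly_residue p h e g =
     ppow_ideal p h e +>\<^bsub>base_ring h\<^esub> (PIdl\<^bsub>Zt\<^esub> h +>\<^bsub>Zt\<^esub> g)"

lemma int_poly_residue_hom:
  "ring_hom_cring Zt (residue_ring p h e) (int_poly_residue p h e)"
  "range (int_poly_residue p h e) = carrier (residue_ring p h e)"
  "int_poly_residue p h e g = \<zero>\<^bsub>residue_ring p h e\<^esub> \<longleftrightarrow>
     g \<in> Idl\<^bsub>Zt\<^esub> {[:int (p ^ e):], h}"
proof -
  let ?J = "PIdl\<^bsub>Zt\<^esub> h"
  interpret b: ring_hom_cring Zt "base_ring h" "(+>\<^bsub>Zt\<^esub>) ?J" by (rule base_hom)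
  show "ring_hom_cring Zt (residue_ring p h e) (int_poly_residue p h e)"
    using ring_hom_cring_comp[OF base_hom residue_hom] unfolding int_poly_residue_def[abs_def] .
  have surj: "(+>\<^bsub>Zt\<^esub>) ?J ` carrier Zt = carrier (base_ring h)"
    unfolding base_ring_def by (rule FactRing_surj)
  show "range (int_poly_residue p h e) = carrier (residue_ring p h e)"
    using residue_surj[of h p e] unfolding surj[symmetric]
    by (simp add: int_poly_residue_def[abs_def] image_image)
  have ker: "?J +>\<^bsub>Zt\<^esub> x = \<zero>\<^bsub>base_ring h\<^esub> \<longleftrightarrow> x \<in> ?J" for x
    unfolding base_ring_def by (rule ideal.rcos_eq_zero_iff) (simp_all add: int_poly.cgenideal_ideal)
  have "int_poly_residue p h e g = \<zero>\<^bsub>residue_ring p h e\<^esub> \<longleftrightarrow>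
    ?J +>\<^bsub>Zt\<^esub> g \<in> PIdl\<^bsub>base_ring h\<^esub> (nat_in (base_ring h) (p ^ e))"
    unfolding int_poly_residue_def using b.hom_closed[of g] by (subst residue_kernel) simp_all
  also have "nat_in (base_ring h) (p ^ e) = ?J +>\<^bsub>Zt\<^esub> [:int (p ^ e):]"
    using b.hom_nat_in[of "p ^ e"] by (simp add: nat_in_int_poly_ring)
  also have "?J +>\<^bsub>Zt\<^esub> g \<in> PIdl\<^bsub>base_ring h\<^esub> \<dots> \<longleftrightarrow>
    g \<in> Idl\<^bsub>Zt\<^esub> {[:int (p ^ e):], h}"
    using surj ker by (intro b.hom_mem_cgenideal_iff) simp_all
  finally show "int_poly_residue p h e g = \<zero>\<^bsub>residue_ring p h e\<^esub> \<longleftrightarrow>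
     g \<in> Idl\<^bsub>Zt\<^esub> {[:int (p ^ e):], h}" .
qed

text \<open>The kernel \<open>(p, h)\<close> of \<open>\<int>[t] \<rightarrow> R\<^sub>1\<close> does not depend on the order in which the two generators are divided
  out.  Dividing by \<open>p\<close> first leads to a polynomial ring over a field, modulo the irreducible image of \<open>h\<close>.\<close>

lemma residue_field:
  assumes adm: "admissible p h"
  shows "field (residue_ring p h 1)"
proof -
  let ?Z = "UP (ZFact (int p))"
  interpret ZF: field "ZFact (int p)" using adm by (intro ZFact_prime_field) (simp add: admissible_def)
  interpret ZP: UP_field "ZFact (int p)" ?Z by unfold_locales
  interpret ZD: principal_domain ?Z by (rule ZP.UP_principal)
  interpret \<phi>: ring_hom_cring Zt ?Z "mod_prime p" by (rule mod_prime_hom)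
  let ?H = "mod_prime p h"
  have H: "?H \<in> carrier ?Z" using \<phi>.hom_closed[of h] by simp
  have irr: "ring_irreducible\<^bsub>?Z\<^esub> ?H" using adm by (simp add: admissible_def)
  have "?H \<noteq> \<zero>\<^bsub>?Z\<^esub>" "ring_prime\<^bsub>?Z\<^esub> ?H"
    using ZD.primeness_condition[OF H] irr by (simp_all add: ring_irreducible_def)
  hence L: "field (?Z Quot PIdl\<^bsub>?Z\<^esub> ?H)" using ZD.field_iff_prime[of ?H] H by simp
  have idealH: "ideal (PIdl\<^bsub>?Z\<^esub> ?H) ?Z" by (rule ZP.P.cgenideal_ideal[OF H])
  define g where "g x = PIdl\<^bsub>?Z\<^esub> ?H +>\<^bsub>?Z\<^esub> mod_prime p x" for x
  have g: "ring_hom_cring Zt (?Z Quot PIdl\<^bsub>?Z\<^esub> ?H) g"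
    unfolding g_def[abs_def]
    by (rule ring_hom_cring_comp[OF mod_prime_hom(1) ideal.rcos_ring_hom_cring[OF idealH ZP.UP_cring]])
  have gs: "g ` carrier Zt = carrier (?Z Quot PIdl\<^bsub>?Z\<^esub> ?H)"
    using FactRing_surj[of ?Z "PIdl\<^bsub>?Z\<^esub> ?H"] unfolding mod_prime_hom(2)[symmetric] g_def[abs_def]
    by (simp add: image_image)
  have ker: "int_poly_residue p h 1 x = \<zero>\<^bsub>residue_ring p h 1\<^esub> \<longleftrightarrow>
    g x = \<zero>\<^bsub>?Z Quot PIdl\<^bsub>?Z\<^esub> ?H\<^esub>" for x
  proof -
    have "g x = \<zero>\<^bsub>?Z Quot PIdl\<^bsub>?Z\<^esub> ?H\<^esub> \<longleftrightarrow> mod_prime p x \<in> PIdl\<^bsub>?Z\<^esub> ?H"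
      unfolding g_def using \<phi>.hom_closed[of x] by (intro ideal.rcos_eq_zero_iff[OF idealH]) simp
    also have "\<dots> \<longleftrightarrow> x \<in> Idl\<^bsub>Zt\<^esub> {h, [:int p:]}"
      using mod_prime_hom(2,3)[of p] by (intro \<phi>.hom_mem_cgenideal_iff) simp_all
    finally show ?thesis using int_poly_residue_hom(3)[of p h 1 x] by (simp add: insert_commute)
  qed
  show ?thesis
    using field_if_same_kernel[OF int_poly_residue_hom(1) _ g gs ker L] int_poly_residue_hom(2)[of p h 1]
    by simp
qed

text \<open>Each class contains an integer polynomial of degree less than \<open>deg h\<close> with coefficients between \<open>0\<close>
  and \<open>p\<^sup>e - 1\<close>.\<close>

lemma card_residue_ring:
  assumes adm: "admissible p h"
  shows "finite (carrier (residue_ring p h e))"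
    and "card (carrier (residue_ring p h e)) \<le> (p ^ degree h) ^ e"
proof -
  let ?d = "degree h"
  let ?N = "int (p ^ e)"
  let ?A = "{..<?d} \<rightarrow>\<^sub>E {0..<?N}"
  let ?poly = "\<lambda>c. \<Sum>i<?d. Polynomial.monom (c i) i"
  interpret k: ring_hom_cring Zt "residue_ring p h e" "int_poly_residue p h e"
    by (rule int_poly_residue_hom)
  have h: "h \<noteq> 0" "Polynomial.lead_coeff h = 1" using adm by (auto simp: admissible_def)
  have N: "?N > 0" using adm prime_gt_0_nat by (simp add: admissible_def)
  have "carrier (residue_ring p h e) \<subseteq> (\<lambda>c. int_poly_residue p h e (?poly c)) ` ?A"
  proof
    fix x assume "x \<in> carrier (residue_ring p h e)"
    then obtain g where x: "x = int_poly_residue p h e g" using int_poly_residue_hom(2)[of p h e] by auto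
    obtain q r where qr: "pseudo_divmod g h = (q, r)" by fastforce
    have g: "g = h * q + r" "r = 0 \<or> degree r < ?d"
      using pseudo_divmod[OF h(1) qr] h(2) by simp_all
    have r0: "Polynomial.coeff r i = 0" if "\<not> i < ?d" for i using g(2) that by (auto intro: coeff_eq_0)
    define c where "c = restrict (\<lambda>i. Polynomial.coeff r i mod ?N) {..<?d}"
    have coeff: "Polynomial.coeff (?poly c) i = (if i < ?d then Polynomial.coeff r i mod ?N else 0)" for i
      by (simp add: Polynomial.coeff_sum c_def)
    have "[:?N:] dvd (r - ?poly c)"
      unfolding const_poly_dvd_iff using r0 by (auto simp: coeff minus_mod_eq_mult_div)
    then obtain s where "r - ?poly c = [:?N:] * s" by (auto simp: dvd_def)
    hence "g - ?poly c = s * [:?N:] + q * h" using g(1) by (simp add: algebra_simps)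
    hence "g - ?poly c \<in> Idl\<^bsub>Zt\<^esub> {[:?N:], h}"
      by (subst int_poly.genideal_pair) auto
    hence "int_poly_residue p h e (g - ?poly c) = \<zero>\<^bsub>residue_ring p h e\<^esub>"
      using int_poly_residue_hom(3)[of p h e] by simp
    moreover have "int_poly_residue p h e g =
      int_poly_residue p h e (g - ?poly c) \<oplus>\<^bsub>residue_ring p h e\<^esub> int_poly_residue p h e (?poly c)"
      using k.hom_add[of "g - ?poly c" "?poly c"] by simp
    ultimately have "x = int_poly_residue p h e (?poly c)" using k.hom_closed[of "?poly c"] x by simp
    moreover have "c \<in> ?A" using N by (auto simp: c_def)
    ultimately show "x \<in> (\<lambda>c. int_poly_residue p h e (?poly c)) ` ?A" by blast
  qed
  moreover have finA: "finite ?A" by (intro finite_PiE) auto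
  ultimately show "finite (carrier (residue_ring p h e))"
    and "card (carrier (residue_ring p h e)) \<le> (p ^ ?d) ^ e"
  proof -
    assume sub: "carrier (residue_ring p h e) \<subseteq> (\<lambda>c. int_poly_residue p h e (?poly c)) ` ?A"
    show "finite (carrier (residue_ring p h e))" using sub finA by (meson finite_imageI finite_subset)
    have "card (carrier (residue_ring p h e)) \<le> card ?A"
      using sub finA by (meson card_image_le card_mono finite_imageI le_trans)
    also have "card ?A = nat ?N ^ ?d" by (simp add: card_PiE)
    also have "nat ?N = p ^ e" by (rule nat_int)
    finally show "card (carrier (residue_ring p h e)) \<le> (p ^ ?d) ^ e"
      by (simp add: power_mult[symmetric] mult.commute)
  qed
qed

text \<open>\<open>R\<^sub>e\<close> and \<open>R\<close> map onto the field \<open>R\<^sub>1\<close>.  Nontriviality is what makes reduction preserve the degree of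
  monic polynomials.\<close>

lemma residue_nontrivial:
  assumes adm: "admissible p h" and e: "e \<ge> 1"
  shows "\<one>\<^bsub>residue_ring p h e\<^esub> \<noteq> \<zero>\<^bsub>residue_ring p h e\<^esub>"
    and "\<one>\<^bsub>base_ring h\<^esub> \<noteq> \<zero>\<^bsub>base_ring h\<^esub>"
proof -
  interpret B: cring "base_ring h" by (rule base_cring)
  interpret c1: ring_hom_cring "base_ring h" "residue_ring p h 1" "(+>\<^bsub>base_ring h\<^esub>) (ppow_ideal p h 1)"
    by (rule residue_hom)
  interpret c: ring_hom_cring "base_ring h" "residue_ring p h e" "(+>\<^bsub>base_ring h\<^esub>) (ppow_ideal p h e)"
    by (rule residue_hom)
  interpret F: field "residue_ring p h 1" by (rule residue_field[OF adm])
  have pe: "p ^ e = p ^ (e - 1) * p ^ 1" using e by (metis le_add_diff_inverse2 power_add)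
  have 1: "\<one>\<^bsub>base_ring h\<^esub> \<notin> PIdl\<^bsub>base_ring h\<^esub> (nat_in (base_ring h) (p ^ 1))"
    using residue_kernel[of "\<one>\<^bsub>base_ring h\<^esub>" h p 1] F.one_not_zero c1.hom_one by auto
  show "\<one>\<^bsub>residue_ring p h e\<^esub> \<noteq> \<zero>\<^bsub>residue_ring p h e\<^esub>"
  proof
    assume "\<one>\<^bsub>residue_ring p h e\<^esub> = \<zero>\<^bsub>residue_ring p h e\<^esub>"
    hence "\<one>\<^bsub>base_ring h\<^esub> \<in> PIdl\<^bsub>base_ring h\<^esub> (nat_in (base_ring h) (p ^ e))"
      using residue_kernel[of "\<one>\<^bsub>base_ring h\<^esub>" h p e] c.hom_one by auto
    moreover have "nat_in (base_ring h) (p ^ e) \<in> PIdl\<^bsub>base_ring h\<^esub> (nat_in (base_ring h) (p ^ 1))"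
      unfolding pe B.nat_in_mult cgenideal_def using B.nat_in_closed by blast
    hence "PIdl\<^bsub>base_ring h\<^esub> (nat_in (base_ring h) (p ^ e)) \<subseteq> PIdl\<^bsub>base_ring h\<^esub> (nat_in (base_ring h) (p ^ 1))"
      by (intro B.cgenideal_minimal B.cgenideal_ideal B.nat_in_closed)
    ultimately show False using 1 by blast
  qed
  show "\<one>\<^bsub>base_ring h\<^esub> \<noteq> \<zero>\<^bsub>base_ring h\<^esub>"
  proof
    assume "\<one>\<^bsub>base_ring h\<^esub> = \<zero>\<^bsub>base_ring h\<^esub>"
    hence "\<one>\<^bsub>residue_ring p h 1\<^esub> = \<zero>\<^bsub>residue_ring p h 1\<^esub>" using c1.hom_one c1.hom_zero by metis
    thus False using F.one_not_zero by blast
  qed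
qed

lemma reduce_eq_map_coeffs:
  "reduce p h e = map_coeffs (base_ring h) ((+>\<^bsub>base_ring h\<^esub>) (ppow_ideal p h e))"
  by (intro ext) (simp add: reduce_def map_coeffs_def)

lemma reduce_hom:
  "ring_hom_cring (Rx h) (res_polys p h e) (reduce p h e)"
  "reduce p h e ` carrier (Rx h) = carrier (res_polys p h e)"
  "g \<in> carrier (Rx h) \<Longrightarrow> reduce p h e g = \<zero>\<^bsub>res_polys p h e\<^esub> \<longleftrightarrow>
     g \<in> PIdl\<^bsub>Rx h\<^esub> (nat_in (Rx h) (p ^ e))"
proof -
  interpret c: ring_hom_cring "base_ring h" "residue_ring p h e" "(+>\<^bsub>base_ring h\<^esub>) (ppow_ideal p h e)"
    by (rule residue_hom)
  interpret BP: UP_cring "base_ring h" "Rx h" by unfold_locales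
  show "ring_hom_cring (Rx h) (res_polys p h e) (reduce p h e)"
    unfolding reduce_eq_map_coeffs by (rule c.map_coeffs_hom)
  show "reduce p h e ` carrier (Rx h) = carrier (res_polys p h e)"
    unfolding reduce_eq_map_coeffs by (rule c.map_coeffs_surj[OF residue_surj])
  interpret const: ring_hom_cring "base_ring h" "Rx h" "\<lambda>a. up_ring.monom (Rx h) a 0"
    by (rule ring_hom_cringI[OF base_cring BP.UP_cring BP.const_ring_hom])
  assume "g \<in> carrier (Rx h)"
  thus "reduce p h e g = \<zero>\<^bsub>res_polys p h e\<^esub> \<longleftrightarrow>
     g \<in> PIdl\<^bsub>Rx h\<^esub> (nat_in (Rx h) (p ^ e))"
    unfolding reduce_eq_map_coeffs const.hom_nat_in[symmetric]
    by (intro c.map_coeffs_kernel residue_kernel c.R.nat_in_closed)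
qed

lemma reduce_monic:
  assumes "admissible p h" "e \<ge> 1" "monic_in (base_ring h) g"
  shows "monic_in (residue_ring p h e) (reduce p h e g)"
    and "deg (residue_ring p h e) (reduce p h e g) = deg (base_ring h) g"
  unfolding reduce_eq_map_coeffs
  using ring_hom_cring.map_coeffs_monic[OF residue_hom assms(3) residue_nontrivial(1)[OF assms(1,2)]]
  by blast+

lemma reduce_mem_cgenideal_iff:
  assumes "m \<in> carrier (Rx h)" "x \<in> carrier (Rx h)"
  shows "reduce p h e x \<in> PIdl\<^bsub>res_polys p h e\<^esub> (reduce p h e m) \<longleftrightarrow>
    x \<in> Idl\<^bsub>Rx h\<^esub> {m, nat_in (Rx h) (p ^ e)}"
proof -
  interpret r: ring_hom_cring "Rx h" "res_polys p h e" "reduce p h e" by (rule reduce_hom)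
  show ?thesis
    using assms by (intro r.hom_mem_cgenideal_iff reduce_hom(2,3) r.R.nat_in_closed)
qed

section \<open>Binary search\<close>

lemma fst_bind_timed [simp]: "fst (bind_timed c g) = fst (g (fst c))"
  and snd_bind_timed [simp]: "snd (bind_timed c g) = snd c + snd (g (fst c))"
  by (simp_all add: bind_timed_def)

lemma ret_charge_simps [simp]:
  "fst (ret x) = x" "snd (ret x) = 0" "snd (charge t) = t"
  by (simp_all add: ret_def charge_def)

text \<open>The threshold \<open>T\<close> stays in \<open>[l, r + 1]\<close>.  When the interval becomes empty, the last midpoint has just
  become \<open>r + 1\<close> or \<open>l - 1\<close>, so it is \<open>T\<close> or \<open>T - 1\<close>; the final test of \<open>height_search\<close> tells which.  Each round
  shortens the interval, which bounds the number of rounds by its length.\<close>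

lemma search_loop_correct:
  fixes T :: int and C :: real
  assumes P: "\<And>i. lo \<le> i \<Longrightarrow> i \<le> hi \<Longrightarrow> fst (P i) \<longleftrightarrow> T \<le> i"
    and cost: "\<And>i. lo \<le> i \<Longrightarrow> i \<le> hi \<Longrightarrow> real (snd (P i)) \<le> C"
    and C: "C \<ge> 0"
  shows "lo \<le> l \<Longrightarrow> r \<le> hi \<Longrightarrow> l \<le> T \<Longrightarrow> T \<le> r + 1 \<Longrightarrow>
    l \<le> r \<or> (lo \<le> mid \<and> mid \<le> hi \<and> (mid = T \<or> mid + 1 = T)) \<Longrightarrow>
    lo \<le> fst (search_loop P l r mid) \<and> fst (search_loop P l r mid) \<le> hi \<and>
    (fst (search_loop P l r mid) = T \<or> fst (search_loop P l r mid) + 1 = T) \<and>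
    real (snd (search_loop P l r mid)) \<le> real (nat (r - l + 1)) * C"
proof (induction "nat (r - l + 1)" arbitrary: l r mid rule: less_induct)
  case less
  show ?case
  proof (cases "l \<le> r")
    case False
    have eq: "search_loop P l r mid = ret mid" using False by (subst search_loop.simps) simp
    show ?thesis unfolding eq using less.prems(5) False by simp
  next
    case True
    define m where "m = l + (r - l) div 2"
    have m: "l \<le> m" "m \<le> r" using True by (auto simp: m_def)
    have bounds: "lo \<le> m" "m \<le> hi" using m less.prems by linarith+
    have eq: "search_loop P l r mid = bind_timed (P m)
      (\<lambda>b. if b then search_loop P l (m - 1) m else search_loop P (m + 1) r m)"
      using True unfolding m_def by (subst search_loop.simps) (simp add: Let_def)
    show ?thesis
    proof (cases "fst (P m)")
      case pm: True
      hence Tm: "T \<le> m" using P bounds by blast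
      have lt: "nat (m - 1 - l + 1) < nat (r - l + 1)" using m by linarith
      have IH: "lo \<le> fst (search_loop P l (m - 1) m) \<and> fst (search_loop P l (m - 1) m) \<le> hi \<and>
        (fst (search_loop P l (m - 1) m) = T \<or> fst (search_loop P l (m - 1) m) + 1 = T) \<and>
        real (snd (search_loop P l (m - 1) m)) \<le> real (nat (m - 1 - l + 1)) * C"
        using lt less.prems m Tm bounds by (intro less.hyps) auto
      have "real (nat (m - 1 - l + 1)) + 1 \<le> real (nat (r - l + 1))" using lt by linarith
      from mult_right_mono[OF this C]
      have "real (nat (m - 1 - l + 1)) * C + C \<le> real (nat (r - l + 1)) * C"
        by (simp add: algebra_simps)
      with IH cost[OF bounds] pm show ?thesis unfolding eq by simp
    next
      case pm: False
      hence Tm: "m < T" using P bounds by force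
      have lt: "nat (r - (m + 1) + 1) < nat (r - l + 1)" using m by linarith
      have IH: "lo \<le> fst (search_loop P (m + 1) r m) \<and> fst (search_loop P (m + 1) r m) \<le> hi \<and>
        (fst (search_loop P (m + 1) r m) = T \<or> fst (search_loop P (m + 1) r m) + 1 = T) \<and>
        real (snd (search_loop P (m + 1) r m)) \<le> real (nat (r - (m + 1) + 1)) * C"
        using lt less.prems m Tm bounds by (intro less.hyps) auto
      have "real (nat (r - (m + 1) + 1)) + 1 \<le> real (nat (r - l + 1))" using lt by linarith
      from mult_right_mono[OF this C]
      have "real (nat (r - (m + 1) + 1)) * C + C \<le> real (nat (r - l + 1)) * C"
        by (simp add: algebra_simps)
      with IH cost[OF bounds] pm show ?thesis unfolding eq by simp
    qed
  qed
qed

lemma height_search_correct: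
  fixes T e \<tau> :: nat and C :: real
  assumes P: "\<And>i. int \<tau> \<le> i \<Longrightarrow> i \<le> int (e * \<tau>) \<Longrightarrow> fst (P i) \<longleftrightarrow> int T \<le> i"
    and cost: "\<And>i. int \<tau> \<le> i \<Longrightarrow> i \<le> int (e * \<tau>) \<Longrightarrow> real (snd (P i)) \<le> C"
    and T: "\<tau> \<le> T" "T \<le> e * \<tau>" and e: "e \<ge> 1" and C: "C \<ge> 0"
  shows "fst (height_search P e \<tau>) = int T"
    and "real (snd (height_search P e \<tau>)) \<le> real (e * \<tau> + 2) * C"
proof -
  let ?s = "search_loop P (int \<tau>) (int (e * \<tau>)) 0"
  have le: "int \<tau> \<le> int (e * \<tau>)" using T by linarith
  have s: "int \<tau> \<le> fst ?s \<and> fst ?s \<le> int (e * \<tau>) \<and> (fst ?s = int T \<or> fst ?s + 1 = int T) \<and>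
    real (snd ?s) \<le> real (nat (int (e * \<tau>) - int \<tau> + 1)) * C"
    using T le by (intro search_loop_correct[where lo="int \<tau>" and hi="int (e * \<tau>)"] P cost C)
      (auto simp del: of_nat_mult)
  have iff: "fst (P (fst ?s)) \<longleftrightarrow> int T \<le> fst ?s" using s P by blast
  show "fst (height_search P e \<tau>) = int T"
    using s iff unfolding height_search_def by auto
  have "real (nat (int (e * \<tau>) - int \<tau> + 1)) * C \<le> real (e * \<tau> + 1) * C"
    using C le by (intro mult_right_mono) linarith+
  moreover have "real (snd (P (fst ?s))) \<le> C" using s cost by blast
  moreover have "real (snd (height_search P e \<tau>)) = real (snd ?s) + real (snd (P (fst ?s)))"
    by (simp add: height_search_def)
  moreover have "real (e * \<tau> + 2) * C = real (e * \<tau> + 1) * C + C" by (simp add: algebra_simps)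
  ultimately show "real (snd (height_search P e \<tau>)) \<le> real (e * \<tau> + 2) * C"
    using s by linarith
qed

section \<open>Splitting off the prime powers\<close>

text \<open>The residue field is \<open>R\<^sub>e\<close> for \<open>e = 1\<close>; written with \<open>Suc 0\<close> it would no longer match the facts about it.\<close>

declare One_nat_def [simp del]

abbreviation (input) Fq :: "nat \<Rightarrow> int poly \<Rightarrow> res ring" where
  "Fq p h \<equiv> residue_ring p h 1"

abbreviation (input) Fqx :: "nat \<Rightarrow> int poly \<Rightarrow> (res, res_poly) up_ring" where
  "Fqx p h \<equiv> res_polys p h 1"

context
  fixes p :: nat and h :: "int poly" and K :: cost_model and n :: nat and D :: real
  assumes adm: "admissible p h"
    and div_cost: "\<And>a b. a \<in> carrier (Fqx p h) \<Longrightarrow> monic_in (Fq p h) b \<Longrightarrow>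
      deg (Fq p h) a \<le> n \<Longrightarrow> deg (Fq p h) b \<le> n \<Longrightarrow>
      real (div_cost K p h 1 a b) \<le> D"
    and D: "D \<ge> 0"
begin

interpretation Fq: field "Fq p h" by (rule residue_field[OF adm])
interpretation U: UP_field "Fq p h" "Fqx p h" by unfold_locales

text \<open>Each successful division lowers the degree by at least 1, so \<open>deg z\<close> attempts suffice to split off all
  factors \<open>G\<close>; if all of them succeed, then the cofactor is constant.\<close>

lemma strip_correct:
  assumes G: "monic_in (Fq p h) G" "deg (Fq p h) G \<ge> 1" "deg (Fq p h) G \<le> n"
  shows "monic_in (Fq p h) z \<Longrightarrow> deg (Fq p h) z \<le> n \<Longrightarrow> deg (Fq p h) z \<le> b \<Longrightarrow>
    \<exists>w j. fst (strip K p h b G z) = (w, j) \<and> monic_in (Fq p h) w \<and> deg (Fq p h) w \<le> deg (Fq p h) z \<and>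
      z = G [^]\<^bsub>Fqx p h\<^esub> j \<otimes>\<^bsub>Fqx p h\<^esub> w \<and> \<not> G divides\<^bsub>Fqx p h\<^esub> w \<and>
      real (snd (strip K p h b G z)) \<le> real b * D"
proof (induction b arbitrary: z)
  case 0
  have z: "z \<in> carrier (Fqx p h)" using 0(1) by (simp add: U.monic_in_iff)
  have "\<not> G divides\<^bsub>Fqx p h\<^esub> z"
  proof
    assume "G divides\<^bsub>Fqx p h\<^esub> z"
    then obtain c where c: "c \<in> carrier (Fqx p h)" "z = c \<otimes>\<^bsub>Fqx p h\<^esub> G"
      using G(1) U.P.m_comm unfolding factor_def U.monic_in_iff by blast
    have "c \<noteq> \<zero>\<^bsub>Fqx p h\<^esub>" using c G(1) U.monic_nonzero[OF 0(1)] by (auto simp: U.monic_in_iff)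
    hence "deg (Fq p h) z \<ge> 1" using U.deg_mult_monic(1)[OF G(1) c(1)] c(2) G(2) by simp
    thus False using 0(3) by simp
  qed
  thus ?case using 0 z by simp
next
  case (Suc b)
  have z: "z \<in> carrier (Fqx p h)" using Suc.prems(1) by (simp add: U.monic_in_iff)
  have Gc: "G \<in> carrier (Fqx p h)" using G(1) by (simp add: U.monic_in_iff)
  define q r where "q = fst (poly_divmod (Fq p h) z G)" and "r = snd (poly_divmod (Fq p h) z G)"
  note dm = U.poly_divmod_monic[OF G(1) z Fq.one_not_zero, folded q_def r_def]
  have eq: "strip K p h (Suc b) G z = bind_timed (divmod_timed K p h z G)
      (\<lambda>(q, r). if r = \<zero>\<^bsub>Fqx p h\<^esub>
         then bind_timed (strip K p h b G q) (\<lambda>(w, j). ret (w, Suc j)) else ret (z, 0))"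
    by simp
  have dt: "fst (divmod_timed K p h z G) = (q, r)" "snd (divmod_timed K p h z G) = div_cost K p h 1 z G"
    by (simp_all add: divmod_timed_def q_def r_def)
  have cost: "real (div_cost K p h 1 z G) \<le> D" using div_cost[OF z G(1)] Suc.prems G(3) by simp
  show ?case
  proof (cases "r = \<zero>\<^bsub>Fqx p h\<^esub>")
    case False
    have "\<not> G divides\<^bsub>Fqx p h\<^esub> z"
      using U.poly_divmod_snd_zero_iff[OF G(1) z Fq.one_not_zero] False by (simp add: r_def)
    moreover have "strip K p h (Suc b) G z = ((z, 0), div_cost K p h 1 z G)"
      unfolding eq using False dt by (intro prod_eqI) simp_all
    moreover have "D \<le> real (Suc b) * D" using D by (simp add: algebra_simps)
    ultimately show ?thesis using Suc.prems z cost by simp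
  next
    case True
    have zq: "z = q \<otimes>\<^bsub>Fqx p h\<^esub> G" using dm True Gc by simp
    have qm: "monic_in (Fq p h) q"
      using U.monic_mult_iff[OF G(1) dm(1) Fq.one_not_zero] Suc.prems(1) zq by simp
    have degz: "deg (Fq p h) z = deg (Fq p h) q + deg (Fq p h) G" using U.deg_monic_mult(2)[OF qm G(1)] zq by simp
    have "deg (Fq p h) q \<le> n" "deg (Fq p h) q \<le> b" using degz G(2) Suc.prems by linarith+
    from Suc.IH[OF qm this] obtain w j where wj: "fst (strip K p h b G q) = (w, j)"
      "monic_in (Fq p h) w" "deg (Fq p h) w \<le> deg (Fq p h) q"
      "q = G [^]\<^bsub>Fqx p h\<^esub> j \<otimes>\<^bsub>Fqx p h\<^esub> w" "\<not> G divides\<^bsub>Fqx p h\<^esub> w"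
      "real (snd (strip K p h b G q)) \<le> real b * D" by blast
    have wc: "w \<in> carrier (Fqx p h)" using wj(2) by (simp add: U.monic_in_iff)
    have "fst (strip K p h (Suc b) G z) = (w, Suc j)"
      "snd (strip K p h (Suc b) G z) = div_cost K p h 1 z G + snd (strip K p h b G q)"
      unfolding eq using True dt wj(1) by simp_all
    moreover have "z = G [^]\<^bsub>Fqx p h\<^esub> Suc j \<otimes>\<^bsub>Fqx p h\<^esub> w"
      unfolding zq using Gc wc by (subst wj(4)) (simp add: U.P.m_ac)
    ultimately show ?thesis using wj(2,3,5,6) degz cost by (simp add: algebra_simps)
  qed
qed

text \<open>A prime split off earlier does not divide the final cofactor, because this is a divisor of the
  cofactor from which the prime had just been removed.\<close>

lemma coprime_part_correct:
  assumes "distinct (map fst Gs)"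
    and "\<And>G. G \<in> fst ` set Gs \<Longrightarrow> monic_in (Fq p h) G \<and> deg (Fq p h) G \<ge> 1 \<and> deg (Fq p h) G \<le> n"
    and "monic_in (Fq p h) z" "deg (Fq p h) z \<le> n"
  shows "\<exists>\<kappa>. let w = fst (coprime_part_timed K p h Gs z) in
    monic_in (Fq p h) w \<and> deg (Fq p h) w \<le> deg (Fq p h) z \<and>
    z = power_prod (Fqx p h) (set_exponents \<kappa> Gs) \<otimes>\<^bsub>Fqx p h\<^esub> w \<and>
    (\<forall>G\<in>fst ` set Gs. \<not> G divides\<^bsub>Fqx p h\<^esub> w) \<and>
    real (snd (coprime_part_timed K p h Gs z)) \<le> real (length Gs) * real n * D"
  using assms
proof (induction Gs arbitrary: z)
  case Nil
  thus ?case by (simp add: U.monic_in_iff)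
next
  case (Cons Gk Gs)
  define G where "G = fst Gk"
  have G: "monic_in (Fq p h) G" "deg (Fq p h) G \<ge> 1" "deg (Fq p h) G \<le> n" using Cons.prems(2) by (simp_all add: G_def)
  have Gc: "G \<in> carrier (Fqx p h)" using G(1) by (simp add: U.monic_in_iff)
  let ?s = "strip K p h (deg (Fq p h) z) G z"
  obtain w1 j where s: "fst ?s = (w1, j)" "monic_in (Fq p h) w1" "deg (Fq p h) w1 \<le> deg (Fq p h) z"
    "z = G [^]\<^bsub>Fqx p h\<^esub> j \<otimes>\<^bsub>Fqx p h\<^esub> w1" "\<not> G divides\<^bsub>Fqx p h\<^esub> w1"
    "real (snd ?s) \<le> real (deg (Fq p h) z) * D"
    using strip_correct[OF G Cons.prems(3,4) order_refl] by blast
  have "distinct (map fst Gs)" "deg (Fq p h) w1 \<le> n" using Cons.prems s(3) by simp_all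
  moreover have "monic_in (Fq p h) H \<and> deg (Fq p h) H \<ge> 1 \<and> deg (Fq p h) H \<le> n" if "H \<in> fst ` set Gs" for H
    using Cons.prems(2) that by simp
  ultimately obtain \<kappa> where IH: "let w = fst (coprime_part_timed K p h Gs w1) in
    monic_in (Fq p h) w \<and> deg (Fq p h) w \<le> deg (Fq p h) w1 \<and>
    w1 = power_prod (Fqx p h) (set_exponents \<kappa> Gs) \<otimes>\<^bsub>Fqx p h\<^esub> w \<and>
    (\<forall>G\<in>fst ` set Gs. \<not> G divides\<^bsub>Fqx p h\<^esub> w) \<and>
    real (snd (coprime_part_timed K p h Gs w1)) \<le> real (length Gs) * real n * D"
    using Cons.IH[of w1] s(2) by blast
  define w where "w = fst (coprime_part_timed K p h Gs w1)"
  let ?P = "power_prod (Fqx p h) (set_exponents \<kappa> Gs)"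
  note IH = IH[folded w_def, unfolded Let_def]
  have w: "monic_in (Fq p h) w" "deg (Fq p h) w \<le> deg (Fq p h) w1" "w1 = ?P \<otimes>\<^bsub>Fqx p h\<^esub> w"
    "\<forall>G\<in>fst ` set Gs. \<not> G divides\<^bsub>Fqx p h\<^esub> w"
    "real (snd (coprime_part_timed K p h Gs w1)) \<le> real (length Gs) * real n * D"
    using IH by blast+
  have "fst ` set (set_exponents \<kappa> Gs) = fst ` set Gs" by force
  hence Pc: "?P \<in> carrier (Fqx p h)"
    using Cons.prems(2) by (intro U.P.power_prod_closed) (auto simp: U.monic_in_iff)
  have wc: "w \<in> carrier (Fqx p h)" using w(1) by (simp add: U.monic_in_iff)
  have "\<not> G divides\<^bsub>Fqx p h\<^esub> w"
  proof
    assume "G divides\<^bsub>Fqx p h\<^esub> w"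
    moreover have "w divides\<^bsub>Fqx p h\<^esub> w1"
      unfolding w(3) factor_def using wc Pc by (intro bexI[of _ ?P] U.P.m_comm)
    ultimately show False using s(5) U.P.divides_trans[OF _ _ Gc] by blast
  qed
  \<comment> \<open>\<open>G\<close> does not occur in \<open>Gs\<close>, so the exponents found there are unaffected\<close>
  define \<kappa>' where "\<kappa>' = \<kappa>(G := j)"
  have map_eq: "map (\<lambda>(G, k). (G, \<kappa>' G)) Gs = set_exponents \<kappa> Gs"
  proof (intro map_cong refl)
    fix x assume "x \<in> set Gs"
    moreover have "G \<notin> fst ` set Gs" using Cons.prems(1) by (simp add: G_def)
    ultimately have "fst x \<noteq> G" by auto
    thus "(case x of (G, k) \<Rightarrow> (G, \<kappa>' G)) = (case x of (G, k) \<Rightarrow> (G, \<kappa> G))"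
      by (simp add: \<kappa>'_def case_prod_beta)
  qed
  have "z = power_prod (Fqx p h) (map (\<lambda>(G, k). (G, \<kappa>' G)) (Gk # Gs)) \<otimes>\<^bsub>Fqx p h\<^esub> w"
  proof -
    have "map (\<lambda>(G, k). (G, \<kappa>' G)) (Gk # Gs) = (G, j) # set_exponents \<kappa> Gs"
      unfolding list.map map_eq by (simp add: case_prod_beta G_def \<kappa>'_def)
    hence "power_prod (Fqx p h) (map (\<lambda>(G, k). (G, \<kappa>' G)) (Gk # Gs)) =
      G [^]\<^bsub>Fqx p h\<^esub> j \<otimes>\<^bsub>Fqx p h\<^esub> ?P"
      by (simp only: power_prod_Cons fst_conv snd_conv)
    thus ?thesis using s(4) w(3) Gc Pc wc by (simp add: U.P.m_assoc)
  qed
  moreover have cf: "fst (coprime_part_timed K p h (Gk # Gs) z) = w"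
    "snd (coprime_part_timed K p h (Gk # Gs) z) = snd ?s + snd (coprime_part_timed K p h Gs w1)"
    using s(1) by (simp_all add: w_def G_def)
  moreover have "real (deg (Fq p h) z) * D \<le> real n * D" using D Cons.prems(4) by (intro mult_right_mono) simp_all
  hence "real (snd ?s + snd (coprime_part_timed K p h Gs w1)) \<le> real (length (Gk # Gs)) * real n * D"
    using s(6) w(5) by (simp add: algebra_simps)
  ultimately show ?case
    using w s(3) \<open>\<not> G divides\<^bsub>Fqx p h\<^esub> w\<close>
    by (intro exI[of _ \<kappa>']) (simp add: Let_def G_def[symmetric])
qed

lemma quotients_correct:
  assumes "\<And>G k. (G, k) \<in> set Gs \<Longrightarrow> monic_in (Fq p h) G \<and> deg (Fq p h) G \<ge> 1 \<and> deg (Fq p h) G \<le> n \<and>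
      prime (Fqx p h) G"
    and z: "monic_in (Fq p h) z" "deg (Fq p h) z \<le> n"
  shows "fst (quotients_timed K p h Gs z) = map (\<lambda>(G, k). nat \<lceil>real (kappa (Fq p h) G z) / real k\<rceil>) Gs \<and>
    real (snd (quotients_timed K p h Gs z)) \<le> real (length Gs) * real n * D"
  using assms(1)
proof (induction Gs)
  case Nil
  thus ?case by simp
next
  case (Cons Gk Gs)
  define G where "G = fst Gk"
  have "(G, snd Gk) \<in> set (Gk # Gs)" by (simp add: G_def)
  from Cons.prems[OF this]
  have G: "monic_in (Fq p h) G" "deg (Fq p h) G \<ge> 1" "deg (Fq p h) G \<le> n" "prime (Fqx p h) G" by simp_all
  have Gc: "G \<in> carrier (Fqx p h)" using G(1) by (simp add: U.monic_in_iff)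
  let ?s = "strip K p h (deg (Fq p h) z) G z"
  obtain w1 j where s: "fst ?s = (w1, j)" "monic_in (Fq p h) w1"
    "z = G [^]\<^bsub>Fqx p h\<^esub> j \<otimes>\<^bsub>Fqx p h\<^esub> w1" "\<not> G divides\<^bsub>Fqx p h\<^esub> w1"
    "real (snd ?s) \<le> real (deg (Fq p h) z) * D"
    using strip_correct[OF G(1-3) z order_refl] by blast
  have "G \<noteq> \<zero>\<^bsub>Fqx p h\<^esub>" using U.monic_nonzero[OF G(1)] by simp
  hence j: "kappa (Fq p h) G z = j"
    using U.kappa_eq[OF G(4) Gc] s(2-4) by (simp add: U.monic_in_iff)
  have IH: "fst (quotients_timed K p h Gs z) = map (\<lambda>(G, k). nat \<lceil>real (kappa (Fq p h) G z) / real k\<rceil>) Gs \<and>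
    real (snd (quotients_timed K p h Gs z)) \<le> real (length Gs) * real n * D"
    by (rule Cons.IH) (erule Cons.prems[OF list.set_intros(2)])
  have "real (deg (Fq p h) z) * D \<le> real n * D" using D z by (intro mult_right_mono) simp_all
  moreover have "snd (quotients_timed K p h (Gk # Gs) z) = snd ?s + snd (quotients_timed K p h Gs z)"
    using s(1) by (simp add: G_def)
  ultimately have "real (snd (quotients_timed K p h (Gk # Gs) z)) \<le> real (length (Gk # Gs)) * real n * D"
    using IH s(5) by (simp add: algebra_simps)
  moreover have "fst (quotients_timed K p h (Gk # Gs) z) =
      map (\<lambda>(G, k). nat \<lceil>real (kappa (Fq p h) G z) / real k\<rceil>) (Gk # Gs)"
    using s(1) j IH by (simp add: G_def case_prod_beta)
  ultimately show ?case by blast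
qed

end

section \<open>The height modulo powers of the prime\<close>

lemma nat_ceiling_quotient_le_iff:
  assumes "k \<ge> 1"
  shows "nat \<lceil>real a / real k\<rceil> \<le> t \<longleftrightarrow> a \<le> t * k"
proof -
  have "nat \<lceil>real a / real k\<rceil> \<le> t \<longleftrightarrow> real a / real k \<le> real t"
    by (simp add: nat_le_iff ceiling_le_iff)
  also have "\<dots> \<longleftrightarrow> real a \<le> real (t * k)" using assms by (simp add: field_simps)
  finally show ?thesis by (simp only: of_nat_le_iff)
qed

text \<open>The reduction \<open>R[x] \<rightarrow> R\<^sub>e[x]/(m)\<close>; its kernel is the ideal used by \<open>cong_mod\<close>.\<close>

definition quot_class ::
  "nat \<Rightarrow> int poly \<Rightarrow> nat \<Rightarrow> (nat \<Rightarrow> int poly set) \<Rightarrow> (nat \<Rightarrow> int poly set) \<Rightarrow> res_poly set" where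
  "quot_class p h e m x = quot_ideal p h e m +>\<^bsub>res_polys p h e\<^esub> reduce p h e x"

lemma lfds_map_eq_mult:
  "lfds_map p h e f m = (\<lambda>z. quot_class p h e m f \<otimes>\<^bsub>quot_algebra p h e m\<^esub> z)"
  by (intro ext) (simp add: lfds_map_def quot_class_def)

lemma (in cring) mem_cgenideal_iff_divides:
  assumes "a \<in> carrier R"
  shows "x \<in> PIdl a \<longleftrightarrow> a divides x"
  using assms m_comm unfolding cgenideal_def factor_def by auto

context
  fixes p :: nat and h :: "int poly" and f m :: "nat \<Rightarrow> int poly set"
  assumes adm: "admissible p h"
    and f: "monic_in (base_ring h) f" and m: "monic_in (base_ring h) m"
    and deg_m: "1 \<le> deg (base_ring h) m"
begin

interpretation B: cring "base_ring h" by (rule base_cring)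
interpretation BP: UP_cring "base_ring h" "Rx h" by unfold_locales

lemma fm_closed: "f \<in> carrier (Rx h)" "m \<in> carrier (Rx h)"
  using f m by (simp_all add: BP.monic_in_iff)

lemma quot_ideal_ideal: "ideal (quot_ideal p h e m) (res_polys p h e)"
proof -
  interpret r: ring_hom_cring "Rx h" "res_polys p h e" "reduce p h e" by (rule reduce_hom)
  show ?thesis unfolding quot_ideal_def by (intro r.S.cgenideal_ideal r.hom_closed fm_closed)
qed

lemma quot_class_hom: "ring_hom_cring (Rx h) (quot_algebra p h e m) (quot_class p h e m)"
  unfolding quot_class_def[abs_def] quot_algebra_def
  by (rule ring_hom_cring_comp[OF reduce_hom(1) ideal.rcos_ring_hom_cring[OF quot_ideal_ideal]])
     (rule ring_hom_cring.axioms(2)[OF reduce_hom(1)])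

lemma quot_class_zero_iff:
  assumes "x \<in> carrier (Rx h)"
  shows "quot_class p h e m x = \<zero>\<^bsub>quot_algebra p h e m\<^esub> \<longleftrightarrow>
    x \<in> Idl\<^bsub>Rx h\<^esub> {m, nat_in (Rx h) (p ^ e)}"
proof -
  interpret r: ring_hom_cring "Rx h" "res_polys p h e" "reduce p h e" by (rule reduce_hom)
  show ?thesis
    unfolding quot_class_def quot_algebra_def ideal.rcos_eq_zero_iff[OF quot_ideal_ideal r.hom_closed[OF assms]]
    unfolding quot_ideal_def by (rule reduce_mem_cgenideal_iff[OF fm_closed(2) assms])
qed

lemma cong_mod_iff_quot_class:
  assumes "x \<in> carrier (Rx h)" "y \<in> carrier (Rx h)"
  shows "cong_mod p h e m x y \<longleftrightarrow> quot_class p h e m x = quot_class p h e m y"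
proof -
  interpret q: ring_hom_cring "Rx h" "quot_algebra p h e m" "quot_class p h e m"
    by (rule quot_class_hom)
  have "cong_mod p h e m x y \<longleftrightarrow> quot_class p h e m (x \<ominus>\<^bsub>Rx h\<^esub> y) = \<zero>\<^bsub>quot_algebra p h e m\<^esub>"
    unfolding cong_mod_def using assms by (intro quot_class_zero_iff[symmetric]) simp
  also have "\<dots> \<longleftrightarrow> quot_class p h e m x = quot_class p h e m y"
    using assms by (simp add: BP.P.minus_eq) (metis q.S.r_neg q.S.minus_equality q.S.minus_minus q.hom_closed q.S.a_inv_closed)
  finally show ?thesis .
qed

lemma cong_mod_iff_reduce:
  assumes "x \<in> carrier (Rx h)" "y \<in> carrier (Rx h)"
  shows "cong_mod p h e m x y \<longleftrightarrow>
    reduce p h e x \<ominus>\<^bsub>res_polys p h e\<^esub> reduce p h e y \<in> PIdl\<^bsub>res_polys p h e\<^esub> (reduce p h e m)"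
proof -
  interpret r: ring_hom_cring "Rx h" "res_polys p h e" "reduce p h e" by (rule reduce_hom)
  have "reduce p h e x \<ominus>\<^bsub>res_polys p h e\<^esub> reduce p h e y = reduce p h e (x \<ominus>\<^bsub>Rx h\<^esub> y)"
    using assms by (simp add: BP.P.minus_eq r.S.minus_eq)
  thus ?thesis
    unfolding cong_mod_def using reduce_mem_cgenideal_iff[OF fm_closed(2), of "x \<ominus>\<^bsub>Rx h\<^esub> y" p e] assms
    by simp
qed

lemma card_quot_algebra:
  assumes e: "e \<ge> 1"
  shows "finite (carrier (quot_algebra p h e m))"
    and "card (carrier (quot_algebra p h e m)) \<le> (p ^ degree h) ^ (e * deg (base_ring h) m)"
proof -
  interpret S: cring "residue_ring p h e" by (rule residue_cring)
  interpret SP: UP_cring "residue_ring p h e" "res_polys p h e" by unfold_locales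
  note mon = reduce_monic[OF adm e m]
  note fin = card_residue_ring[OF adm, of e]
  note * = SP.card_quotient_monic[OF mon(1) residue_nontrivial(1)[OF adm e] fin(1)]
  show "finite (carrier (quot_algebra p h e m))"
    unfolding quot_algebra_def quot_ideal_def using * mon(2) deg_m by simp
  have "card (carrier (quot_algebra p h e m)) \<le> card (carrier (residue_ring p h e)) ^ deg (base_ring h) m"
    unfolding quot_algebra_def quot_ideal_def using * mon(2) deg_m by simp
  also have "\<dots> \<le> ((p ^ degree h) ^ e) ^ deg (base_ring h) m"
    using fin(2) by (rule power_mono) simp
  finally show "card (carrier (quot_algebra p h e m)) \<le> (p ^ degree h) ^ (e * deg (base_ring h) m)"
    by (simp add: power_mult)
qed

definition lfds_height :: "nat \<Rightarrow> nat" where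
  "lfds_height e = system_height (carrier (quot_algebra p h e m)) (lfds_map p h e f m)"

lemma lfds_height_le_iff:
  assumes e: "e \<ge> 1"
  shows "lfds_height e \<le> t \<longleftrightarrow>
    (\<exists>l\<ge>1. cong_mod p h e m (f [^]\<^bsub>Rx h\<^esub> (t + l)) (f [^]\<^bsub>Rx h\<^esub> t))"
proof -
  interpret q: ring_hom_cring "Rx h" "quot_algebra p h e m" "quot_class p h e m"
    by (rule quot_class_hom)
  show ?thesis
    unfolding lfds_height_def lfds_map_eq_mult
      q.S.system_height_mult_le_iff[OF card_quot_algebra(1)[OF e] q.hom_closed[OF fm_closed(1)]]
    using fm_closed by (simp add: cong_mod_iff_quot_class)
qed

lemma cong_mod_Max_periods_iff:
  assumes e: "e \<ge> 1"
  defines "lmax \<equiv> Max (periods (carrier (quot_algebra p h e m)) (lfds_map p h e f m))"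
  shows "cong_mod p h e m (f [^]\<^bsub>Rx h\<^esub> (t + lmax)) (f [^]\<^bsub>Rx h\<^esub> t) \<longleftrightarrow> lfds_height e \<le> t"
    and "lmax \<le> (p ^ degree h) ^ (e * deg (base_ring h) m)"
proof -
  interpret q: ring_hom_cring "Rx h" "quot_algebra p h e m" "quot_class p h e m"
    by (rule quot_class_hom)
  note fin = card_quot_algebra[OF e]
  show "cong_mod p h e m (f [^]\<^bsub>Rx h\<^esub> (t + lmax)) (f [^]\<^bsub>Rx h\<^esub> t) \<longleftrightarrow> lfds_height e \<le> t"
    unfolding lfds_height_def lmax_def lfds_map_eq_mult
      q.S.pow_add_Max_periods_iff[OF fin(1) q.hom_closed[OF fm_closed(1)], symmetric]
    using fm_closed by (simp add: cong_mod_iff_quot_class)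
  show "lmax \<le> (p ^ degree h) ^ (e * deg (base_ring h) m)"
    unfolding lmax_def lfds_map_eq_mult
    using q.S.Max_periods_mult_le_card[OF fin(1) q.hom_closed[OF fm_closed(1)]] fin(2) by (rule le_trans)
qed

text \<open>The ideal \<open>(m, p\<^sup>e)\<close> is contained in \<open>(m, p)\<close>, so a cycle modulo \<open>p\<^sup>e\<close> gives one modulo \<open>p\<close>.\<close>

lemma lfds_height_lower:
  assumes e: "e \<ge> 1"
  shows "lfds_height 1 \<le> lfds_height e"
proof -
  let ?\<pi> = "nat_in (Rx h)"
  obtain l where l: "l \<ge> 1"
    "cong_mod p h e m (f [^]\<^bsub>Rx h\<^esub> (lfds_height e + l)) (f [^]\<^bsub>Rx h\<^esub> lfds_height e)"
    using lfds_height_le_iff[OF e, of "lfds_height e"] by auto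
  have pe: "p ^ e = p ^ (e - 1) * p ^ 1" using e by (metis le_add_diff_inverse2 power_add)
  have "Idl\<^bsub>Rx h\<^esub> {m, ?\<pi> (p ^ e)} \<subseteq> Idl\<^bsub>Rx h\<^esub> {m, ?\<pi> (p ^ 1)}"
  proof
    fix x assume "x \<in> Idl\<^bsub>Rx h\<^esub> {m, ?\<pi> (p ^ e)}"
    then obtain u v where uv: "u \<in> carrier (Rx h)" "v \<in> carrier (Rx h)"
      "x = u \<otimes>\<^bsub>Rx h\<^esub> m \<oplus>\<^bsub>Rx h\<^esub> v \<otimes>\<^bsub>Rx h\<^esub> ?\<pi> (p ^ e)"
      unfolding BP.P.genideal_pair[OF fm_closed(2) BP.P.nat_in_closed] by blast
    have "x = u \<otimes>\<^bsub>Rx h\<^esub> m \<oplus>\<^bsub>Rx h\<^esub>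
        (v \<otimes>\<^bsub>Rx h\<^esub> ?\<pi> (p ^ (e - 1))) \<otimes>\<^bsub>Rx h\<^esub> ?\<pi> (p ^ 1)"
      unfolding uv(3) pe BP.P.nat_in_mult
      using uv(1,2) by (simp add: BP.P.m_assoc BP.P.nat_in_closed)
    moreover have "v \<otimes>\<^bsub>Rx h\<^esub> ?\<pi> (p ^ (e - 1)) \<in> carrier (Rx h)"
      using uv(2) BP.P.nat_in_closed by blast
    ultimately show "x \<in> Idl\<^bsub>Rx h\<^esub> {m, ?\<pi> (p ^ 1)}"
      unfolding BP.P.genideal_pair[OF fm_closed(2) BP.P.nat_in_closed] using uv(1) by blast
  qed
  with l(2) have "cong_mod p h 1 m (f [^]\<^bsub>Rx h\<^esub> (lfds_height e + l)) (f [^]\<^bsub>Rx h\<^esub> lfds_height e)"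
    unfolding cong_mod_def by blast
  with l(1) show ?thesis by (subst lfds_height_le_iff) auto
qed

text \<open>The \<open>e\<close>-th power of an element of \<open>(m, p)\<close> lies in \<open>(m, p\<^sup>e)\<close>.\<close>

lemma lfds_height_upper:
  assumes e: "e \<ge> 1"
  shows "lfds_height e \<le> e * lfds_height 1"
proof -
  interpret q: ring_hom_cring "Rx h" "quot_algebra p h e m" "quot_class p h e m"
    by (rule quot_class_hom)
  let ?t = "lfds_height 1"
  let ?f = "\<lambda>k::nat. f [^]\<^bsub>Rx h\<^esub> k"
  obtain l where l: "l \<ge> 1" "cong_mod p h 1 m (?f (?t + l)) (?f ?t)"
    using lfds_height_le_iff[of 1 ?t] by auto
  hence "cong_mod p h 1 m (?f ?t) (?f (?t + l))"
    using fm_closed by (simp add: cong_mod_iff_quot_class)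
  hence "?f ?t \<ominus>\<^bsub>Rx h\<^esub> ?f (?t + l) \<in> Idl\<^bsub>Rx h\<^esub> {m, nat_in (Rx h) p}"
    unfolding cong_mod_def by simp
  from BP.P.pow_mem_genideal_pair[OF fm_closed(2) BP.P.nat_in_closed this, of e]
  have "quot_class p h e m ((?f ?t \<ominus>\<^bsub>Rx h\<^esub> ?f (?t + l)) [^]\<^bsub>Rx h\<^esub> e) = \<zero>\<^bsub>quot_algebra p h e m\<^esub>"
    using fm_closed by (subst quot_class_zero_iff) (simp_all add: BP.P.nat_in_power)
  hence "(quot_class p h e m f [^]\<^bsub>quot_algebra p h e m\<^esub> ?t \<ominus>\<^bsub>quot_algebra p h e m\<^esub>
      quot_class p h e m f [^]\<^bsub>quot_algebra p h e m\<^esub> (?t + l)) [^]\<^bsub>quot_algebra p h e m\<^esub> e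
      = \<zero>\<^bsub>quot_algebra p h e m\<^esub>"
    using fm_closed by (simp add: BP.P.minus_eq q.S.minus_eq)
  from q.S.system_height_mult_nilpotent[OF card_quot_algebra(1)[OF e] q.hom_closed[OF fm_closed(1)] l(1) this]
  show ?thesis by (simp add: lfds_height_def lfds_map_eq_mult)
qed

interpretation Fq: field "Fq p h" by (rule residue_field[OF adm])
interpretation U: UP_field "Fq p h" "Fqx p h" by unfold_locales

lemma residue_height_le_iff:
  "lfds_height 1 \<le> t \<longleftrightarrow> (\<exists>l\<ge>1::nat. reduce p h 1 m divides\<^bsub>Fqx p h\<^esub>
     (reduce p h 1 f [^]\<^bsub>Fqx p h\<^esub> t \<otimes>\<^bsub>Fqx p h\<^esub>
       (reduce p h 1 f [^]\<^bsub>Fqx p h\<^esub> l \<ominus>\<^bsub>Fqx p h\<^esub> \<one>\<^bsub>Fqx p h\<^esub>)))"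
proof -
  interpret r: ring_hom_cring "Rx h" "Fqx p h" "reduce p h 1" by (rule reduce_hom)
  have c: "reduce p h 1 f \<in> carrier (Fqx p h)" "reduce p h 1 m \<in> carrier (Fqx p h)"
    using fm_closed by simp_all
  have "cong_mod p h 1 m (f [^]\<^bsub>Rx h\<^esub> (t + l)) (f [^]\<^bsub>Rx h\<^esub> t) \<longleftrightarrow>
      reduce p h 1 m divides\<^bsub>Fqx p h\<^esub>
     (reduce p h 1 f [^]\<^bsub>Fqx p h\<^esub> t \<otimes>\<^bsub>Fqx p h\<^esub>
       (reduce p h 1 f [^]\<^bsub>Fqx p h\<^esub> l \<ominus>\<^bsub>Fqx p h\<^esub> \<one>\<^bsub>Fqx p h\<^esub>))" for l :: nat
  proof -
    have "reduce p h 1 (f [^]\<^bsub>Rx h\<^esub> (t + l)) \<ominus>\<^bsub>Fqx p h\<^esub> reduce p h 1 (f [^]\<^bsub>Rx h\<^esub> t)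
      = reduce p h 1 f [^]\<^bsub>Fqx p h\<^esub> t \<otimes>\<^bsub>Fqx p h\<^esub>
       (reduce p h 1 f [^]\<^bsub>Fqx p h\<^esub> l \<ominus>\<^bsub>Fqx p h\<^esub> \<one>\<^bsub>Fqx p h\<^esub>)"
      using c fm_closed by (simp add: U.P.nat_pow_mult[symmetric] U.P.minus_eq U.P.r_distr U.P.r_minus)
    thus ?thesis
      using fm_closed c by (simp add: cong_mod_iff_reduce U.P.mem_cgenideal_iff_divides)
  qed
  thus ?thesis by (simp add: lfds_height_le_iff)
qed

text \<open>Over the residue field the height is the number \<open>\<tau>\<close> computed by the algorithm, for any factorization of
  \<open>f\<close>.  The maximum of the rounded quotients is at most \<open>t\<close> exactly if \<open>\<kappa> G \<le> t k\<close> for all factors, which is the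
  criterion of \<open>divides_power_prod_period_iff\<close>; its hypothesis is met because the residue system is
  finite.  Since \<open>\<kappa> G\<close> is at most the degree of \<open>m\<close>, so is the height.\<close>

lemma residue_height_formula:
  assumes fac: "is_factorization (Fq p h) Gs (reduce p h 1 f)" and Gs: "Gs \<noteq> []"
    and w: "monic_in (Fq p h) w"
    and coprime: "\<forall>G\<in>fst ` set Gs. \<not> G divides\<^bsub>Fqx p h\<^esub> w"
    and dec: "reduce p h 1 m =
      power_prod (Fqx p h) (set_exponents \<kappa> Gs) \<otimes>\<^bsub>Fqx p h\<^esub> w"
  defines "M2 \<equiv> fst (poly_divmod (Fq p h) (reduce p h 1 m) w)"
  shows "(THE M. is_greatest_coprime_divisor (Fq p h) (reduce p h 1 f) (reduce p h 1 m) M) = w"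
    and "monic_in (Fq p h) M2"
    and "deg (Fq p h) M2 \<le> deg (base_ring h) m"
    and "Max ((\<lambda>(G, k). nat \<lceil>real (kappa (Fq p h) G M2) / real k\<rceil>) ` set Gs) = lfds_height 1"
    and "Max ((\<lambda>(G, k). nat \<lceil>real (kappa (Fq p h) G M2) /
      real (kappa (Fq p h) G (reduce p h 1 f))\<rceil>) ` set Gs) = lfds_height 1"
    and "lfds_height 1 \<le> deg (base_ring h) m"
proof -
  let ?F = "Fq p h" and ?P = "Fqx p h"
  let ?Js = "set_exponents \<kappa> Gs"
  note facts = U.factorization_facts[OF fac]
  have ndvd: "\<And>G. G \<in> fst ` set Gs \<Longrightarrow> \<not> G divides\<^bsub>Fqx p h\<^esub> w"
    using coprime by blast
  show "(THE M. is_greatest_coprime_divisor ?F (reduce p h 1 f) (reduce p h 1 m) M) = w"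
    by (rule U.greatest_coprime_divisor[OF fac w ndvd dec])
  have map_fst: "map fst ?Js = map fst Gs" by auto
  hence set_eq: "fst ` set ?Js = fst ` set Gs" by (metis list.set_map)
  have monJ: "monic_in ?F G" if "G \<in> fst ` set ?Js" for G using that facts(3) unfolding set_eq by blast
  have mon: "monic_in ?F (power_prod ?P ?Js)" using monJ by (rule U.monic_power_prod)
  have wc: "w \<in> carrier ?P" using w by (simp add: U.monic_in_iff)
  have Pc: "power_prod ?P ?Js \<in> carrier ?P" using mon by (simp add: U.monic_in_iff)
  have M2: "M2 = power_prod ?P ?Js" unfolding M2_def dec using U.poly_divmod_exact[OF w Pc] by simp
  show "monic_in ?F M2" unfolding M2 by (rule mon)
  have degm: "deg ?F (reduce p h 1 m) = deg (base_ring h) m"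
    using reduce_monic(2)[OF adm _ m] by simp
  have "deg ?F (reduce p h 1 m) = deg ?F M2 + deg ?F w"
    unfolding dec M2 by (rule U.deg_monic_mult(2)[OF mon w])
  thus degM2: "deg ?F M2 \<le> deg (base_ring h) m" using degm by simp
  have kM2: "kappa ?F G M2 = \<kappa> G" if "(G, k) \<in> set Gs" for G k
  proof -
    have mem: "(G, \<kappa> G) \<in> set ?Js" using that by force
    have "prime ?P G" "G \<in> carrier ?P" using facts(2)[OF that] by simp_all
    from U.kappa_power_prod[OF fac map_fst mem U.UP_one_closed U.prime_not_divides_one[OF this]]
    show ?thesis using Pc M2 by simp
  qed
  have height_iff: "lfds_height 1 \<le> t \<longleftrightarrow> (\<forall>(G, k)\<in>set Gs. \<kappa> G \<le> t * k)" for t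
  proof -
    obtain l0 :: nat where l0: "l0 \<ge> 1" "reduce p h 1 m divides\<^bsub>?P\<^esub>
      (reduce p h 1 f [^]\<^bsub>?P\<^esub> lfds_height 1 \<otimes>\<^bsub>?P\<^esub> (reduce p h 1 f [^]\<^bsub>?P\<^esub> l0 \<ominus>\<^bsub>?P\<^esub> \<one>\<^bsub>?P\<^esub>))"
      using residue_height_le_iff[of "lfds_height 1"] by auto
    show ?thesis
      unfolding residue_height_le_iff
      using domain.divides_power_prod_period_iff[OF U.UP_domain facts(1,2,4) wc ndvd l0(1), of \<kappa> "lfds_height 1" t]
        l0(2) unfolding facts(5) dec by blast
  qed
  have Max_eq: "Max ((\<lambda>(G, k). nat \<lceil>real (kappa ?F G M2) / real (c G k)\<rceil>) ` set Gs) = lfds_height 1"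
    if c: "\<And>G k. (G, k) \<in> set Gs \<Longrightarrow> c G k = k" for c
  proof (rule antisym)
    let ?A = "(\<lambda>(G, k). nat \<lceil>real (kappa ?F G M2) / real (c G k)\<rceil>) ` set Gs"
    have A: "finite ?A" "?A \<noteq> {}" using Gs by simp_all
    have le_iff: "Max ?A \<le> t \<longleftrightarrow> (\<forall>(G, k)\<in>set Gs. \<kappa> G \<le> t * k)" for t
    proof -
      have "Max ?A \<le> t \<longleftrightarrow> (\<forall>(G, k)\<in>set Gs. nat \<lceil>real (kappa ?F G M2) / real (c G k)\<rceil> \<le> t)"
        unfolding Max_le_iff[OF A] by auto
      also have "\<dots> \<longleftrightarrow> (\<forall>(G, k)\<in>set Gs. \<kappa> G \<le> t * k)"
        using nat_ceiling_quotient_le_iff facts(2) kM2 c by (intro ball_cong) auto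
      finally show ?thesis .
    qed
    show "Max ?A \<le> lfds_height 1" using le_iff[of "lfds_height 1"] height_iff[of "lfds_height 1"] by simp
    show "lfds_height 1 \<le> Max ?A" using le_iff[of "Max ?A"] height_iff[of "Max ?A"] by simp
  qed
  show "Max ((\<lambda>(G, k). nat \<lceil>real (kappa ?F G M2) / real k\<rceil>) ` set Gs) = lfds_height 1"
    using Max_eq[of "\<lambda>G k. k"] by simp
  show "Max ((\<lambda>(G, k). nat \<lceil>real (kappa ?F G M2) / real (kappa ?F G (reduce p h 1 f))\<rceil>) ` set Gs) = lfds_height 1"
    using Max_eq[of "\<lambda>G k. kappa ?F G (reduce p h 1 f)"] U.kappa_factor[OF fac] by simp
  have "\<kappa> G \<le> deg (base_ring h) m * k" if Gk: "(G, k) \<in> set Gs" for G k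
  proof -
    have mem: "(G, \<kappa> G) \<in> set ?Js" "G \<in> fst ` set Gs" using Gk by force+
    have "\<kappa> G * 1 \<le> \<kappa> G * deg ?F G" using facts(3)[OF mem(2)] by (intro mult_left_mono) simp_all
    also have "\<dots> \<le> deg ?F M2" unfolding M2 using monJ mem(1) by (rule U.deg_factor_le)
    also have "\<dots> \<le> deg (base_ring h) m * 1" using degM2 by simp
    also have "\<dots> \<le> deg (base_ring h) m * k" using facts(2)[OF Gk] by (intro mult_left_mono) simp_all
    finally show ?thesis by simp
  qed
  thus "lfds_height 1 \<le> deg (base_ring h) m" unfolding height_iff by blast
qed

end

section \<open>Cost estimates\<close>

text \<open>The estimates of \<open>cost_conventions\<close> for fixed parameters, restricted to what the algorithm performs:
  divisions and a factorization over the residue field, and powers over \<open>R\<^sub>e\<close>.\<close>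

definition cost_bounds :: "cost_model \<Rightarrow> real \<Rightarrow> nat \<Rightarrow> int poly \<Rightarrow> nat \<Rightarrow> nat \<Rightarrow> bool" where
  "cost_bounds K c p h e n \<longleftrightarrow>
     (\<forall>a b. a \<in> carrier (Fqx p h) \<and> monic_in (Fq p h) b \<and> deg (Fq p h) a \<le> n \<and> deg (Fq p h) b \<le> n \<longrightarrow>
        real (div_cost K p h 1 a b) \<le> c * real (mult_bound K p h 1 n)) \<and>
     (\<forall>g k m. g \<in> carrier (res_polys p h e) \<and> monic_in (residue_ring p h e) m \<and>
        deg (residue_ring p h e) g < deg (residue_ring p h e) m \<and> deg (residue_ring p h e) m = n \<longrightarrow>
        real (powmod_cost K p h e g k m) \<le> c * real (mult_bound K p h e n) * max 1 (log 2 (real k))) \<and>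
     (\<forall>g. monic_in (Fq p h) g \<and> 1 \<le> deg (Fq p h) g \<and> deg (Fq p h) g \<le> n \<longrightarrow>
        is_factorization (Fq p h) (factorize K p h g) g \<and>
        real (factorize_cost K p h g) \<le>
          c * real n * real (mult_bound K p h 1 n) * log 2 (real n * real (p ^ degree h))) \<and>
     real (mult_bound K p h 1 n) \<le> c * real (mult_bound K p h e n)"

lemma cost_bounds_mono:
  assumes "admissible p h" "1 \<le> n" "cost_bounds K c0 p h e n" "c0 \<le> c"
  shows "cost_bounds K c p h e n"
proof -
  have mono: "c0 * x \<le> c * x" if "x \<ge> 0" for x using assms(4) that by (rule mult_right_mono)
  have "1 \<le> p ^ degree h"
    using assms(1) prime_gt_0_nat[of p] by (simp add: admissible_def Suc_le_eq One_nat_def)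
  hence "1 * 1 \<le> n * p ^ degree h" using assms(2) by (intro mult_le_mono)
  hence "1 \<le> real n * real (p ^ degree h)"
    by (metis mult_1 of_nat_1 of_nat_le_iff of_nat_mult)
  hence log: "0 \<le> log 2 (real n * real (p ^ degree h))" by simp
  note old = assms(3)[unfolded cost_bounds_def]
  show ?thesis
    unfolding cost_bounds_def
  proof (intro conjI allI impI, goal_cases)
    case (1 a b)
    hence "real (div_cost K p h 1 a b) \<le> c0 * real (mult_bound K p h 1 n)" using old by blast
    also have "\<dots> \<le> c * real (mult_bound K p h 1 n)" by (rule mono) simp
    finally show ?case .
  next
    case (2 g k m)
    hence "real (powmod_cost K p h e g k m) \<le> c0 * real (mult_bound K p h e n) * max 1 (log 2 (real k))"
      using old by blast
    also have "\<dots> \<le> c * real (mult_bound K p h e n) * max 1 (log 2 (real k))"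
      by (intro mult_right_mono mono) simp_all
    finally show ?case .
  next
    case (3 g)
    thus ?case using old by blast
  next
    case (4 g)
    hence "real (factorize_cost K p h g) \<le>
        c0 * real n * real (mult_bound K p h 1 n) * log 2 (real n * real (p ^ degree h))"
      using old by blast
    also have "\<dots> \<le> c * real n * real (mult_bound K p h 1 n) * log 2 (real n * real (p ^ degree h))"
      using log by (intro mult_right_mono mono) simp_all
    finally show ?case .
  next
    case 5
    have "real (mult_bound K p h 1 n) \<le> c0 * real (mult_bound K p h e n)" using old by blast
    also have "\<dots> \<le> c * real (mult_bound K p h e n)" by (rule mono) simp
    finally show ?case .
  qed
qed

lemma cost_conventions_bounds:
  assumes "cost_conventions K"
  obtains c where "c \<ge> 1"
    and "\<And>p h e n. admissible p h \<Longrightarrow> 1 \<le> e \<Longrightarrow> 1 \<le> n \<Longrightarrow> cost_bounds K c p h e n"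
proof -
  obtain c0 where conv: "\<And>p h e n. admissible p h \<and> e \<ge> 1 \<and> n \<ge> 1 \<longrightarrow>
     (let S = residue_ring p h e; F = residue_ring p h 1; q = p ^ degree h;
          M = (\<lambda>i. real (mult_bound K p h i n))
      in (\<forall>a b. a \<in> carrier (UP S) \<and> monic_in S b \<and> deg S a \<le> n \<and> deg S b \<le> n \<longrightarrow>
            real (div_cost K p h e a b) \<le> c0 * M e) \<and>
         (\<forall>g k m. g \<in> carrier (UP S) \<and> monic_in S m \<and> deg S g < deg S m \<and> deg S m = n \<longrightarrow>
            real (powmod_cost K p h e g k m) \<le> c0 * M e * max 1 (log 2 (real k))) \<and>
         (\<forall>g. monic_in F g \<and> 1 \<le> deg F g \<and> deg F g \<le> n \<longrightarrow>
            is_factorization F (factorize K p h g) g \<and>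
            real (factorize_cost K p h g) \<le> c0 * real n * M 1 * log 2 (real n * real q)) \<and>
         M 1 \<le> c0 * M e)"
    using assms unfolding cost_conventions_def by blast
  note conv = conv[unfolded Let_def]
  show thesis
  proof (rule that[of "max 1 c0"])
    fix p h e n assume *: "admissible p h" "(1::nat) \<le> e" "(1::nat) \<le> n"
    have "cost_bounds K c0 p h e n"
      unfolding cost_bounds_def using conv[of p h e n] conv[of p h 1 n] * by blast
    from cost_bounds_mono[OF *(1,3) this] show "cost_bounds K (max 1 c0) p h e n" by simp
  qed simp
qed

text \<open>With \<open>N = e n\<close> this bounds the logarithms of all exponents of the search: \<open>i \<le> N < 2\<^sup>N \<le> q\<^sup>N\<close>, so the
  exponent is at most \<open>2 q\<^sup>N\<close>.\<close>

lemma log_exponent_sum_le: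
  fixes q N i l :: nat and L :: real
  assumes q: "q \<ge> 2" "log 2 (real q) \<le> L" and L: "L \<ge> 1" and N: "N \<ge> 1"
    and i: "i \<le> N" and l: "l \<le> q ^ N"
  shows "max 1 (log 2 (real (i + l))) \<le> 2 * real N * L"
proof -
  have NL: "1 * 1 \<le> real N * L" using L N by (intro mult_mono) simp_all
  have "log 2 (real (i + l)) \<le> 2 * real N * L"
  proof (cases "i + l = 0")
    case True
    have "0 \<le> 2 * real N * L" using NL by linarith
    thus ?thesis using True by (simp add: log_def)
  next
    case False
    have "N < 2 ^ N" by (rule less_exp)
    also have "(2::nat) ^ N \<le> q ^ N" using q(1) by (rule power_mono) simp
    finally have "i + l \<le> 2 * q ^ N" using i l by simp
    hence le: "real (i + l) \<le> 2 * real q ^ N"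
      by (metis of_nat_le_iff of_nat_mult of_nat_numeral of_nat_power)
    have pos: "0 < real (i + l)" using False by (metis neq0_conv of_nat_0_less_iff)
    have "log 2 (real (i + l)) \<le> log 2 (2 * real q ^ N)" by (rule log_mono[OF _ pos le]) simp
    also have "\<dots> = 1 + real N * log 2 (real q)" using q(1) by (simp add: log_mult log_nat_power)
    also have "\<dots> \<le> real N * L + real N * L"
      using NL mult_left_mono[OF q(2), of "real N"] by (intro add_mono) simp_all
    finally show ?thesis by (simp add: mult_ac)
  qed
  thus ?thesis using NL by linarith
qed

text \<open>Adds up the costs of the coefficientwise passes, the factorization, the coprime part, the division giving \<open>M\<^sub>2\<close>,
  the exponents in \<open>M\<^sub>2\<close>, and the search; they contribute 4, 1, 1, 1, 1 and 10 times the monomial \<open>c\<^sup>2 L N\<^sup>2 E\<^sup>2 M\<close>.\<close>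

lemma run_cost_arith:
  fixes c M M1 L N E D S t0 t1 t2 t3 t4 t5 \<tau> len :: real
  assumes c: "c \<ge> 1" and M: "M \<ge> 0" "0 \<le> M1" "M1 \<le> c * M" and L: "L \<ge> 1" and N: "N \<ge> 2" and E: "E \<ge> 1"
    and \<tau>: "0 \<le> \<tau>" "\<tau> \<le> N" and len: "0 \<le> len" "len \<le> N"
    and t0: "t0 = 2 * M + 2 * M1"
    and t1: "t1 \<le> c * N * M1 * L"
    and t2: "t2 \<le> len * N * (c * M1)"
    and t3: "t3 \<le> c * M1"
    and t4: "t4 \<le> len * N * (c * M1)"
    and t5: "t5 \<le> (E * \<tau> + 2) * (2 * (c * M * (2 * (E * N) * L)) + M)"
  shows "t0 + t1 + t2 + t3 + t4 + t5 \<le> 18 * c\<^sup>2 * L * (N\<^sup>2 * E\<^sup>2 * M)"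
proof -
  define Y where "Y = c\<^sup>2 * L * (N\<^sup>2 * E\<^sup>2 * M)"
  have pos: "0 \<le> c" "0 \<le> L" "0 \<le> N" "0 \<le> E" using c L N E by linarith+
  have c1: "1 \<le> c\<^sup>2" "c \<le> c\<^sup>2" using c by (simp_all add: self_le_power)
  have N1: "1 \<le> N\<^sup>2" "N \<le> N\<^sup>2" using N by (simp_all add: self_le_power)
  have E1: "1 \<le> E\<^sup>2" "E \<le> E\<^sup>2" using E by (simp_all add: self_le_power)
  \<comment> \<open>every monomial in the costs is dominated by \<open>Y\<close> factor by factor\<close>
  have dom: "a * l * (x * y * M) \<le> Y" if "0 \<le> a" "a \<le> c\<^sup>2" "0 \<le> l" "l \<le> L" "0 \<le> x" "x \<le> N\<^sup>2" "0 \<le> y" "y \<le> E\<^sup>2"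
    for a l x y
    unfolding Y_def using that M(1) pos by (intro mult_mono mult_nonneg_nonneg) auto
  have cM1: "c * M1 \<le> c\<^sup>2 * M"
    using mult_left_mono[OF M(3) pos(1)] by (simp add: power2_eq_square mult.assoc)
  have b0: "t0 \<le> 4 * Y"
    using dom[of 1 1 1 1] dom[of c 1 1 1] c1 L N1 E1 M pos unfolding t0 by simp
  have b1: "t1 \<le> Y"
  proof -
    have "c * N * M1 * L = (c * M1) * (N * L)" by simp
    also have "\<dots> \<le> (c\<^sup>2 * M) * (N * L)" using cM1 pos by (intro mult_right_mono) simp_all
    also have "\<dots> = c\<^sup>2 * L * (N * 1 * M)" by simp
    also have "\<dots> \<le> Y" using c1 L N1 E1 pos by (intro dom) simp_all
    finally show ?thesis using t1 by linarith
  qed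
  have len': "len * N * (c * M1) \<le> Y"
  proof -
    have lenN: "len * N \<le> N * N" using len pos by (intro mult_right_mono)
    have "len * N * (c * M1) \<le> N * N * (c\<^sup>2 * M)"
      by (rule mult_mono[OF lenN cM1]) (use pos M in simp_all)
    also have "\<dots> = c\<^sup>2 * 1 * (N\<^sup>2 * 1 * M)" by (simp add: power2_eq_square)
    also have "\<dots> \<le> Y" using c1 L N1 E1 pos by (intro dom) simp_all
    finally show ?thesis .
  qed
  have b3: "t3 \<le> Y"
    using t3 cM1 dom[of "c\<^sup>2" 1 1 1] c1 L N1 E1 pos by simp
  have b5: "t5 \<le> 10 * Y"
  proof -
    have EN: "2 \<le> E * N" using mult_mono[of 1 E 2 N] E N by simp
    have \<tau>': "E * \<tau> + 2 \<le> 2 * (E * N)" using mult_left_mono[OF \<tau>(2) pos(4)] EN by linarith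
    have one: "1 \<le> c * (E * N * L)"
      using mult_mono[of 1 c 1 "E * N * L"] mult_mono[of 1 "E * N" 1 L] c EN L pos by simp
    have "M \<le> c * (E * N * L) * M" using mult_right_mono[OF one M(1)] by simp
    hence "2 * (c * M * (2 * (E * N) * L)) + M \<le> 5 * (c * (E * N * L) * M)"
      by (simp add: algebra_simps)
    hence "(E * \<tau> + 2) * (2 * (c * M * (2 * (E * N) * L)) + M) \<le> (2 * (E * N)) * (5 * (c * (E * N * L) * M))"
      using \<tau>' pos M \<tau> by (intro mult_mono) simp_all
    also have "\<dots> = 10 * (c * L * (N\<^sup>2 * E\<^sup>2 * M))" by (simp add: power2_eq_square)
    also have "c * L * (N\<^sup>2 * E\<^sup>2 * M) \<le> Y" using c1 pos by (intro dom) simp_all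
    finally show ?thesis using t5 by linarith
  qed
  have "t0 + t1 + t2 + t3 + t4 + t5 \<le> 18 * Y"
    using b0 b1 b3 b5 t2 t4 len' by linarith
  thus ?thesis by (simp add: Y_def)
qed

section \<open>Correctness and running time of the height algorithm\<close>

context
  fixes p :: nat and h :: "int poly" and f m :: "nat \<Rightarrow> int poly set" and e n lmax :: nat
  assumes adm: "admissible p h" and e: "1 \<le> e"
    and f: "monic_in (base_ring h) f" and m: "monic_in (base_ring h) m"
    and deg_f: "1 \<le> deg (base_ring h) f" and deg_fm: "deg (base_ring h) f < deg (base_ring h) m"
  defines "n \<equiv> deg (base_ring h) m"
    and "lmax \<equiv> Max (periods (carrier (quot_algebra p h e m)) (lfds_map p h e f m))"
begin

lemma n_ge: "1 \<le> deg (base_ring h) m" "2 \<le> n"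
  using deg_f deg_fm by (simp_all add: n_def)

interpretation Fq: field "Fq p h" by (rule residue_field[OF adm])
interpretation U: UP_field "Fq p h" "Fqx p h" by unfold_locales

lemmas f_closed = fm_closed(1)[OF adm f m n_ge(1)]

lemma factorization_nonempty:
  assumes "is_factorization (Fq p h) Gs (reduce p h 1 f)"
  shows "Gs \<noteq> []"
proof
  assume "Gs = []"
  hence "reduce p h 1 f = \<one>\<^bsub>Fqx p h\<^esub>" using U.factorization_facts(5)[OF assms] by simp
  thus False using reduce_monic(2)[OF adm _ f, of 1] deg_f by simp
qed

lemma factor_degrees:
  assumes fac: "is_factorization (Fq p h) Gs (reduce p h 1 f)" and G: "G \<in> fst ` set Gs"
  shows "monic_in (Fq p h) G \<and> deg (Fq p h) G \<ge> 1 \<and> deg (Fq p h) G \<le> n"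
proof -
  note facts = U.factorization_facts[OF fac]
  obtain k where k: "(G, k) \<in> set Gs" using G by auto
  have "1 * deg (Fq p h) G \<le> k * deg (Fq p h) G"
    using facts(2)[OF k] by (intro mult_right_mono) simp_all
  also have "\<dots> \<le> deg (Fq p h) (reduce p h 1 f)"
    using U.deg_factor_le[OF _ k] facts(3,5) by simp
  also have "\<dots> \<le> n" using reduce_monic(2)[OF adm _ f, of 1] deg_fm by (simp add: n_def)
  finally show ?thesis using facts(3)[OF G] by simp
qed

lemmas height_bounds =
  lfds_height_lower[OF adm f m n_ge(1) e] lfds_height_upper[OF adm f m n_ge(1) e]

lemma search_test_iff:
  "cong_mod p h e m (f [^]\<^bsub>Rx h\<^esub> (nat i + lmax)) (f [^]\<^bsub>Rx h\<^esub> nat i) \<longleftrightarrow>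
    int (lfds_height p h f m e) \<le> i" if "i \<ge> 0" for i
  using cong_mod_Max_periods_iff(1)[OF adm f m n_ge(1) e, of "nat i"] that
  by (simp add: lmax_def nat_le_iff le_nat_iff)

lemma height_algorithm_correct:
  assumes fac: "is_factorization (Fq p h) Gs (reduce p h 1 f)"
    and w: "monic_in (Fq p h) w"
    and coprime: "\<forall>G\<in>fst ` set Gs. \<not> G divides\<^bsub>Fqx p h\<^esub> w"
    and dec: "reduce p h 1 m =
      power_prod (Fqx p h) (map (\<lambda>(G, k). (G, \<kappa> G)) Gs) \<otimes>\<^bsub>Fqx p h\<^esub> w"
  shows "height_algorithm p h e f m lmax Gs = int (lfds_height p h f m e)"
proof -
  note formula = residue_height_formula[OF adm f m n_ge(1) fac factorization_nonempty[OF fac] w coprime dec]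
  show ?thesis
    unfolding height_algorithm_def Let_def formula(1) formula(5)
    by (rule height_search_correct(1)[where C = 0])
       (use search_test_iff height_bounds e in \<open>simp_all\<close>)
qed

lemma cong_timed_correct:
  assumes i: "i \<ge> 0"
  shows "fst (cong_timed K p h e n (reduce p h e f) (reduce p h e m) lmax i) \<longleftrightarrow>
    int (lfds_height p h f m e) \<le> i"
proof -
  interpret S: cring "residue_ring p h e" by (rule residue_cring)
  interpret SP: UP_cring "residue_ring p h e" "res_polys p h e" by unfold_locales
  interpret r: ring_hom_cring "Rx h" "res_polys p h e" "reduce p h e" by (rule reduce_hom)
  let ?fe = "reduce p h e f"
  have fe: "?fe [^]\<^bsub>res_polys p h e\<^esub> k = reduce p h e (f [^]\<^bsub>Rx h\<^esub> k)" for k :: nat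
    using f_closed by simp
  have "fst (cong_timed K p h e n ?fe (reduce p h e m) lmax i) \<longleftrightarrow>
    snd (poly_divmod (residue_ring p h e) (?fe [^]\<^bsub>res_polys p h e\<^esub> (nat i + lmax)) (reduce p h e m)) =
    snd (poly_divmod (residue_ring p h e) (?fe [^]\<^bsub>res_polys p h e\<^esub> nat i) (reduce p h e m))"
    by (simp add: cong_timed_def powmod_timed_def)
  also have "\<dots> \<longleftrightarrow> cong_mod p h e m (f [^]\<^bsub>Rx h\<^esub> (nat i + lmax)) (f [^]\<^bsub>Rx h\<^esub> nat i)"
    unfolding fe
    using f_closed by (subst SP.poly_divmod_snd_eq_iff[OF reduce_monic(1)[OF adm e m] _ _ residue_nontrivial(1)[OF adm e]])
      (simp_all add: cong_mod_iff_reduce[OF adm f m n_ge(1)] del: r.hom_pow)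
  also have "\<dots> \<longleftrightarrow> int (lfds_height p h f m e) \<le> i" using i by (rule search_test_iff)
  finally show ?thesis .
qed

text \<open>The coprime part computed by the timed algorithm from a factorization also serves as the decomposition of
  \<open>m\<close> for the untimed algorithm started with that factorization.\<close>

lemma timed_run_correct:
  fixes K :: cost_model and c :: real
  assumes c: "c \<ge> 1" and bounds: "cost_bounds K c p h e n"
  shows "is_factorization (Fq p h) Gs (reduce p h 1 f) \<Longrightarrow>
      height_algorithm p h e f m lmax Gs = int (lfds_height p h f m e)"
    and "fst (height_algorithm_timed K p h e f m lmax) = int (lfds_height p h f m e)"
    and "real (snd (height_algorithm_timed K p h e f m lmax)) \<le>
      18 * c\<^sup>2 * log 2 (real n * real e * real (p ^ degree h)) *
        ((real n)\<^sup>2 * (real e)\<^sup>2 * real (mult_bound K p h e n))"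
proof -
  let ?F = "Fq p h" and ?P = "Fqx p h"
  let ?f = "reduce p h 1 f" and ?m = "reduce p h 1 m"
  define q where "q = p ^ degree h"
  define L where "L = log 2 (real n * real e * real q)"
  define M where "M = real (mult_bound K p h e n)"
  define M1 where "M1 = real (mult_bound K p h 1 n)"
  define D where "D = c * M1"
  have D: "D \<ge> 0" using c by (simp add: D_def M1_def)
  have div': "real (div_cost K p h 1 a b) \<le> D"
    if "a \<in> carrier ?P" "monic_in ?F b" "deg ?F a \<le> n" "deg ?F b \<le> n" for a b
    using bounds that unfolding cost_bounds_def D_def M1_def by blast
  have pow: "real (powmod_cost K p h e g k b) \<le> c * M * max 1 (log 2 (real k))"
    if "g \<in> carrier (res_polys p h e)" "monic_in (residue_ring p h e) b"
      "deg (residue_ring p h e) g < deg (residue_ring p h e) b" "deg (residue_ring p h e) b = n" for g k b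
    using bounds that unfolding cost_bounds_def M_def by blast
  have mult: "M1 \<le> c * M" using bounds unfolding cost_bounds_def M_def M1_def by blast
  have fm: "monic_in ?F ?f" "deg ?F ?f = deg (base_ring h) f" "monic_in ?F ?m" "deg ?F ?m = n"
    using reduce_monic[OF adm _ f, of 1] reduce_monic[OF adm _ m, of 1] by (simp_all add: n_def)
  have mP: "?m \<in> carrier ?P" using fm(3) by (simp add: U.monic_in_iff)
  have degfn: "1 \<le> deg ?F ?f" "deg ?F ?f \<le> n" using fm(2) deg_f deg_fm by (simp_all add: n_def)
  have q: "q \<ge> 2"
  proof -
    have p: "p \<ge> 2" and d: "degree h \<ge> 1" using adm prime_ge_2_nat by (auto simp: admissible_def)
    have "p ^ 1 \<le> p ^ degree h" using p d by (intro power_increasing) simp_all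
    thus ?thesis using p by (simp add: q_def)
  qed
  have ne: "1 \<le> n * e" using n_ge e mult_le_mono[of 1 n 1 e] by simp
  have Lq: "log 2 (real q) \<le> L"
  proof -
    have "1 \<le> real n * real e" using mult_mono[of 1 "real n" 1 "real e"] n_ge e by simp
    hence "1 * real q \<le> real n * real e * real q" by (intro mult_right_mono) simp_all
    thus ?thesis using q unfolding L_def by (intro log_mono) simp_all
  qed
  have "log 2 2 \<le> log 2 (real q)" using q by (intro log_mono) simp_all
  hence L: "L \<ge> 1" using Lq by simp
  have Lnq: "log 2 (real n * real q) \<le> L"
  proof -
    have "real n * 1 * real q \<le> real n * real e * real q"
      using e by (intro mult_right_mono mult_left_mono) simp_all
    moreover have "0 < real n * real q" using n_ge q by simp
    ultimately show ?thesis unfolding L_def by (intro log_mono) simp_all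
  qed
  have decomposition: "\<exists>\<kappa>. let w = fst (coprime_part_timed K p h Gs ?m) in
      monic_in ?F w \<and> deg ?F w \<le> deg ?F ?m \<and>
      ?m = power_prod ?P (map (\<lambda>(G, k). (G, \<kappa> G)) Gs) \<otimes>\<^bsub>?P\<^esub> w \<and>
      (\<forall>G\<in>fst ` set Gs. \<not> G divides\<^bsub>?P\<^esub> w) \<and>
      real (snd (coprime_part_timed K p h Gs ?m)) \<le> real (length Gs) * real n * D"
    if "is_factorization ?F Gs ?f" for Gs
    using fm U.factorization_facts(1)[OF that] factor_degrees[OF that]
    by (intro coprime_part_correct[OF adm div' D]) simp_all
  show "height_algorithm p h e f m lmax Gs = int (lfds_height p h f m e)"
    if fac: "is_factorization ?F Gs ?f" for Gs
    using decomposition[OF fac] height_algorithm_correct[OF fac] by (auto simp: Let_def)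
  define Gs where "Gs = factorize K p h ?f"
  have fac: "is_factorization ?F Gs ?f"
    and fac_cost: "real (factorize_cost K p h ?f) \<le> c * real n * M1 * log 2 (real n * real q)"
    using bounds fm(1) degfn unfolding cost_bounds_def Gs_def M1_def q_def by blast+
  note facts = U.factorization_facts[OF fac]
  define w where "w = fst (coprime_part_timed K p h Gs ?m)"
  obtain \<kappa> where w: "monic_in ?F w" "deg ?F w \<le> deg ?F ?m"
    "?m = power_prod ?P (map (\<lambda>(G, k). (G, \<kappa> G)) Gs) \<otimes>\<^bsub>?P\<^esub> w"
    "\<forall>G\<in>fst ` set Gs. \<not> G divides\<^bsub>?P\<^esub> w"
    "real (snd (coprime_part_timed K p h Gs ?m)) \<le> real (length Gs) * real n * D"
    using decomposition[OF fac] unfolding w_def Let_def by blast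
  define M2 where "M2 = fst (poly_divmod ?F ?m w)"
  note formula = residue_height_formula[OF adm f m n_ge(1) fac factorization_nonempty[OF fac] w(1,4,3),
      folded M2_def n_def]
  define \<tau> where "\<tau> = lfds_height p h f m 1"
  have quot: "fst (quotients_timed K p h Gs M2) = map (\<lambda>(G, k). nat \<lceil>real (kappa ?F G M2) / real k\<rceil>) Gs \<and>
    real (snd (quotients_timed K p h Gs M2)) \<le> real (length Gs) * real n * D"
  proof (rule quotients_correct[OF adm div' D _ formula(2,3)])
    fix G k assume Gk: "(G, k) \<in> set Gs"
    hence "G \<in> fst ` set Gs" by force
    thus "monic_in ?F G \<and> deg ?F G \<ge> 1 \<and> deg ?F G \<le> n \<and> prime ?P G"
      using factor_degrees[OF fac] facts(2)[OF Gk] by blast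
  qed
  have Max_ts: "Max (set (fst (quotients_timed K p h Gs M2))) = \<tau>"
    using quot formula(4) by (simp add: \<tau>_def)
  let ?P' = "cong_timed K p h e n (reduce p h e f) (reduce p h e m) lmax"
  define C where "C = 2 * (c * M * (2 * (real e * real n) * L)) + M"
  have C: "C \<ge> 0" using c L by (simp add: C_def M_def)
  have run: "fst (height_algorithm_timed K p h e f m lmax) = fst (height_search ?P' e \<tau>)"
    "snd (height_algorithm_timed K p h e f m lmax) =
      2 * mult_bound K p h e n + 2 * mult_bound K p h 1 n + factorize_cost K p h ?f +
      snd (coprime_part_timed K p h Gs ?m) + div_cost K p h 1 ?m w +
      snd (quotients_timed K p h Gs M2) + snd (height_search ?P' e \<tau>)"
    using Max_ts
    by (simp_all add: height_algorithm_timed_def Let_def n_def[symmetric] factorize_timed_def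
        divmod_timed_def case_prod_beta Gs_def[symmetric] w_def[symmetric] M2_def[symmetric])
  have i_le: "nat i \<le> e * n" if "i \<le> int (e * \<tau>)" for i
  proof -
    have "e * \<tau> \<le> e * n" using formula(6) unfolding \<tau>_def by (rule mult_left_mono) simp
    thus ?thesis using that by linarith
  qed
  have step_cost: "real (snd (?P' i)) \<le> C" if i: "i \<le> int (e * \<tau>)" for i
  proof -
    have single: "real (powmod_cost K p h e (reduce p h e f) (nat i + l) (reduce p h e m)) \<le>
        c * M * (2 * (real e * real n) * L)" if "l \<le> q ^ (e * n)" for l
    proof -
      interpret r: ring_hom_cring "Rx h" "res_polys p h e" "reduce p h e" by (rule reduce_hom)
      have "real (powmod_cost K p h e (reduce p h e f) (nat i + l) (reduce p h e m)) \<le>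
        c * M * max 1 (log 2 (real (nat i + l)))"
        using reduce_monic[OF adm e m] reduce_monic(2)[OF adm e f] deg_fm f_closed
        by (intro pow) (simp_all add: n_def)
      also have "max 1 (log 2 (real (nat i + l))) \<le> 2 * real (e * n) * L"
        using ne i_le[OF i] that by (intro log_exponent_sum_le[OF q Lq L]) (simp_all add: mult.commute)
      hence "c * M * max 1 (log 2 (real (nat i + l))) \<le> c * M * (2 * (real e * real n) * L)"
        using c by (intro mult_left_mono) (simp_all add: M_def)
      finally show ?thesis .
    qed
    have "lmax \<le> q ^ (e * n)"
      using cong_mod_Max_periods_iff(2)[OF adm f m n_ge(1) e] by (simp add: lmax_def q_def n_def)
    from single[OF this] single[of 0] show ?thesis
      by (simp add: cong_timed_def powmod_timed_def C_def M_def)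
  qed
  have search: "fst (height_search ?P' e \<tau>) = int (lfds_height p h f m e)"
    "real (snd (height_search ?P' e \<tau>)) \<le> real (e * \<tau> + 2) * C"
  proof -
    have test: "fst (?P' i) \<longleftrightarrow> int (lfds_height p h f m e) \<le> i" if "int \<tau> \<le> i" for i
      using that by (intro cong_timed_correct) simp
    show "fst (height_search ?P' e \<tau>) = int (lfds_height p h f m e)"
      by (rule height_search_correct(1)[OF test step_cost _ _ e C]) (simp_all add: \<tau>_def height_bounds)
    show "real (snd (height_search ?P' e \<tau>)) \<le> real (e * \<tau> + 2) * C"
      by (rule height_search_correct(2)[OF test step_cost _ _ e C]) (simp_all add: \<tau>_def height_bounds)
  qed
  show "fst (height_algorithm_timed K p h e f m lmax) = int (lfds_height p h f m e)"
    using run(1) search(1) by simp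
  have search_cost: "real (snd (height_search ?P' e \<tau>)) \<le> (real e * real \<tau> + 2) * C"
    using search(2) by (simp add: add.commute)
  have "length Gs \<le> n" using U.length_factorization_le[OF fac] degfn(2) by linarith
  moreover have "\<tau> \<le> n" using formula(6) by (simp add: \<tau>_def)
  moreover have "real (factorize_cost K p h ?f) \<le> c * real n * M1 * L"
  proof -
    have "c * real n * M1 * log 2 (real n * real q) \<le> c * real n * M1 * L"
      using Lnq c by (intro mult_left_mono) (simp_all add: M1_def)
    thus ?thesis using fac_cost by linarith
  qed
  moreover have "real (div_cost K p h 1 ?m w) \<le> c * M1"
    using div'[OF mP w(1)] w(2) fm(4) by (simp add: D_def)
  ultimately have "(2 * M + 2 * M1) + real (factorize_cost K p h ?f) +
      real (snd (coprime_part_timed K p h Gs ?m)) + real (div_cost K p h 1 ?m w) +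
      real (snd (quotients_timed K p h Gs M2)) + real (snd (height_search ?P' e \<tau>))
    \<le> 18 * c\<^sup>2 * L * ((real n)\<^sup>2 * (real e)\<^sup>2 * M)"
    using c mult L n_ge(2) e w(5) quot search_cost
    by (intro run_cost_arith[of c M M1 L "real n" "real e" "real \<tau>" "real (length Gs)"])
       (simp_all add: M_def M1_def D_def C_def)
  thus "real (snd (height_algorithm_timed K p h e f m lmax)) \<le>
      18 * c\<^sup>2 * log 2 (real n * real e * real (p ^ degree h)) *
        ((real n)\<^sup>2 * (real e)\<^sup>2 * real (mult_bound K p h e n))"
    unfolding run(2) by (simp add: M_def M1_def L_def q_def)
qed

end

theorem theorem12:
  fixes K :: cost_model
  assumes conventions: "cost_conventions K"
  shows "\<exists>(C::real) (s::nat). \<forall>(p::nat) (h::int poly) (e::nat) f m.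
    admissible p h \<and> 1 \<le> e \<and> monic_in (base_ring h) f \<and> monic_in (base_ring h) m \<and>
    1 \<le> deg (base_ring h) f \<and> deg (base_ring h) f < deg (base_ring h) m \<longrightarrow>
    (let n = deg (base_ring h) m;
         q = p ^ Polynomial.degree h;
         X = carrier (quot_algebra p h e m);
         \<Gamma> = lfds_map p h e f m;
         lmax = Max (periods X \<Gamma>);
         run = height_algorithm_timed K p h e f m lmax
     in (\<forall>Gs. is_factorization (residue_ring p h 1) Gs (reduce p h 1 f) \<longrightarrow>
           height_algorithm p h e f m lmax Gs = int (system_height X \<Gamma>)) \<and>
        fst run = int (system_height X \<Gamma>) \<and>
        real (snd run) \<le> C * log 2 (real n * real e * real q) ^ s *
          (real n ^ 2 * real e ^ 2 * real (mult_bound K p h e n)))"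
proof -
  obtain c where c: "c \<ge> 1"
    and bounds: "\<And>p h e n. admissible p h \<Longrightarrow> 1 \<le> e \<Longrightarrow> 1 \<le> n \<Longrightarrow> cost_bounds K c p h e n"
    using cost_conventions_bounds[OF conventions] by blast
  show ?thesis
  proof (intro exI[of _ "18 * c\<^sup>2"] exI[of _ "1::nat"] allI impI, elim conjE, goal_cases)
    case (1 p h e f m)
    have n: "1 \<le> deg (base_ring h) m" using 1(5,6) by linarith
    note run = timed_run_correct[OF 1 c bounds[OF 1(1,2) n]]
    show ?case
      unfolding Let_def power_one_right
      unfolding lfds_height_def[OF 1(1,3,4) n, symmetric]
      using run by blast
  qed
qed

end
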